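(* For every real $p>2$ there is a constant $C_p$, depending only on $p$, such that the following holds. Let $N$ be a positive integer and let $\phi_1,\ldots,\phi_N$ be pairwise orthogonal functions on a probability space $(X,\mu)$ satisfying $\|\phi_i\|_\infty\le 1$ for every $i\in[N]$. Then there is a set $S\subset[N]$ with $$|S|=\left\lceil N^{\frac{2}{p}}\right\rceil$$ such that $$\left\|\sum_{i\in S}a_i\phi_i\right\|_p\le C_p\left(\sum_{i\in S}|a_i|^2\right)^{\frac12}\qquad( * )$$ for every choice of complex coefficients $(a_i)_{i\in S}$. Moreover, if $N\ge2$ and $S$ is chosen uniformly at random from all subsets of $[N]$ of cardinality $\lceil N^{2/p}\rceil$, then $( * )$ holds simultaneously for every complex coefficient vector $(a_i)_{i\in S}$ with probability at least $$1-\frac1N.$$ The constant $C_p$ (including in the probability statement) is independent of $N$, the probability space, and the functions.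
   Context: $[N]=\{1,\ldots,N\}$. Functions are complex-valued measurable functions on the probability space $(X,\mu)$. $\|h\|_q=\left(\int_X|h|^q\,d\mu\right)^{1/q}$ for $1\le q<\infty$, and $\|h\|_\infty$ is the essential supremum of $|h|$. Functions $\phi_1,\ldots,\phi_N$ are pairwise orthogonal if $\int_X\phi_i\overline{\phi_j}\,d\mu=0$ whenever $i\neq j$; they are not required to have $L^2$ norm one. Probability refers only to the random choice of the index set $S$. *)

theory Defs
  imports "HOL-Probability.Probability"
begin

text \<open>For \<open>1 \<le> q < \<infinity>\<close>. The Bochner integral is \<open>0\<close> on non-integrable functions, so this is the
  \<open>L\<^sup>q\<close> norm only for \<open>h\<close> in \<open>L\<^sup>q\<close>; below it is applied only to finite linear combinations of
  essentially bounded functions on a probability space.\<close>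

definition Lq_norm :: "real \<Rightarrow> 'a measure \<Rightarrow> ('a \<Rightarrow> complex) \<Rightarrow> real"
  where "Lq_norm q M h = (\<integral>x. cmod (h x) powr q \<partial>M) powr (1 / q)"

definition Linf_norm :: "'a measure \<Rightarrow> ('a \<Rightarrow> complex) \<Rightarrow> ereal"
  where "Linf_norm M h = esssup M (\<lambda>x. ereal (cmod (h x)))"

definition bounded_orthogonal_system :: "'a measure \<Rightarrow> nat \<Rightarrow> (nat \<Rightarrow> 'a \<Rightarrow> complex) \<Rightarrow> bool"
  where "bounded_orthogonal_system M N \<phi> \<longleftrightarrow>
    (\<forall>i\<in>{1..N}. \<phi> i \<in> borel_measurable M \<and> Linf_norm M (\<phi> i) \<le> 1) \<and>
    (\<forall>i\<in>{1..N}. \<forall>j\<in>{1..N}. i \<noteq> j \<longrightarrow> (\<integral>x. \<phi> i x * cnj (\<phi> j x) \<partial>M) = 0)"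

text \<open>Only the values of \<open>a\<close> on \<open>S\<close> matter.\<close>

definition Lambda_p_bound ::
    "real \<Rightarrow> real \<Rightarrow> 'a measure \<Rightarrow> (nat \<Rightarrow> 'a \<Rightarrow> complex) \<Rightarrow> nat set \<Rightarrow> bool"
  where "Lambda_p_bound p C M \<phi> S \<longleftrightarrow>
    (\<forall>a :: nat \<Rightarrow> complex.
      Lq_norm p M (\<lambda>x. \<Sum>i\<in>S. a i * \<phi> i x) \<le> C * sqrt (\<Sum>i\<in>S. (cmod (a i))\<^sup>2))"

definition selections :: "real \<Rightarrow> nat \<Rightarrow> nat set set"
  where "selections p N = {S. S \<subseteq> {1..N} \<and> card S = nat \<lceil>real N powr (2 / p)\<rceil>}"

text \<open>A statement \<open>\<exists>C. \<forall>M :: 'a measure. \<dots>\<close> would allow \<open>C\<close> to depend on the type \<open>'a\<close>. To have one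
  constant for probability spaces over all types, \<open>Lambda_const p\<close> is fixed once, as an arbitrary
  constant that works for the probability spaces over the type \<open>nat \<Rightarrow> complex\<close> (large enough for the
  joint distribution of any sequence \<open>\<phi>\<close>). That such a constant exists is not presupposed: it is
  equivalent to the instance \<open>'a = nat \<Rightarrow> complex\<close> of the statement that \<open>Lambda_const p\<close> works for
  every \<open>M :: 'a measure\<close>.\<close>

definition Lambda_const :: "real \<Rightarrow> real"
  where "Lambda_const p = (SOME C.
    \<forall>(M :: (nat \<Rightarrow> complex) measure) N \<phi>.
      prob_space M \<longrightarrow> 1 \<le> N \<longrightarrow> bounded_orthogonal_system M N \<phi> \<longrightarrow>
        (\<exists>S\<in>selections p N. Lambda_p_bound p C M \<phi> S) \<and>
        (2 \<le> N \<longrightarrow>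
          measure_pmf.prob (pmf_of_set (selections p N)) {S. Lambda_p_bound p C M \<phi> S}
            \<ge> 1 - 1 / real N))"

end

theory Submission
  imports Defs
begin

text \<open>Write \<open>m = |S|\<close>, \<open>\<delta> = m / N\<close>, \<open>f = \<Sum>\<^sub>S a\<^sub>i \<phi>\<^sub>i\<close> with \<open>|a|\<^sub>2 \<le> 1\<close>, and let
  \<open>coef g i\<close> be the \<open>i\<close>-th Fourier coefficient of \<open>g\<close>. Split \<open>f\<close> at the height \<open>T = N powr (3 / (4 p))\<close>. By
  duality each part of \<open>f\<close> is controlled by \<open>\<Sum>\<^sub>S |coef g i|\<^sup>2\<close>, where \<open>g\<close> is a multiple of
  \<open>f |f| powr (p - 2)\<close> restricted to \<open>|f| > T\<close> or \<open>|f| \<le> T\<close>.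

  For the high part, subtract the mean \<open>\<delta> \<Sum>\<^sub>[\<^sub>N\<^sub>] |coef g i|\<^sup>2\<close>, which Bessel's inequality bounds. The difference is a
  quadratic form in \<open>g\<close> whose random kernel has an \<open>L\<^sup>r\<close> norm of order \<open>\<surd>m\<close> up to a factor \<open>N powr (2 / r)\<close>, and
  for large \<open>r\<close> this suffices.

  For the low part, chaining is replaced by mirror descent (an online-learning argument). For
  \<open>\<theta> = 1, 1/2, 1/4, \<dots>\<close> the hypothesis \<open>h\<close> is corrected along some \<open>\<phi>\<^sub>i\<close> with \<open>i \<in> S\<close> as long as
  \<open>|coef (g - h) i| \<ge> \<theta> / 2\<close>. Each correction lowers a bounded potential by a multiple of \<open>\<theta>\<^sup>2\<close>. After \<open>R\<close>
  corrections \<open>h\<close> is one of only \<open>N powr O(R)\<close> functions. By Bessel the set where \<open>|coef h i| \<ge> \<theta> / 2\<close> has size at most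
  \<open>N powr (- c) \<theta> powr (- 2) / \<delta>\<close>, so with high probability it meets \<open>S\<close> in only \<open>O(R + 1)\<close> points, up to a
  negligible term; the union bound costs no logarithm because each additional point of \<open>S\<close> costs a power of \<open>N\<close>.
  The decrease of the potential bounds the resulting sum over all scales \<open>\<theta>\<close>.\<close>

section \<open>Uniformly random subsets of fixed size\<close>

definition nsub :: "nat \<Rightarrow> nat \<Rightarrow> nat set set"
  where "nsub N m = {S. S \<subseteq> {1..N} \<and> card S = m}"

lemma finite_nsub [simp]: "finite (nsub N m)"
  unfolding nsub_def by (rule finite_subset[of _ "Pow {1..N}"]) auto

lemma card_nsub: "card (nsub N m) = N choose m"
  unfolding nsub_def using n_subsets[of "{1..N}" m] by simp

text \<open>The binomial distribution with mean \<open>m\<close> has its mode at \<open>m\<close>. Hence a uniformly random \<open>m\<close>-subset behaves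
  like independent selection with probability \<open>m / N\<close>, up to a harmless factor \<open>N + 1\<close>.\<close>

lemma binomial_mode:
  fixes N m :: nat
  assumes "m \<le> N" "1 \<le> N"
  defines "d \<equiv> real m / real N"
  shows "1 \<le> real (N + 1) * (real (N choose m) * d ^ m * (1 - d) ^ (N - m))"
proof -
  define b where "b k = real (N choose k) * d ^ k * (1 - d) ^ (N - k)" for k
  have d: "0 \<le> d" "d \<le> 1" and dN: "d * real N = real m"
    using assms by (auto simp: d_def divide_simps)
  \<comment> \<open>The ratio of consecutive weights, cleared of denominators so that
    \<open>d = 0\<close> and \<open>d = 1\<close> are included. As \<open>d * N = m\<close>, the two
    factors compared below differ by \<open>m - (k + 1) + d\<close>, which is nonnegative for
    \<open>k < m\<close> and nonpositive for \<open>m \<le> k\<close>.\<close>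
  have b_Suc: "b (Suc k) * real (Suc k) * (1 - d) = b k * (real N - real k) * d" if "k < N" for k
  proof -
    have "Suc k * (N choose Suc k) = (N - k) * (N choose k)"
      using binomial_absorb_comp[of N k] binomial_absorption[of k N] by simp
    then have 1: "real (Suc k) * real (N choose Suc k) = (real N - real k) * real (N choose k)"
      using that by (metis of_nat_diff of_nat_mult less_imp_le)
    have 2: "(1 - d) ^ (N - k) = (1 - d) ^ (N - Suc k) * (1 - d)"
      using that by (metis Suc_diff_Suc power_Suc2)
    have "b (Suc k) * real (Suc k) * (1 - d)
        = (real (Suc k) * real (N choose Suc k)) * d ^ k * d * ((1 - d) ^ (N - Suc k) * (1 - d))"
      by (simp add: b_def)
    then show ?thesis unfolding 1 2[symmetric] by (simp add: b_def mult_ac)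
  qed
  have b_nn: "b k \<ge> 0" for k using d by (simp add: b_def)
  have up: "b k \<le> b (Suc k)" if "k < m" for k
  proof (cases "d = 1")
    case True
    have "m = N" using True dN by simp
    then have "k < N" using that by simp
    then have "b k = 0" using True by (simp add: b_def)
    then show ?thesis using b_nn by simp
  next
    case False
    have "k < N" using that assms by simp
    have "(real N - real k) * d - real (Suc k) * (1 - d) = real m - real (Suc k) + d"
      using dN by (simp add: algebra_simps)
    also have "\<dots> \<ge> 0" using that d by simp
    finally have *: "real (Suc k) * (1 - d) \<le> (real N - real k) * d" by simp
    have "b k * (real (Suc k) * (1 - d)) \<le> b k * ((real N - real k) * d)"
      by (rule mult_left_mono[OF * b_nn])
    also have "\<dots> = b (Suc k) * (real (Suc k) * (1 - d))"
      using b_Suc[OF \<open>k < N\<close>] by (simp only: mult.assoc)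
    finally show ?thesis using False d by (simp add: mult_le_cancel_right)
  qed
  have down: "b (Suc k) \<le> b k" if "m \<le> k" "k < N" for k
  proof (cases "d = 0")
    case True
    then show ?thesis using b_nn by (simp add: b_def)
  next
    case False
    have "(real N - real k) * d - real (Suc k) * (1 - d) = real m - real (Suc k) + d"
      using dN by (simp add: algebra_simps)
    also have "\<dots> \<le> 0" using that d by simp
    finally have *: "(real N - real k) * d \<le> real (Suc k) * (1 - d)" by simp
    have pos: "0 < (real N - real k) * d" using that False d by simp
    have "b (Suc k) * ((real N - real k) * d) \<le> b (Suc k) * (real (Suc k) * (1 - d))"
      by (rule mult_left_mono[OF * b_nn])
    also have "\<dots> = b k * ((real N - real k) * d)"
      using b_Suc[OF \<open>k < N\<close>] by (simp only: mult.assoc)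
    finally show ?thesis using pos by (simp add: mult_le_cancel_right del: mult_pos_pos)
  qed
  have le1: "b k \<le> b m" if "k \<le> m" for k
    using that by (induction rule: inc_induct) (auto intro: order_trans up)
  have le2: "k \<le> N \<Longrightarrow> b k \<le> b m" if "m \<le> k" for k
    using that
  proof (induction k rule: dec_induct)
    case (step n)
    then show ?case using down[of n] by simp
  qed simp
  \<comment> \<open>The \<open>N + 1\<close> weights sum to \<open>1\<close>, and none exceeds
    \<open>b m\<close>.\<close>
  have "1 = (d + (1 - d)) ^ N" by simp
  also have "\<dots> = (\<Sum>k\<le>N. b k)"
    unfolding binomial_ring by (simp add: b_def)
  also have "\<dots> \<le> (\<Sum>k\<le>N. b m)"
    by (rule sum_mono) (use le1 le2 in \<open>metis atMost_iff nle_le\<close>)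
  also have "\<dots> = real (N + 1) * b m" by simp
  finally show ?thesis by (simp add: b_def)
qed

text \<open>Under independent selection with probability \<open>d = m / N\<close> every
  \<open>m\<close>-subset has weight \<open>c = d ^ m * (1 - d) ^ (N - m)\<close>. Dropping the
  cardinality restriction only adds nonnegative terms, and the full sum factorises over
  \<open>i\<close>. Finally \<open>binomial_mode\<close> removes the factor
  \<open>c\<close>.\<close>

lemma nsub_sum_prod_le:
  fixes y :: "nat \<Rightarrow> real"
  assumes "m \<le> N" "1 \<le> N" and y: "\<And>i. i \<in> {1..N} \<Longrightarrow> 0 \<le> y i"
  shows "(\<Sum>S\<in>nsub N m. \<Prod>i\<in>S. y i)
    \<le> real (N + 1) * real (N choose m) * exp (real m / real N * (\<Sum>i=1..N. y i - 1))"
proof -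
  define d where "d = real m / real N"
  have d: "0 \<le> d" "d \<le> 1" using assms by (auto simp: d_def divide_simps)
  define c where "c = d ^ m * (1 - d) ^ (N - m)"
  define Z where "Z = (\<Sum>S\<in>nsub N m. \<Prod>i\<in>S. y i)"
  have c0: "c \<ge> 0" using d by (simp add: c_def)
  have Z0: "Z \<ge> 0" unfolding Z_def by (intro sum_nonneg prod_nonneg) (use y in \<open>auto simp: nsub_def\<close>)
  have "c * Z = (\<Sum>S\<in>nsub N m. (\<Prod>i\<in>S. d * y i) * (\<Prod>i\<in>{1..N} - S. 1 - d))"
    unfolding Z_def sum_distrib_left
  proof (rule sum.cong)
    fix S assume "S \<in> nsub N m"
    then have S: "S \<subseteq> {1..N}" "card S = m" by (auto simp: nsub_def)
    then have "card ({1..N} - S) = N - m"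
      by (subst card_Diff_subset) (auto intro: finite_subset)
    then show "c * prod y S = (\<Prod>i\<in>S. d * y i) * (\<Prod>i\<in>{1..N} - S. 1 - d)"
      using S by (simp add: c_def prod.distrib)
  qed simp
  also have "\<dots> \<le> (\<Sum>S\<in>Pow {1..N}. (\<Prod>i\<in>S. d * y i) * (\<Prod>i\<in>{1..N} - S. 1 - d))"
    by (rule sum_mono2)
      (use y d in \<open>auto simp: nsub_def intro!: mult_nonneg_nonneg prod_nonneg\<close>)
  also have "\<dots> = (\<Prod>i\<in>{1..N}. d * y i + (1 - d))"
    by (rule prod_add[symmetric]) simp
  also have "\<dots> \<le> (\<Prod>i\<in>{1..N}. exp (d * (y i - 1)))"
  proof (rule prod_mono)
    fix i assume i: "i \<in> {1..N}"
    have "d * y i + (1 - d) = 1 + d * (y i - 1)" by (simp add: algebra_simps)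
    also have "\<dots> \<le> exp (d * (y i - 1))" by (rule exp_ge_add_one_self)
    finally have "d * y i + (1 - d) \<le> exp (d * (y i - 1))" .
    then show "0 \<le> d * y i + (1 - d) \<and> d * y i + (1 - d) \<le> exp (d * (y i - 1))"
      using y[OF i] d by simp
  qed
  also have "\<dots> = exp (d * (\<Sum>i=1..N. y i - 1))"
    by (simp add: exp_sum sum_distrib_left)
  finally have cZ: "c * Z \<le> exp (d * (\<Sum>i=1..N. y i - 1))" .
  have "Z \<le> (real (N + 1) * (real (N choose m) * d ^ m * (1 - d) ^ (N - m))) * Z"
    using mult_right_mono[OF binomial_mode[OF assms(1,2)] Z0] by (simp add: d_def)
  also have "\<dots> = real (N + 1) * real (N choose m) * (c * Z)" by (simp add: c_def)
  also have "\<dots> \<le> real (N + 1) * real (N choose m) * exp (d * (\<Sum>i=1..N. y i - 1))"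
    by (rule mult_left_mono[OF cZ]) simp
  finally show ?thesis by (simp add: Z_def d_def)
qed

text \<open>Exponential Markov inequality with weight \<open>y\<close> on \<open>I\<close> and
  \<open>1\<close> elsewhere. Such bounds are kept as counts of subsets until the final conversion
  to a probability.\<close>

lemma nsub_chernoff:
  assumes "m \<le> N" "1 \<le> N" "I \<subseteq> {1..N}" "1 < (y::real)"
  shows "real (card {S\<in>nsub N m. k \<le> real (card (S \<inter> I))})
    \<le> real (N choose m) * (real (N + 1) * y powr (- k) * exp (real m / real N * real (card I) * (y - 1)))"
proof -
  define w where "w i = (if i \<in> I then y else 1)" for i
  have pw: "(\<Prod>i\<in>S. w i) = y powr real (card (S \<inter> I))" if "S \<in> nsub N m" for S
  proof -
    have "finite S" using that by (auto simp: nsub_def intro: finite_subset)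
    then show ?thesis using assms
      by (simp add: w_def prod.If_cases powr_realpow)
  qed
  have fI: "finite I" using assms finite_subset by auto
  have sw: "(\<Sum>i=1..N. w i - 1) = real (card I) * (y - 1)"
  proof -
    have "(\<Sum>i=1..N. w i - 1) = (\<Sum>i\<in>{1..N}. if i \<in> I then y - 1 else 0)"
      by (rule sum.cong) (auto simp: w_def)
    also have "\<dots> = real (card ({1..N} \<inter> I)) * (y - 1)"
      by (simp add: sum.If_cases Int_def)
    also have "{1..N} \<inter> I = I" using assms by auto
    finally show ?thesis .
  qed
  have "real (card {S\<in>nsub N m. k \<le> real (card (S \<inter> I))}) * y powr k
      = (\<Sum>S | S \<in> nsub N m \<and> k \<le> real (card (S \<inter> I)). y powr k)" by simp
  also have "\<dots> \<le> (\<Sum>S | S \<in> nsub N m \<and> k \<le> real (card (S \<inter> I)). \<Prod>i\<in>S. w i)"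
    by (rule sum_mono) (use assms in \<open>simp add: pw\<close>)
  also have "\<dots> \<le> (\<Sum>S\<in>nsub N m. \<Prod>i\<in>S. w i)"
    by (rule sum_mono2) (use assms in \<open>auto intro!: prod_nonneg simp: w_def\<close>)
  also have "\<dots> \<le> real (N + 1) * real (N choose m) * exp (real m / real N * (\<Sum>i=1..N. w i - 1))"
    by (rule nsub_sum_prod_le) (use assms in \<open>auto simp: w_def\<close>)
  finally have *: "real (card {S\<in>nsub N m. k \<le> real (card (S \<inter> I))}) * y powr k
    \<le> real (N + 1) * real (N choose m) * exp (real m / real N * (real (card I) * (y - 1)))"
    unfolding sw .
  have "real (card {S\<in>nsub N m. k \<le> real (card (S \<inter> I))})
    = real (card {S\<in>nsub N m. k \<le> real (card (S \<inter> I))}) * y powr k * y powr (- k)"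
    using assms by (simp add: powr_minus)
  also have "\<dots> \<le> real (N + 1) * real (N choose m) * exp (real m / real N * (real (card I) * (y - 1))) * y powr (- k)"
    by (rule mult_right_mono[OF *]) simp
  finally show ?thesis by (simp add: mult_ac)
qed

lemma exp_le_quadratic:
  fixes t :: real
  assumes "\<bar>t\<bar> \<le> 1"
  shows "exp t \<le> 1 + t + t\<^sup>2"
proof (cases "t \<ge> 0")
  case True
  then show ?thesis using exp_bound[of t] assms by simp
next
  case False
  define s where "s = - t"
  have s: "0 \<le> s" "s \<le> 1" using False assms by (auto simp: s_def)
  \<comment> \<open>The product equals \<open>1 + s ^ 3\<close>.\<close>
  have "1 \<le> (1 - s + s\<^sup>2) * (1 + s)"
    using s by (simp add: algebra_simps power2_eq_square)
  also have "\<dots> \<le> (1 - s + s\<^sup>2) * exp s"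
    by (rule mult_left_mono[OF exp_ge_add_one_self]) (use s in simp)
  finally have "exp (- s) \<le> 1 - s + s\<^sup>2"
    by (simp add: exp_minus divide_simps)
  then show ?thesis by (simp add: s_def)
qed

text \<open>Centring cancels the linear term of the exponent; what remains is \<open>d\<close> times
  the sum of \<open>exp (l * c i) - 1 - l * c i\<close>, at most
  \<open>d * N * l\<^sup>2 = l\<^sup>2 * m \<le> 1\<close>.\<close>

lemma nsub_exp_sum_le:
  fixes c :: "nat \<Rightarrow> real"
  assumes "m \<le> N" "1 \<le> m" and c: "\<And>i. i \<in> {1..N} \<Longrightarrow> \<bar>c i\<bar> \<le> 1" and l: "l\<^sup>2 * real m \<le> 1"
  shows "(\<Sum>S\<in>nsub N m. exp (l * (\<Sum>i=1..N. (of_bool (i \<in> S) - real m / real N) * c i)))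
    \<le> real (N choose m) * (real (N + 1) * exp 1)"
proof -
  define d where "d = real m / real N"
  have N: "1 \<le> N" using assms by simp
  have d0: "d \<ge> 0" by (simp add: d_def)
  have "l\<^sup>2 * 1 \<le> l\<^sup>2 * real m" using assms by (intro mult_left_mono) auto
  then have l1: "\<bar>l\<bar> \<le> 1" using l abs_square_le_1[of l] by simp
  have eq: "exp (l * (\<Sum>i=1..N. (of_bool (i \<in> S) - d) * c i))
      = exp (- (d * (\<Sum>i=1..N. l * c i))) * (\<Prod>i\<in>S. exp (l * c i))" if S: "S \<in> nsub N m" for S
  proof -
    have S': "S \<subseteq> {1..N}" and fS: "finite S" using S by (auto simp: nsub_def intro: finite_subset)
    have "(\<Sum>i=1..N. (of_bool (i \<in> S) - d) * c i)
      = (\<Sum>i=1..N. (if i \<in> S then c i else 0)) - d * (\<Sum>i=1..N. c i)"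
      unfolding sum_distrib_left sum_subtractf[symmetric]
      by (rule sum.cong) (auto simp: algebra_simps)
    also have "(\<Sum>i=1..N. (if i \<in> S then c i else 0)) = (\<Sum>i\<in>S. c i)"
      using S' by (simp add: sum.If_cases Int_absorb1 Int_def[symmetric])
    finally have "l * (\<Sum>i=1..N. (of_bool (i \<in> S) - d) * c i)
        = - (d * (\<Sum>i=1..N. l * c i)) + (\<Sum>i\<in>S. l * c i)"
      unfolding sum_distrib_left[symmetric] by (simp add: right_diff_distrib)
    then show ?thesis by (simp only: exp_add exp_sum[OF fS])
  qed
  have "(\<Sum>S\<in>nsub N m. exp (l * (\<Sum>i=1..N. (of_bool (i \<in> S) - d) * c i)))
    = exp (- (d * (\<Sum>i=1..N. l * c i))) * (\<Sum>S\<in>nsub N m. \<Prod>i\<in>S. exp (l * c i))"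
    using eq by (simp add: sum_distrib_left)
  also have "\<dots> \<le> exp (- (d * (\<Sum>i=1..N. l * c i))) *
      (real (N + 1) * real (N choose m) * exp (d * (\<Sum>i=1..N. exp (l * c i) - 1)))"
    unfolding d_def by (intro mult_left_mono nsub_sum_prod_le) (use assms N in auto)
  also have "\<dots> = real (N + 1) * real (N choose m) *
      exp (d * ((\<Sum>i=1..N. exp (l * c i) - 1) - (\<Sum>i=1..N. l * c i)))"
    by (simp add: right_diff_distrib exp_diff exp_minus divide_simps)
  also have "\<dots> \<le> real (N + 1) * real (N choose m) * exp 1"
  proof -
    have "(\<Sum>i=1..N. exp (l * c i) - 1) - (\<Sum>i=1..N. l * c i) = (\<Sum>i=1..N. exp (l * c i) - 1 - l * c i)"
      by (simp add: sum_subtractf)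
    also have "\<dots> \<le> (\<Sum>i=1..N. l\<^sup>2)"
    proof (rule sum_mono)
      fix i assume i: "i \<in> {1..N}"
      have c1: "\<bar>c i\<bar> \<le> 1" by (rule c[OF i])
      have "\<bar>l * c i\<bar> \<le> 1" using l1 c1 by (simp add: abs_mult mult_le_one)
      from exp_le_quadratic[OF this]
      have "exp (l * c i) - 1 - l * c i \<le> l\<^sup>2 * (c i)\<^sup>2" by (simp add: power_mult_distrib)
      also have "\<dots> \<le> l\<^sup>2 * 1"
        using c1 by (intro mult_left_mono) (auto simp: abs_square_le_1)
      finally show "exp (l * c i) - 1 - l * c i \<le> l\<^sup>2" by simp
    qed
    finally have "d * ((\<Sum>i=1..N. exp (l * c i) - 1) - (\<Sum>i=1..N. l * c i)) \<le> d * (\<Sum>i=1..N. l\<^sup>2)"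
      using d0 by (rule mult_left_mono)
    also have "\<dots> = l\<^sup>2 * real m" using N by (simp add: d_def)
    also have "\<dots> \<le> 1" by (rule l)
    finally show ?thesis by (intro mult_left_mono) auto
  qed
  finally show ?thesis by (simp add: d_def mult_ac)
qed

text \<open>Compares \<open>x ^ r / fact r\<close> with \<open>exp x\<close> at
  \<open>x = \<bar>X\<bar> / sqrt m\<close>; the parameters \<open>1 / sqrt m\<close> and
  \<open>- 1 / sqrt m\<close> are the extreme ones that \<open>nsub_exp_sum_le\<close>
  admits.\<close>

lemma nsub_moment_le:
  fixes c :: "nat \<Rightarrow> real"
  assumes "m \<le> N" "1 \<le> m" and c: "\<And>i. i \<in> {1..N} \<Longrightarrow> \<bar>c i\<bar> \<le> 1"
  shows "(\<Sum>S\<in>nsub N m. \<bar>\<Sum>i=1..N. (of_bool (i \<in> S) - real m / real N) * c i\<bar> ^ r)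
    \<le> real (N choose m) * (2 * exp 1 * real (N + 1) * fact r * sqrt (real m) ^ r)"
proof -
  define X where "X S = (\<Sum>i=1..N. (of_bool (i \<in> S) - real m / real N) * c i)" for S
  define s where "s = sqrt (real m)"
  have s: "s > 0" using assms by (simp add: s_def)
  have s2: "(1 / s)\<^sup>2 * real m \<le> 1" "(- (1 / s))\<^sup>2 * real m \<le> 1" using assms by (auto simp: s_def power_divide)
  have "\<bar>X S\<bar> ^ r \<le> fact r * s ^ r * (exp ((1 / s) * X S) + exp (- (1 / s) * X S))" for S
  proof -
    define x where "x = \<bar>X S\<bar> / s"
    have x: "x \<ge> 0" using s by (simp add: x_def)
    have "x ^ r / fact r \<le> exp x"
    proof -
      have "(\<Sum>n\<in>{r}. x ^ n /\<^sub>R fact n) \<le> (\<Sum>n. x ^ n /\<^sub>R fact n)"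
        using summable_exp_generic[of x] x by (intro sum_le_suminf) auto
      then show ?thesis by (simp add: exp_def divide_inverse mult.commute)
    qed
    also have "exp x \<le> exp ((1 / s) * X S) + exp (- (1 / s) * X S)"
      by (cases "X S \<ge> 0") (auto simp: x_def)
    finally have "x ^ r \<le> fact r * (exp ((1 / s) * X S) + exp (- (1 / s) * X S))"
      by (simp add: divide_simps mult.commute)
    then have "s ^ r * x ^ r \<le> s ^ r * (fact r * (exp ((1 / s) * X S) + exp (- (1 / s) * X S)))"
      using s by (intro mult_left_mono) auto
    moreover have "s ^ r * x ^ r = \<bar>X S\<bar> ^ r"
      using s by (simp add: x_def power_mult_distrib[symmetric])
    ultimately show ?thesis by (simp add: mult_ac)
  qed
  then have "(\<Sum>S\<in>nsub N m. \<bar>X S\<bar> ^ r)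
    \<le> (\<Sum>S\<in>nsub N m. fact r * s ^ r * (exp ((1 / s) * X S) + exp (- (1 / s) * X S)))"
    by (rule sum_mono)
  also have "\<dots> = fact r * s ^ r * ((\<Sum>S\<in>nsub N m. exp ((1 / s) * X S)) + (\<Sum>S\<in>nsub N m. exp (- (1 / s) * X S)))"
    by (simp only: sum_distrib_left[symmetric] sum.distrib)
  also have "\<dots> \<le> fact r * s ^ r * (real (N choose m) * (real (N + 1) * exp 1) + real (N choose m) * (real (N + 1) * exp 1))"
    unfolding X_def
    by (intro mult_left_mono add_mono nsub_exp_sum_le) (use assms s s2 in auto)
  finally show ?thesis by (simp add: X_def s_def algebra_simps)
qed

text \<open>\<open>xs\<close> will be a token list and \<open>J l xs\<close> the set of indices at
  which the function it encodes has a coefficient of size at least \<open>2 ^ -l / 2\<close>. A list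
  of length \<open>R\<close> fails with probability at most
  \<open>(N + 1) / N ^ (16 * (R + 1))\<close>, and there are at most \<open>N ^ (5 * R)\<close> such
  lists, so the sum over all lists and scales stays small.\<close>

lemma nsub_spectrum_union_bound:
  fixes J :: "nat \<Rightarrow> 'v list \<Rightarrow> nat set" and a D K :: real
  assumes m: "m \<le> N" and N: "2 \<le> N" and L: "L \<le> N" and V: "finite V" "card V \<le> N ^ 5"
    and a: "0 < a" and D: "0 \<le> D" and K: "1 \<le> K" "16 \<le> a * K" "D \<le> a * K * ln 2"
    and J: "\<And>l xs. J l xs \<subseteq> {1..N}"
    and cJ: "\<And>l xs. real m / real N * real (card (J l xs)) \<le> D * 4 ^ l * real N powr (- 3 * a)"
  shows "real (card {S\<in>nsub N m. \<exists>l\<le>L. \<exists>xs. set xs \<subseteq> V \<and>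
      K * (real (length xs) + 1 + 4 ^ l * real N powr (- a)) \<le> real (card (S \<inter> J l xs))})
    \<le> real (N choose m) / (2 * real N)"
proof -
  define k where "k l R = K * (real R + 1 + 4 ^ l * real N powr (- a))" for l R :: nat
  define B where "B l xs = {S\<in>nsub N m. k l (length xs) \<le> real (card (S \<inter> J l xs))}" for l xs
  define X where "X R = {xs. set xs \<subseteq> V \<and> length xs = R}" for R
  have fX: "finite (X R)" for R unfolding X_def by (rule finite_lists_length_eq[OF V(1)])
  have cX: "card (X R) \<le> N ^ (5 * R)" for R
    unfolding X_def card_lists_length_eq[OF V(1)] power_mult by (rule power_mono[OF V(2)]) simp
  have fB: "finite (B l xs)" for l xs by (simp add: B_def)
  have lnN: "ln 2 \<le> ln (real N)" using N by simp
  have lnN0: "0 < ln (real N)" using N by simp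
  have cB: "real (card (B l xs)) \<le> real (N choose m) * (real (N + 1) * (1 / real N ^ (16 * (length xs + 1))))" for l xs
  proof -
    define R where "R = length xs"
    \<comment> \<open>With this weight each point of \<open>S\<close> in \<open>J l xs\<close> costs
      a factor \<open>N powr (- a)\<close>. The mean of the count times \<open>y\<close> is still at
      most \<open>D * 4 ^ l * N powr (- 2 * a)\<close>, which the summand
      \<open>K * 4 ^ l * N powr (- a)\<close> of the threshold absorbs.\<close>
    define y where "y = real N powr a"
    have y1: "1 < y" using N a by (simp add: y_def)
    have "real (card (B l xs)) \<le> real (N choose m) *
        (real (N + 1) * y powr (- k l R) * exp (real m / real N * real (card (J l xs)) * (y - 1)))"
      unfolding B_def R_def by (rule nsub_chernoff) (use m N J y1 in auto)
    also have "\<dots> \<le> real (N choose m) * (real (N + 1) * (1 / real N ^ (16 * (R + 1))))"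
    proof -
      have "real m / real N * real (card (J l xs)) * (y - 1) \<le> D * 4 ^ l * real N powr (- 3 * a) * (y - 1)"
        using cJ y1 by (intro mult_right_mono) auto
      also have "\<dots> \<le> D * 4 ^ l * real N powr (- 3 * a) * y"
        using D by (intro mult_left_mono) auto
      also have "\<dots> = D * 4 ^ l * real N powr (- 2 * a)"
        using N by (simp add: y_def powr_add[symmetric])
      also have "\<dots> \<le> D * 4 ^ l * real N powr (- a)"
        using D N a by (intro mult_left_mono powr_mono) auto
      also have "\<dots> \<le> (a * K * ln 2) * (4 ^ l * real N powr (- a))"
        using K(3) mult_right_mono[of D "a * K * ln 2" "4 ^ l * real N powr (- a)"] by (simp add: mult_ac)
      also have "\<dots> \<le> (a * K * ln (real N)) * (4 ^ l * real N powr (- a))"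
        using a K lnN by (intro mult_right_mono mult_left_mono) auto
      finally have e1: "real m / real N * real (card (J l xs)) * (y - 1) \<le> (a * K * ln (real N)) * (4 ^ l * real N powr (- a))" .
      have "16 * (real R + 1) * ln (real N) \<le> (a * K) * (real R + 1) * ln (real N)"
        using K lnN0 by (intro mult_right_mono) auto
      then have e2: "real m / real N * real (card (J l xs)) * (y - 1) - a * k l R * ln (real N) \<le> - (16 * (real R + 1) * ln (real N))"
        using e1 by (simp add: k_def algebra_simps)
      have "y powr (- k l R) * exp (real m / real N * real (card (J l xs)) * (y - 1))
        = exp (real m / real N * real (card (J l xs)) * (y - 1) - a * k l R * ln (real N))"
        using N by (simp add: y_def powr_powr powr_def exp_add[symmetric])
      also have "\<dots> \<le> exp (- (16 * (real R + 1) * ln (real N)))" using e2 by simp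
      also have "\<dots> = real N powr (- real (16 * (R + 1)))"
        using N by (simp add: powr_def algebra_simps)
      also have "\<dots> = 1 / real N ^ (16 * (R + 1))"
        using N by (subst powr_minus_divide, subst powr_realpow) auto
      finally show ?thesis unfolding mult.assoc[of "real (N + 1)"] by (intro mult_left_mono) auto
    qed
    finally show ?thesis by (simp add: R_def)
  qed
  \<comment> \<open>As \<open>K \<ge> 1\<close>, the threshold is at least
    \<open>length xs + 1\<close>, while \<open>S\<close> has at most \<open>N\<close> elements;
    hence only lists shorter than \<open>N\<close> can fail.\<close>
  have sub: "{S\<in>nsub N m. \<exists>l\<le>L. \<exists>xs. set xs \<subseteq> V \<and> k l (length xs) \<le> real (card (S \<inter> J l xs))}
      \<subseteq> (\<Union>l\<in>{..L}. \<Union>R\<in>{..<N}. \<Union>xs\<in>X R. B l xs)"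
  proof
    fix S assume "S \<in> {S\<in>nsub N m. \<exists>l\<le>L. \<exists>xs. set xs \<subseteq> V \<and> k l (length xs) \<le> real (card (S \<inter> J l xs))}"
    then obtain l xs where S: "S \<in> nsub N m" and l: "l \<le> L" "set xs \<subseteq> V"
      "k l (length xs) \<le> real (card (S \<inter> J l xs))" by blast
    have "finite S" "card S = m" using S by (auto simp: nsub_def intro: finite_subset)
    then have "card (S \<inter> J l xs) \<le> m" by (metis card_mono inf_le1)
    then have "k l (length xs) \<le> real N" using l(3) m by linarith
    moreover have "1 * (real (length xs) + 1) \<le> k l (length xs)"
      unfolding k_def using K by (intro mult_mono) auto
    ultimately have "real (length xs) + 1 \<le> real N" by simp
    then have "length xs < N" by linarith
    then show "S \<in> (\<Union>l\<in>{..L}. \<Union>R\<in>{..<N}. \<Union>xs\<in>X R. B l xs)"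
      using S l by (auto simp: X_def B_def)
  qed
  have "card (\<Union>l\<in>{..L}. \<Union>R\<in>{..<N}. \<Union>xs\<in>X R. B l xs)
      \<le> (\<Sum>l\<in>{..L}. \<Sum>R\<in>{..<N}. \<Sum>xs\<in>X R. card (B l xs))"
    by (intro card_UN_le[THEN order_trans] sum_mono fX finite_atMost finite_lessThan order_refl)
  then have "real (card (\<Union>l\<in>{..L}. \<Union>R\<in>{..<N}. \<Union>xs\<in>X R. B l xs))
      \<le> (\<Sum>l\<in>{..L}. \<Sum>R\<in>{..<N}. \<Sum>xs\<in>X R. real (card (B l xs)))"
    by (simp only: of_nat_sum[symmetric] of_nat_le_iff)
  also have "\<dots> \<le> (\<Sum>l\<in>{..L}. \<Sum>R\<in>{..<N}. real (N choose m) * (real (N + 1) * (1 / real N ^ 16)))"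
  proof (intro sum_mono)
    fix l R
    have "(\<Sum>xs\<in>X R. real (card (B l xs))) \<le>
        (\<Sum>xs\<in>X R. real (N choose m) * (real (N + 1) * (1 / real N ^ (16 * (R + 1)))))"
    proof (rule sum_mono)
      fix xs assume "xs \<in> X R"
      then have "length xs = R" by (simp add: X_def)
      then show "real (card (B l xs)) \<le> real (N choose m) * (real (N + 1) * (1 / real N ^ (16 * (R + 1))))"
        using cB[of l xs] by simp
    qed
    also have "\<dots> = real (card (X R)) * (real (N choose m) * (real (N + 1) * (1 / real N ^ (16 * (R + 1)))))"
      by simp
    also have "\<dots> \<le> real (N ^ (5 * R)) * (real (N choose m) * (real (N + 1) * (1 / real N ^ (16 * (R + 1)))))"
      using cX by (intro mult_right_mono) (auto simp del: of_nat_power)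
    also have "\<dots> = real (N choose m) * (real (N + 1) * (real N ^ (5 * R) / real N ^ (16 * (R + 1))))"
      by simp
    also have "\<dots> \<le> real (N choose m) * (real (N + 1) * (1 / real N ^ 16))"
    proof -
      have "real N ^ (5 * R) * real N ^ 16 \<le> real N ^ (16 * (R + 1))"
        unfolding power_add[symmetric] using N by (intro power_increasing) auto
      then have "real N ^ (5 * R) / real N ^ (16 * (R + 1)) \<le> 1 / real N ^ 16"
        using N by (simp add: divide_simps)
      then show ?thesis by (intro mult_left_mono) auto
    qed
    finally show "(\<Sum>xs\<in>X R. real (card (B l xs))) \<le> real (N choose m) * (real (N + 1) * (1 / real N ^ 16))" .
  qed
  also have "\<dots> = real (N choose m) * (real (L + 1) * real N * real (N + 1) / real N ^ 16)"
    by (simp add: algebra_simps)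
  also have "\<dots> \<le> real (N choose m) * (1 / (2 * real N))"
  proof (rule mult_left_mono)
    \<comment> \<open>Since \<open>N \<ge> 2\<close>, numerical factors can be traded for powers of
      \<open>N\<close>.\<close>
    have "real (L + 1) * real N * real (N + 1) * (2 * real N) \<le> (2 * real N) * real N * (2 * real N) * (2 * real N)"
      using L N by (intro mult_mono) auto
    also have "\<dots> = 2 ^ 3 * real N ^ 4" by (simp add: power_numeral_reduce)
    also have "\<dots> \<le> real N ^ 3 * real N ^ 4" using N by (intro mult_right_mono power_mono) auto
    also have "\<dots> \<le> real N ^ 16" unfolding power_add[symmetric] using N by (intro power_increasing) auto
    finally show "real (L + 1) * real N * real (N + 1) / real N ^ 16 \<le> 1 / (2 * real N)"
      using N by (simp add: divide_simps)
  qed simp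
  finally have "real (card (\<Union>l\<in>{..L}. \<Union>R\<in>{..<N}. \<Union>xs\<in>X R. B l xs)) \<le> real (N choose m) / (2 * real N)"
    by simp
  moreover have "card {S\<in>nsub N m. \<exists>l\<le>L. \<exists>xs. set xs \<subseteq> V \<and> k l (length xs) \<le> real (card (S \<inter> J l xs))}
      \<le> card (\<Union>l\<in>{..L}. \<Union>R\<in>{..<N}. \<Union>xs\<in>X R. B l xs)"
    by (rule card_mono[OF _ sub]) (use fX fB in auto)
  ultimately show ?thesis unfolding k_def by linarith
qed

section \<open>The truncated power potential\<close>

text \<open>\<open>rho p T\<close> is \<open>t powr p / p\<close> up to \<open>T\<close>, continued by a quadratic, so that its derivative \<open>t * wt p T t\<close> grows
  only linearly beyond \<open>T\<close>. This truncation keeps the mirror image of a function bounded in \<open>L\<^sup>2\<close>. As a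
  function of \<open>t\<^sup>2\<close>, \<open>rho p T\<close> is convex, which is how its smoothness is proved below.\<close>

definition wt :: "real \<Rightarrow> real \<Rightarrow> real \<Rightarrow> real"
  where "wt p T t = min t T powr (p - 2)"

definition rho :: "real \<Rightarrow> real \<Rightarrow> real \<Rightarrow> real"
  where "rho p T t = wt p T t * t\<^sup>2 / 2 - (1 / 2 - 1 / p) * min t T powr p"

lemma wt_nonneg: "0 \<le> wt p T t"
  by (simp add: wt_def)

lemma wt_mono: "2 \<le> p \<Longrightarrow> 0 \<le> T \<Longrightarrow> 0 \<le> s \<Longrightarrow> s \<le> t \<Longrightarrow> wt p T s \<le> wt p T t"
  unfolding wt_def by (intro powr_mono2) auto

lemma powr_diff_two_mult:
  fixes t :: real
  assumes "0 \<le> t"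
  shows "t powr (p - 2) * t\<^sup>2 = t powr p"
proof (cases "t = 0")
  case False
  then have "t\<^sup>2 = t powr 2" using assms by (simp add: powr_numeral)
  then show ?thesis by (simp add: powr_add[symmetric])
qed simp

lemma min_powr_le: "0 < T \<Longrightarrow> 0 \<le> t \<Longrightarrow> min t T powr p \<le> wt p T t * t\<^sup>2"
  unfolding wt_def using powr_diff_two_mult[of "min t T" p]
  by (metis min.cobounded1 min_def mult_left_mono power_mono powr_ge_zero less_imp_le)

text \<open>Equality holds for \<open>t \<le> T\<close>. Through this bound the potential controls
  the energy \<open>wt p T t * t\<^sup>2\<close>.\<close>

lemma rho_ge:
  assumes "2 \<le> p" "0 < T" "0 \<le> t"
  shows "wt p T t * t\<^sup>2 / p \<le> rho p T t"
proof -
  have "(1 / 2 - 1 / p) * min t T powr p \<le> (1 / 2 - 1 / p) * (wt p T t * t\<^sup>2)"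
    using assms by (intro mult_left_mono min_powr_le) (auto simp: divide_simps)
  then show ?thesis unfolding rho_def by (simp add: algebra_simps)
qed

lemma rho_nonneg: "2 \<le> p \<Longrightarrow> 0 < T \<Longrightarrow> 0 \<le> t \<Longrightarrow> 0 \<le> rho p T t"
  using rho_ge[of p T t] wt_nonneg[of p T t]
  by (meson divide_nonneg_nonneg mult_nonneg_nonneg order_trans zero_le_power2 zero_le_numeral)

lemma rho_zero [simp]: "0 < T \<Longrightarrow> 0 < p \<Longrightarrow> rho p T 0 = 0"
  by (simp add: rho_def)

section \<open>Convexity in the square, and second-order estimates\<close>

lemma powr_Bernoulli:
  fixes x e :: real
  assumes "1 \<le> e" "0 \<le> x"
  shows "1 + e * (x - 1) \<le> x powr e"
proof (cases "x = 0")
  case False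
  have "e * (x - 1) \<le> x powr e - 1 powr e"
    by (rule convex_on_imp_above_tangent[where A = "{0<..}"])
      (use assms False in \<open>auto intro!: powr_convex derivative_eq_intros simp: interior_open\<close>)
  then show ?thesis by simp
qed (use assms in simp)

text \<open>\<open>u powr p\<close> is the convex function \<open>x powr (p / 2)\<close> of
  \<open>x = u\<^sup>2\<close>. After division by \<open>s powr p\<close> the claim is Bernoulli's
  inequality at \<open>x = (u / s)\<^sup>2\<close>.\<close>

lemma powr_ge_tangent:
  fixes u s :: real
  assumes "2 \<le> p" "0 \<le> u" "0 \<le> s"
  shows "s powr p + p / 2 * s powr (p - 2) * (u\<^sup>2 - s\<^sup>2) \<le> u powr p"
proof (cases "s = 0 \<or> u = 0")
  case True
  show ?thesis
  proof (cases "s = 0")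
    case False
    then have "u = 0" using True by simp
    moreover have "s powr (p - 2) * s\<^sup>2 = s powr p" using powr_diff_two_mult assms by simp
    ultimately have "s powr p + p / 2 * s powr (p - 2) * (u\<^sup>2 - s\<^sup>2) = (1 - p / 2) * s powr p"
      by (simp add: algebra_simps)
    also have "\<dots> \<le> 0" using assms by (intro mult_nonpos_nonneg) auto
    finally show ?thesis using \<open>u = 0\<close> assms by simp
  qed (use assms in simp)
next
  case False
  define x where "x = (u / s)\<^sup>2"
  have su: "0 < s" "0 < u" using False assms by auto
  have x0: "0 < x" using su by (simp add: x_def)
  have "1 + (p / 2) * (x - 1) \<le> x powr (p / 2)"
    using powr_Bernoulli[of "p / 2" x] x0 assms by simp
  also have "x powr (p / 2) = (u / s) powr p"
    using su by (simp add: x_def powr_powr powr_numeral[symmetric] del: powr_numeral)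
  finally have "s powr p * (1 + (p / 2) * (x - 1)) \<le> s powr p * (u / s) powr p"
    by (rule mult_left_mono) simp
  also have "\<dots> = u powr p" using su by (simp add: powr_divide)
  also have "s powr p * (1 + (p / 2) * (x - 1)) = s powr p + p / 2 * s powr (p - 2) * (u\<^sup>2 - s\<^sup>2)"
    unfolding powr_diff_two_mult[OF less_imp_le[OF su(1)], symmetric, of p] x_def
    using su by (simp add: field_simps power2_eq_square)
  finally show ?thesis .
qed

text \<open>The tangent at \<open>v\<close>, in the variable \<open>u\<^sup>2\<close>, is that of
  \<open>t powr p / p\<close> at \<open>s = min v T\<close>. For \<open>u \<le> T\<close> this is
  \<open>powr_ge_tangent\<close>; beyond \<open>T\<close> both sides are affine in
  \<open>u\<^sup>2\<close>, and \<open>rho\<close> has the larger slope.\<close>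

lemma rho_ge_tangent:
  assumes p: "2 < p" and T: "0 < T" and uv: "0 \<le> u" "0 \<le> v"
  shows "rho p T v + wt p T v / 2 * (u\<^sup>2 - v\<^sup>2) \<le> rho p T u"
proof -
  define s where "s = min v T"
  have s: "0 \<le> s" "s \<le> T" using T uv by (auto simp: s_def)
  define l where "l x = s powr p / p + s powr (p - 2) / 2 * (x\<^sup>2 - s\<^sup>2)" for x
  have rho_alt: "rho p T x = min x T powr p / p + min x T powr (p - 2) / 2 * (x\<^sup>2 - (min x T)\<^sup>2)"
    if "0 \<le> x" for x
  proof -
    have "min x T powr (p - 2) * (min x T)\<^sup>2 = min x T powr p"
      using powr_diff_two_mult[of "min x T" p] that T by simp
    then show ?thesis by (simp add: rho_def wt_def right_diff_distrib left_diff_distrib diff_divide_distrib)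
  qed
  have lhs: "rho p T v + wt p T v / 2 * (u\<^sup>2 - v\<^sup>2) = l u"
    unfolding rho_alt[OF uv(2)] l_def s_def[symmetric] wt_def by (simp add: field_simps)
  have l_le: "l x \<le> x powr p / p" if "0 \<le> x" for x
  proof -
    have "s powr p + p / 2 * s powr (p - 2) * (x\<^sup>2 - s\<^sup>2) \<le> x powr p"
      using powr_ge_tangent[of p x s] p s that by simp
    then have "(s powr p + p / 2 * s powr (p - 2) * (x\<^sup>2 - s\<^sup>2)) / p \<le> x powr p / p"
      using p by (intro divide_right_mono) auto
    then show ?thesis using p by (simp add: l_def add_divide_distrib)
  qed
  show ?thesis
  proof (cases "u \<le> T")
    case True
    then show ?thesis using l_le[OF uv(1)] unfolding lhs rho_alt[OF uv(1)] by simp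
  next
    case False
    have "l u = l T + s powr (p - 2) / 2 * (u\<^sup>2 - T\<^sup>2)" by (simp add: l_def field_simps)
    also have "\<dots> \<le> T powr p / p + T powr (p - 2) / 2 * (u\<^sup>2 - T\<^sup>2)"
      using l_le[of T] T False s p
      by (intro add_mono mult_right_mono divide_right_mono powr_mono2) (auto intro: power_mono)
    also have "\<dots> = rho p T u" unfolding rho_alt[OF uv(1)] using False by simp
    finally show ?thesis unfolding lhs .
  qed
qed

text \<open>A difference form of the bound \<open>t * wt' t \<le> (p - 2) * wt t\<close>; when
  \<open>p - 2 < 1\<close> the power is concave and the constant becomes \<open>1\<close>.
  Truncation only helps, because the ratio \<open>r\<close> of the truncated arguments is at least
  \<open>a / b\<close>.\<close>

lemma wt_diff_le_aux:
  assumes p: "2 < p" and T: "0 < T" and ab: "0 \<le> a" "a \<le> b"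
  shows "(wt p T b - wt p T a) * b \<le> max 1 (p - 2) * wt p T b * (b - a)"
proof -
  define k where "k = max 1 (p - 2)"
  define A where "A = min a T"
  define B where "B = min b T"
  have AB: "0 \<le> A" "A \<le> B" "B \<le> T" using ab T by (auto simp: A_def B_def)
  show ?thesis
  proof (cases "B = 0")
    case True
    then have "b = 0" "a = 0" using T ab by (auto simp: B_def min_def split: if_splits)
    then show ?thesis by simp
  next
    case False
    then have B0: "0 < B" using AB by simp
    have b0: "0 < b" using B0 T ab by (auto simp: B_def min_def split: if_splits)
    define r where "r = A / B"
    have r: "0 \<le> r" "r \<le> 1" using AB B0 by (auto simp: r_def)
    have r_ge: "a / b \<le> r"
    proof (cases "b \<le> T")
      case True
      then show ?thesis using ab by (simp add: r_def A_def B_def)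
    next
      case False
      then have "B = T" by (simp add: B_def)
      show ?thesis
      proof (cases "a \<le> T")
        case True
        then show ?thesis using False ab T by (auto simp: r_def \<open>B = T\<close> A_def intro!: divide_left_mono)
      next
        case False
        then show ?thesis using b0 ab T by (auto simp: r_def \<open>B = T\<close> A_def)
      qed
    qed
    have "1 - r powr (p - 2) \<le> k * (1 - r)"
    proof (cases "p - 2 \<le> 1")
      case True
      have "r powr 1 \<le> r powr (p - 2)"
        using r True p by (intro powr_mono') auto
      then show ?thesis using True r by (simp add: k_def)
    next
      case False
      then have k: "k = p - 2" by (simp add: k_def)
      have "1 + k * (r - 1) \<le> r powr (p - 2)"
        unfolding k using powr_Bernoulli[of "p - 2" r] r False by simp
      then show ?thesis by (simp add: right_diff_distrib)
    qed
    also have "\<dots> \<le> k * (1 - a / b)" using r_ge by (intro mult_left_mono) (auto simp: k_def)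
    finally have "(B powr (p - 2) * b) * (1 - r powr (p - 2)) \<le> (B powr (p - 2) * b) * (k * (1 - a / b))"
      using b0 by (intro mult_left_mono) auto
    moreover have "B powr (p - 2) * r powr (p - 2) = A powr (p - 2)"
      using B0 AB by (simp add: r_def powr_divide)
    ultimately show ?thesis
      using b0 by (simp add: wt_def A_def[symmetric] B_def[symmetric] k_def[symmetric] algebra_simps)
  qed
qed

lemma wt_diff_le:
  assumes p: "2 < p" and T: "0 < T" and ab: "0 \<le> a" "0 \<le> b"
  shows "\<bar>wt p T b - wt p T a\<bar> * a \<le> max 1 (p - 2) * wt p T (max a b) * \<bar>b - a\<bar>"
proof (cases "a \<le> b")
  case True
  have le: "wt p T a \<le> wt p T b" using wt_mono p T ab True by simp
  have "\<bar>wt p T b - wt p T a\<bar> * a \<le> (wt p T b - wt p T a) * b"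
    using le True ab by (intro mult_mono) auto
  then show ?thesis using wt_diff_le_aux[OF p T ab(1) True] True by (simp add: max_absorb2)
next
  case False
  then have "wt p T b \<le> wt p T a" using wt_mono p T ab by simp
  then show ?thesis using wt_diff_le_aux[OF p T ab(2), of a] False by (simp add: max_absorb1)
qed

text \<open>Second-order expansion with gradient \<open>wt p T (cmod z) * z\<close>. The tangent
  bound is used at the new point \<open>z + v\<close>, so that convexity bounds the increase from
  above; returning to the weight at \<open>z\<close> costs \<open>wt_diff_le\<close>.\<close>

lemma rho_smooth:
  fixes z v :: complex
  assumes p: "2 < p" and T: "0 < T"
  shows "rho p T (cmod (z + v)) \<le> rho p T (cmod z) + wt p T (cmod z) * Re (cnj z * v)
    + (max 1 (p - 2) + 1) * wt p T (cmod z + cmod v) * (cmod v)\<^sup>2"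
proof -
  define a b c where "a = cmod z" "b = cmod (z + v)" "c = cmod v"
  define k where "k = max 1 (p - 2)"
  have nn: "0 \<le> a" "0 \<le> b" "0 \<le> c" by (auto simp: a_b_c_def)
  have ba: "\<bar>b - a\<bar> \<le> c" unfolding a_b_c_def using norm_triangle_ineq3[of "z + v" z] by simp
  have sq: "b\<^sup>2 - a\<^sup>2 = 2 * Re (cnj z * v) + c\<^sup>2"
    unfolding a_b_c_def cmod_power2 by (simp add: power2_eq_square algebra_simps)
  have re: "\<bar>Re (cnj z * v)\<bar> \<le> a * c"
    unfolding a_b_c_def using abs_Re_le_cmod[of "cnj z * v"] by (simp add: norm_mult)
  have w1: "wt p T (max a b) \<le> wt p T (a + c)" using ba nn p T by (intro wt_mono) auto
  have w2: "wt p T b \<le> wt p T (a + c)" using ba nn p T by (intro wt_mono) auto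
  have "rho p T b - rho p T a \<le> wt p T b / 2 * (b\<^sup>2 - a\<^sup>2)"
    using rho_ge_tangent[OF p T nn(1,2)] by (simp add: algebra_simps)
  also have "\<dots> = wt p T a * Re (cnj z * v) + (wt p T b - wt p T a) * Re (cnj z * v) + wt p T b / 2 * c\<^sup>2"
    unfolding sq by (simp add: algebra_simps)
  also have "(wt p T b - wt p T a) * Re (cnj z * v) \<le> k * wt p T (a + c) * c\<^sup>2"
  proof -
    have "(wt p T b - wt p T a) * Re (cnj z * v) \<le> \<bar>wt p T b - wt p T a\<bar> * \<bar>Re (cnj z * v)\<bar>"
      by (metis abs_ge_self abs_mult)
    also have "\<dots> \<le> \<bar>wt p T b - wt p T a\<bar> * (a * c)" by (intro mult_left_mono re) auto
    also have "\<dots> = \<bar>wt p T b - wt p T a\<bar> * a * c" by simp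
    also have "\<dots> \<le> k * wt p T (max a b) * \<bar>b - a\<bar> * c"
      unfolding k_def by (intro mult_right_mono wt_diff_le p T nn)
    also have "\<dots> \<le> k * wt p T (a + c) * c * c"
      using w1 ba nn by (intro mult_mono mult_nonneg_nonneg wt_nonneg) (auto simp: k_def)
    finally show ?thesis by (simp add: power2_eq_square mult.assoc)
  qed
  also have "wt p T b / 2 * c\<^sup>2 \<le> 1 * wt p T (a + c) * c\<^sup>2"
    using w2 wt_nonneg[of p T b] by (intro mult_right_mono) auto
  finally show ?thesis by (simp add: a_b_c_def k_def algebra_simps)
qed

text \<open>The curvature met by a step of length at most \<open>1\<close> is controlled by the
  energy, with a constant independent of \<open>T\<close>.\<close>

lemma wt_add_one_le:
  assumes "2 < p" "0 < T" "0 \<le> t" "0 \<le> s" "s \<le> 1"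
  shows "wt p T (t + s) \<le> 2 powr (p - 2) * (1 + wt p T t * t\<^sup>2)"
proof -
  define u where "u = min t T"
  have u: "0 \<le> u" using assms by (simp add: u_def)
  have "wt p T (t + s) \<le> (u + 1) powr (p - 2)"
    unfolding wt_def u_def using assms by (intro powr_mono2) auto
  also have "\<dots> \<le> (2 * max 1 u) powr (p - 2)" using u assms by (intro powr_mono2) auto
  also have "\<dots> = 2 powr (p - 2) * (max 1 u) powr (p - 2)" by (simp add: powr_mult)
  also have "(max 1 u) powr (p - 2) \<le> (max 1 u) powr p" by (intro powr_mono) auto
  also have "(max 1 u) powr p \<le> 1 + u powr p" by (auto simp: max_def)
  also have "u powr p \<le> wt p T t * t\<^sup>2" unfolding u_def using assms by (intro min_powr_le) auto
  finally show ?thesis by (simp add: algebra_simps)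
qed

text \<open>Young's inequality for the truncated weight, split at \<open>x = 2 * p * b\<close>. The
  condition \<open>b \<le> T\<close> lets \<open>wt p T x\<close> dominate
  \<open>b powr (p - 2)\<close>. By \<open>rho_ge\<close> the coefficient \<open>1 / (2 * p)\<close>
  makes the first term at most half of \<open>rho p T x\<close>.\<close>

lemma wt_young:
  assumes p: "2 < p" and b: "0 \<le> b" "b \<le> T" and x: "0 \<le> x" and T: "0 < T"
  shows "x * b powr (p - 1) \<le> wt p T x * x\<^sup>2 / (2 * p) + 2 * p * b powr p"
proof (cases "x \<le> 2 * p * b")
  case True
  have "x * b powr (p - 1) \<le> 2 * p * b * b powr (p - 1)"
    using True by (rule mult_right_mono) simp
  also have "\<dots> = 2 * p * b powr p"
    using b by (cases "b = 0") (auto simp: powr_diff)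
  finally show ?thesis using wt_nonneg[of p T x] p by (simp add: add_increasing)
next
  case False
  have bx: "b \<le> x" "2 * p * b \<le> x" using False p b mult_right_mono[of 1 "2 * p" b] by auto
  have "x * b powr (p - 1) = b powr (p - 2) * x * b"
    using b by (cases "b = 0") (auto simp: powr_diff power2_eq_square)
  also have "\<dots> \<le> wt p T x * x * (x / (2 * p))"
    using bx b x p unfolding wt_def
    by (intro mult_mono powr_mono2) (auto simp: divide_simps mult_ac)
  finally show ?thesis using p b by (simp add: power2_eq_square add_increasing2)
qed

section \<open>Bounded orthogonal systems\<close>

text \<open>The bounds hold at every point and for every index, which keeps all functions formed
  below bounded. General systems are brought into this form at the end, by a change on null sets and
  by zero outside \<open>{1..N}\<close>.\<close>

locale bounded_system = prob_space M for M :: "'a measure" +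
  fixes \<phi> :: "nat \<Rightarrow> 'a \<Rightarrow> complex"
  assumes phi_measurable [measurable]: "\<And>i. \<phi> i \<in> borel_measurable M"
    and phi_le: "\<And>i x. cmod (\<phi> i x) \<le> 1"
    and phi_orth: "\<And>i j. i \<noteq> j \<Longrightarrow> (\<integral>x. \<phi> i x * cnj (\<phi> j x) \<partial>M) = 0"
begin

text \<open>This class is closed under the operations used below and consists of integrable
  functions, so integrability conditions become routine.\<close>

definition bfun :: "('a \<Rightarrow> complex) \<Rightarrow> bool"
  where "bfun F \<longleftrightarrow> F \<in> borel_measurable M \<and> (\<exists>B. \<forall>x. cmod (F x) \<le> B)"

lemma bfun_measurable [measurable_dest]: "bfun F \<Longrightarrow> F \<in> borel_measurable M"
  by (simp add: bfun_def)

lemma bfun_phi [simp]: "bfun (\<phi> i)"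
  unfolding bfun_def using phi_le by auto

lemma bfun_const [simp]: "bfun (\<lambda>x. c)"
  unfolding bfun_def by auto

lemma bfun_add [simp]: "bfun F \<Longrightarrow> bfun G \<Longrightarrow> bfun (\<lambda>x. F x + G x)"
proof -
  assume F: "bfun F" and G: "bfun G"
  then obtain A B where "\<And>x. cmod (F x) \<le> A" "\<And>x. cmod (G x) \<le> B"
    by (auto simp: bfun_def)
  then have "\<forall>x. cmod (F x + G x) \<le> A + B"
    by (auto intro: norm_triangle_mono)
  then show ?thesis using F G by (auto simp: bfun_def)
qed

lemma bfun_mult [simp]: "bfun F \<Longrightarrow> bfun G \<Longrightarrow> bfun (\<lambda>x. F x * G x)"
proof -
  assume F: "bfun F" and G: "bfun G"
  then obtain A B where "\<forall>x. cmod (F x) \<le> A" "\<forall>x. cmod (G x) \<le> B"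
    by (auto simp: bfun_def)
  then have "\<forall>x. cmod (F x * G x) \<le> A * B"
    by (auto simp: norm_mult intro!: mult_mono intro: order_trans[OF norm_ge_zero])
  then show ?thesis using F G by (auto simp: bfun_def)
qed

lemma bfun_cnj [simp]: "bfun F \<Longrightarrow> bfun (\<lambda>x. cnj (F x))"
  unfolding bfun_def
  using measurable_compose[OF _ borel_measurable_continuous_onI[OF continuous_on_cnj[OF continuous_on_id]], of F M]
  by auto

lemma bfun_diff [simp]: "bfun F \<Longrightarrow> bfun G \<Longrightarrow> bfun (\<lambda>x. F x - G x)"
  using bfun_add[of F "\<lambda>x. - 1 * G x"] bfun_mult[of "\<lambda>x. - 1" G] by simp

lemma bfun_sum [simp]: "(\<And>i. i \<in> A \<Longrightarrow> bfun (F i)) \<Longrightarrow> bfun (\<lambda>x. \<Sum>i\<in>A. F i x)"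
  by (induction A rule: infinite_finite_induct) auto

lemma bfun_of_real:
  fixes u U :: "real \<Rightarrow> real"
  assumes "bfun F" "u \<in> borel_measurable borel" "\<And>b t. 0 \<le> t \<Longrightarrow> t \<le> b \<Longrightarrow> \<bar>u t\<bar> \<le> U b"
  shows "bfun (\<lambda>x. complex_of_real (u (cmod (F x))))"
proof -
  obtain B where B: "\<And>x. cmod (F x) \<le> B" using assms(1) by (auto simp: bfun_def)
  have [measurable]: "F \<in> borel_measurable M" using assms(1) by (rule bfun_measurable)
  note [measurable] = assms(2)
  show ?thesis unfolding bfun_def
    by (intro conjI exI[of _ "U B"]) (use B assms(3) in auto)
qed

lemma bfun_integrable [simp]: "bfun F \<Longrightarrow> integrable M F"
  unfolding bfun_def by (auto intro: integrable_const_bound)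

lemma bfun_integrable_Re [simp]: "bfun F \<Longrightarrow> integrable M (\<lambda>x. Re (F x))"
  using bfun_integrable by (rule integrable_Re)

lemma bfun_integral_Re: "bfun F \<Longrightarrow> (\<integral>x. Re (F x) \<partial>M) = Re (\<integral>x. F x \<partial>M)"
  using bfun_integrable by (rule integral_Re)

lemma bfun_cmod_integrable:
  fixes u U :: "real \<Rightarrow> real"
  assumes "bfun F" "u \<in> borel_measurable borel" "\<And>b t. 0 \<le> t \<Longrightarrow> t \<le> b \<Longrightarrow> \<bar>u t\<bar> \<le> U b"
  shows "integrable M (\<lambda>x. u (cmod (F x)))"
  using bfun_integrable_Re[OF bfun_of_real[where u = u and U = U, OF assms(1,2)]] assms(3) by simp

lemma bfun_cmod_powr_integrable [simp]: "bfun F \<Longrightarrow> 0 \<le> q \<Longrightarrow> integrable M (\<lambda>x. cmod (F x) powr q)"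
  by (rule bfun_cmod_integrable[where u = "\<lambda>t. t powr q" and U = "\<lambda>b. b powr q"]) (auto intro: powr_mono2)

lemma bfun_cmod_power2_integrable [simp]: "bfun F \<Longrightarrow> integrable M (\<lambda>x. (cmod (F x))\<^sup>2)"
  by (rule bfun_cmod_integrable[where u = "\<lambda>t. t\<^sup>2" and U = "\<lambda>b. b\<^sup>2"]) (auto intro: power_mono)

section \<open>Fourier coefficients and Bessel's inequality\<close>

definition coef :: "('a \<Rightarrow> complex) \<Rightarrow> nat \<Rightarrow> complex"
  where "coef g i = (\<integral>x. g x * cnj (\<phi> i x) \<partial>M)"

lemma integral_mult_cnj_sum:
  assumes "bfun h" "finite A"
  shows "(\<integral>x. h x * cnj (\<Sum>i\<in>A. a i * \<phi> i x) \<partial>M) = (\<Sum>i\<in>A. cnj (a i) * coef h i)"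
proof -
  have "(\<integral>x. h x * cnj (\<Sum>i\<in>A. a i * \<phi> i x) \<partial>M)
    = (\<integral>x. (\<Sum>i\<in>A. cnj (a i) * (h x * cnj (\<phi> i x))) \<partial>M)"
    by (simp add: sum_distrib_left mult_ac)
  also have "\<dots> = (\<Sum>i\<in>A. \<integral>x. cnj (a i) * (h x * cnj (\<phi> i x)) \<partial>M)"
    by (rule Bochner_Integration.integral_sum) (use assms in auto)
  also have "\<dots> = (\<Sum>i\<in>A. cnj (a i) * coef h i)"
    unfolding coef_def by (rule sum.cong) (use assms in auto)
  finally show ?thesis .
qed

lemma coef_sum:
  assumes "finite A" "i \<in> A"
  shows "coef (\<lambda>x. \<Sum>j\<in>A. a j * \<phi> j x) i = a i * (\<integral>x. (cmod (\<phi> i x))\<^sup>2 \<partial>M)"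
proof -
  have "coef (\<lambda>x. \<Sum>j\<in>A. a j * \<phi> j x) i = (\<integral>x. (\<Sum>j\<in>A. a j * (\<phi> j x * cnj (\<phi> i x))) \<partial>M)"
    by (simp add: coef_def sum_distrib_right mult.assoc)
  also have "\<dots> = (\<Sum>j\<in>A. \<integral>x. a j * (\<phi> j x * cnj (\<phi> i x)) \<partial>M)"
    by (rule Bochner_Integration.integral_sum) auto
  also have "\<dots> = (\<Sum>j\<in>A. if j = i then a i * (\<integral>x. \<phi> i x * cnj (\<phi> i x) \<partial>M) else 0)"
    by (rule sum.cong) (auto simp: phi_orth)
  also have "\<dots> = a i * (\<integral>x. \<phi> i x * cnj (\<phi> i x) \<partial>M)" using assms by simp
  also have "(\<integral>x. \<phi> i x * cnj (\<phi> i x) \<partial>M) = complex_of_real (\<integral>x. (cmod (\<phi> i x))\<^sup>2 \<partial>M)"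
    by (simp only: complex_norm_square[symmetric] integral_complex_of_real)
  finally show ?thesis .
qed

lemma phi_square_integral_le: "(\<integral>x. (cmod (\<phi> i x))\<^sup>2 \<partial>M) \<le> 1"
proof -
  have "(\<integral>x. (cmod (\<phi> i x))\<^sup>2 \<partial>M) \<le> (\<integral>x. 1 \<partial>M)"
    by (rule integral_mono) (use phi_le in \<open>auto simp: abs_square_le_1\<close>)
  then show ?thesis by (simp add: prob_space)
qed

lemma square_integral_sum_le:
  assumes "finite A"
  shows "(\<integral>x. (cmod (\<Sum>i\<in>A. a i * \<phi> i x))\<^sup>2 \<partial>M) \<le> (\<Sum>i\<in>A. (cmod (a i))\<^sup>2)"
proof -
  define s where "s x = (\<Sum>i\<in>A. a i * \<phi> i x)" for x
  have s: "bfun s" unfolding s_def by simp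
  have "complex_of_real (\<integral>x. (cmod (s x))\<^sup>2 \<partial>M) = (\<integral>x. s x * cnj (s x) \<partial>M)"
    by (simp only: complex_norm_square[symmetric] integral_complex_of_real)
  also have "\<dots> = (\<Sum>i\<in>A. cnj (a i) * coef s i)"
    using integral_mult_cnj_sum[OF s assms, of a] by (simp only: s_def)
  also have "\<dots> = (\<Sum>i\<in>A. cnj (a i) * (a i * (\<integral>x. (cmod (\<phi> i x))\<^sup>2 \<partial>M)))"
    unfolding s_def by (rule sum.cong) (auto simp: coef_sum assms)
  also have "\<dots> = complex_of_real (\<Sum>i\<in>A. (cmod (a i))\<^sup>2 * (\<integral>x. (cmod (\<phi> i x))\<^sup>2 \<partial>M))"
    by (simp add: complex_norm_square mult_ac del: of_real_power)
  finally have "(\<integral>x. (cmod (s x))\<^sup>2 \<partial>M) = (\<Sum>i\<in>A. (cmod (a i))\<^sup>2 * (\<integral>x. (cmod (\<phi> i x))\<^sup>2 \<partial>M))"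
    by (simp only: of_real_eq_iff)
  also have "\<dots> \<le> (\<Sum>i\<in>A. (cmod (a i))\<^sup>2 * 1)"
    by (intro sum_mono mult_left_mono phi_square_integral_le) auto
  finally show ?thesis by (simp add: s_def)
qed

text \<open>The \<open>\<phi> i\<close> are not normalised and \<open>coef\<close> is not divided by
  their norms. Expanding the square norm of \<open>h - s\<close> still works, because norms at most
  one give \<open>s\<close> a square norm of at most the sum on the left.\<close>

lemma Bessel:
  assumes h: "bfun h" and A: "finite A"
  shows "(\<Sum>i\<in>A. (cmod (coef h i))\<^sup>2) \<le> (\<integral>x. (cmod (h x))\<^sup>2 \<partial>M)"
proof -
  define s where "s x = (\<Sum>i\<in>A. coef h i * \<phi> i x)" for x
  have s: "bfun s" unfolding s_def by simp
  have "(\<integral>x. h x * cnj (s x) \<partial>M) = (\<Sum>i\<in>A. cnj (coef h i) * coef h i)"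
    unfolding s_def by (rule integral_mult_cnj_sum[OF h A])
  also have "\<dots> = complex_of_real (\<Sum>i\<in>A. (cmod (coef h i))\<^sup>2)"
    by (simp add: complex_norm_square mult_ac del: of_real_power)
  finally have hs: "Re (\<integral>x. h x * cnj (s x) \<partial>M) = (\<Sum>i\<in>A. (cmod (coef h i))\<^sup>2)" by simp
  define u where "u x = Re (h x * cnj (s x))" for x
  have u: "integrable M u" unfolding u_def by (intro bfun_integrable_Re bfun_mult bfun_cnj h s)
  have sq: "(cmod (h x - s x))\<^sup>2 = (cmod (h x))\<^sup>2 - 2 * u x + (cmod (s x))\<^sup>2" for x
    unfolding cmod_power2 u_def by (simp add: power2_eq_square algebra_simps)
  have "0 \<le> (\<integral>x. (cmod (h x - s x))\<^sup>2 \<partial>M)" by simp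
  also have "\<dots> = (\<integral>x. (cmod (h x))\<^sup>2 \<partial>M) - 2 * (\<integral>x. u x \<partial>M) + (\<integral>x. (cmod (s x))\<^sup>2 \<partial>M)"
    unfolding sq using h s u by simp
  also have "(\<integral>x. u x \<partial>M) = (\<Sum>i\<in>A. (cmod (coef h i))\<^sup>2)"
    unfolding u_def hs[symmetric] by (intro bfun_integral_Re bfun_mult bfun_cnj h s)
  also have "(\<integral>x. (cmod (s x))\<^sup>2 \<partial>M) \<le> (\<Sum>i\<in>A. (cmod (coef h i))\<^sup>2)"
    unfolding s_def by (rule square_integral_sum_le[OF A])
  finally show ?thesis by simp
qed

end

section \<open>Mirror descent\<close>

text \<open>The three factors come from \<open>rho_smooth\<close>, from
  \<open>wt_add_one_le\<close>, and from the energy bound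
  \<open>p * pot F \<le> 4 * p\<^sup>2\<close>.\<close>

definition smooth_const :: "real \<Rightarrow> real"
  where "smooth_const p = (max 1 (p - 2) + 1) * 2 powr (p - 2) * (1 + 4 * p\<^sup>2)"

text \<open>Chosen so that the second-order loss of a correction is at most half of its first-order
  gain.\<close>

definition step_size :: "real \<Rightarrow> real"
  where "step_size p = 1 / (8 * smooth_const p)"

lemma smooth_const_ge_1: "2 < p \<Longrightarrow> 1 \<le> smooth_const p"
proof -
  assume p: "2 < p"
  have "1 * 1 * 1 \<le> (max 1 (p - 2) + 1) * 2 powr (p - 2) * (1 + 4 * p\<^sup>2)"
    using p by (intro mult_mono) (auto intro: ge_one_powr_ge_zero)
  then show ?thesis by (simp add: smooth_const_def)
qed

lemma step_size_bounds: "2 < p \<Longrightarrow> 0 < step_size p" "2 < p \<Longrightarrow> step_size p \<le> 1"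
  using smooth_const_ge_1[of p] by (auto simp: step_size_def divide_simps)

lemma wt_le: "2 < p \<Longrightarrow> 0 < T \<Longrightarrow> 0 \<le> t \<Longrightarrow> wt p T t \<le> T powr (p - 2)"
  unfolding wt_def by (intro powr_mono2) auto

lemma rho_le: "2 < p \<Longrightarrow> rho p T t \<le> wt p T t * t\<^sup>2 / 2"
  unfolding rho_def by simp

lemma wt_measurable [measurable]: "wt p T \<in> borel_measurable borel"
  unfolding wt_def[abs_def] by measurable

lemma rho_measurable [measurable]: "rho p T \<in> borel_measurable borel"
  unfolding rho_def[abs_def] by measurable

text \<open>Four directions lose only a factor \<open>2\<close> and keep the set of possible
  corrections finite.\<close>

lemma quarter_turn_obtain:
  fixes z :: complex
  obtains w where "w \<in> {1, -1, \<i>, -\<i>}" "cmod z / 2 \<le> Re (w * cnj z)"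
proof -
  have "cmod z \<le> \<bar>Re z\<bar> + \<bar>Im z\<bar>" by (rule cmod_le)
  then consider "cmod z / 2 \<le> Re z" | "cmod z / 2 \<le> - Re z" | "cmod z / 2 \<le> Im z" | "cmod z / 2 \<le> - Im z"
    by linarith
  then show ?thesis
    by cases (use that[of 1] that[of "-1"] that[of "\<i>"] that[of "-\<i>"] in auto)
qed

locale mirror_descent = bounded_system +
  fixes p T :: real
  assumes p: "2 < p" and T: "0 < T"
begin

definition pot :: "('a \<Rightarrow> complex) \<Rightarrow> real"
  where "pot F = (\<integral>x. rho p T (cmod (F x)) \<partial>M)"

text \<open>The mirror map, that is, the gradient of \<open>pot\<close>: corrections are added to
  \<open>F\<close>, while \<open>mir F\<close> is the hypothesis compared with the target.\<close>

definition mir :: "('a \<Rightarrow> complex) \<Rightarrow> 'a \<Rightarrow> complex"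
  where "mir F x = complex_of_real (wt p T (cmod (F x))) * F x"

lemma bfun_mir [simp]: "bfun F \<Longrightarrow> bfun (mir F)"
proof -
  assume F: "bfun F"
  have "bfun (\<lambda>x. complex_of_real (wt p T (cmod (F x))))"
    by (rule bfun_of_real[where u = "wt p T" and U = "\<lambda>_. T powr (p - 2)"])
      (use F wt_le[OF p T] in \<open>auto simp: wt_nonneg\<close>)
  then show ?thesis using F unfolding mir_def[abs_def] by simp
qed

lemma rho_integrable [simp]: "bfun F \<Longrightarrow> integrable M (\<lambda>x. rho p T (cmod (F x)))"
proof (rule bfun_cmod_integrable[where u = "rho p T" and U = "\<lambda>b. T powr (p - 2) * b\<^sup>2"])
  fix b t :: real assume t: "0 \<le> t" "t \<le> b"
  have "rho p T t \<le> wt p T t * t\<^sup>2"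
    using rho_le[OF p, of T t] mult_nonneg_nonneg[OF wt_nonneg[of p T t] zero_le_power2[of t]] by linarith
  also have "\<dots> \<le> T powr (p - 2) * b\<^sup>2"
    using t wt_le[OF p T] by (intro mult_mono power_mono) auto
  finally show "\<bar>rho p T t\<bar> \<le> T powr (p - 2) * b\<^sup>2"
    using rho_nonneg[of p T t] p T t by simp
qed auto

lemma wt_square_integrable [simp]:
  "bfun F \<Longrightarrow> integrable M (\<lambda>x. wt p T (cmod (F x)) * (cmod (F x))\<^sup>2)"
proof (rule bfun_cmod_integrable[where u = "\<lambda>t. wt p T t * t\<^sup>2" and U = "\<lambda>b. T powr (p - 2) * b\<^sup>2"])
  fix b t :: real assume t: "0 \<le> t" "t \<le> b"
  show "\<bar>wt p T t * t\<^sup>2\<bar> \<le> T powr (p - 2) * b\<^sup>2"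
    using t wt_le[OF p T, of t] wt_nonneg[of p T t] unfolding abs_mult
    by (intro mult_mono) (auto intro: power_mono)
qed auto

lemma wt_square_integral_le:
  assumes "bfun F"
  shows "(\<integral>x. wt p T (cmod (F x)) * (cmod (F x))\<^sup>2 \<partial>M) \<le> p * pot F"
proof -
  have "(\<integral>x. wt p T (cmod (F x)) * (cmod (F x))\<^sup>2 \<partial>M) \<le> (\<integral>x. p * rho p T (cmod (F x)) \<partial>M)"
  proof (rule integral_mono)
    show "integrable M (\<lambda>x. p * rho p T (cmod (F x)))" using assms by (intro integrable_mult_right) simp
    show "wt p T (cmod (F x)) * (cmod (F x))\<^sup>2 \<le> p * rho p T (cmod (F x))" for x
      using rho_ge[of p T "cmod (F x)"] p T by (simp add: divide_simps mult.commute)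
  qed (use assms in simp)
  then show ?thesis by (simp add: pot_def)
qed

text \<open>This is where the truncation pays: \<open>wt\<close> is at most
  \<open>T powr (p - 2)\<close>. With Bessel's inequality the bound limits the number of large
  coefficients of \<open>mir F\<close>.\<close>

lemma mir_square_integral_le:
  assumes F: "bfun F"
  shows "(\<integral>x. (cmod (mir F x))\<^sup>2 \<partial>M) \<le> T powr (p - 2) * (p * pot F)"
proof -
  have "(\<integral>x. (cmod (mir F x))\<^sup>2 \<partial>M) \<le> (\<integral>x. T powr (p - 2) * (wt p T (cmod (F x)) * (cmod (F x))\<^sup>2) \<partial>M)"
  proof (rule integral_mono)
    fix x
    have "(cmod (mir F x))\<^sup>2 = wt p T (cmod (F x)) * (wt p T (cmod (F x)) * (cmod (F x))\<^sup>2)"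
      using wt_nonneg[of p T "cmod (F x)"] by (simp add: mir_def norm_mult power2_eq_square mult_ac)
    also have "\<dots> \<le> T powr (p - 2) * (wt p T (cmod (F x)) * (cmod (F x))\<^sup>2)"
      using wt_le[OF p T] wt_nonneg by (intro mult_right_mono mult_nonneg_nonneg) auto
    finally show "(cmod (mir F x))\<^sup>2 \<le> T powr (p - 2) * (wt p T (cmod (F x)) * (cmod (F x))\<^sup>2)" .
  qed (use F in \<open>auto intro!: integrable_mult_right\<close>)
  also have "\<dots> = T powr (p - 2) * (\<integral>x. wt p T (cmod (F x)) * (cmod (F x))\<^sup>2 \<partial>M)" by simp
  also have "\<dots> \<le> T powr (p - 2) * (p * pot F)"
    by (intro mult_left_mono wt_square_integral_le F) simp
  finally show ?thesis .
qed

text \<open>Integrates \<open>rho_smooth\<close>. The condition \<open>pot F \<le> 4 * p\<close>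
  bounds the average curvature; along the descent it is supplied by
  \<open>pot_le_if_gap\<close>.\<close>

lemma pot_add_le:
  assumes F: "bfun F" and v: "bfun v" and ve: "\<And>x. cmod (v x) \<le> e" and e: "0 \<le> e" "e \<le> 1"
    and pF: "pot F \<le> 4 * p"
  shows "pot (\<lambda>x. F x + v x) \<le> pot F + Re (\<integral>x. v x * cnj (mir F x) \<partial>M) + smooth_const p * e\<^sup>2"
proof -
  define k where "k = max 1 (p - 2) + 1"
  have k: "k \<ge> 0" by (simp add: k_def)
  define W where "W x = wt p T (cmod (F x)) * (cmod (F x))\<^sup>2" for x
  have W: "integrable M W" unfolding W_def using F by simp
  define u where "u x = Re (v x * cnj (mir F x))" for x
  have u: "integrable M u" unfolding u_def by (intro bfun_integrable_Re bfun_mult bfun_cnj bfun_mir F v)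
  have "pot (\<lambda>x. F x + v x) \<le> (\<integral>x. rho p T (cmod (F x)) + u x + (k * 2 powr (p - 2) * e\<^sup>2) * (1 + W x) \<partial>M)"
    unfolding pot_def
  proof (rule integral_mono)
    fix x
    have "rho p T (cmod (F x + v x)) \<le> rho p T (cmod (F x)) + wt p T (cmod (F x)) * Re (cnj (F x) * v x)
        + k * wt p T (cmod (F x) + cmod (v x)) * (cmod (v x))\<^sup>2"
      unfolding k_def by (rule rho_smooth[OF p T])
    also have "wt p T (cmod (F x)) * Re (cnj (F x) * v x) = u x"
      by (simp add: u_def mir_def algebra_simps)
    also have "k * wt p T (cmod (F x) + cmod (v x)) * (cmod (v x))\<^sup>2
        \<le> k * (2 powr (p - 2) * (1 + W x)) * e\<^sup>2"
      unfolding W_def using ve[of x] e k p T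
      by (intro mult_mono mult_nonneg_nonneg wt_add_one_le power_mono add_nonneg_nonneg wt_nonneg) auto
    finally show "rho p T (cmod (F x + v x)) \<le> rho p T (cmod (F x)) + u x + (k * 2 powr (p - 2) * e\<^sup>2) * (1 + W x)"
      by (simp add: mult_ac)
  qed (use F v u W in \<open>auto intro!: Bochner_Integration.integrable_add integrable_mult_right\<close>)
  also have "\<dots> = pot F + (\<integral>x. u x \<partial>M) + (k * 2 powr (p - 2) * e\<^sup>2) * (1 + (\<integral>x. W x \<partial>M))"
    using F u W by (simp add: pot_def prob_space)
  also have "(\<integral>x. u x \<partial>M) = Re (\<integral>x. v x * cnj (mir F x) \<partial>M)"
    unfolding u_def by (intro bfun_integral_Re bfun_mult bfun_cnj bfun_mir F v)
  also have "(k * 2 powr (p - 2) * e\<^sup>2) * (1 + (\<integral>x. W x \<partial>M)) \<le> (k * 2 powr (p - 2) * e\<^sup>2) * (1 + 4 * p\<^sup>2)"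
  proof (rule mult_left_mono)
    have "(\<integral>x. W x \<partial>M) \<le> p * pot F" unfolding W_def by (rule wt_square_integral_le[OF F])
    also have "\<dots> \<le> p * (4 * p)" using pF p by (intro mult_left_mono) auto
    finally show "1 + (\<integral>x. W x \<partial>M) \<le> 1 + 4 * p\<^sup>2" by (simp add: power2_eq_square)
  qed (use k in simp)
  also have "(k * 2 powr (p - 2) * e\<^sup>2) * (1 + 4 * p\<^sup>2) = smooth_const p * e\<^sup>2"
    by (simp add: smooth_const_def k_def)
  finally show ?thesis by simp
qed

text \<open>A token \<open>(l, w, i)\<close> encodes a correction at scale \<open>2 ^ -l\<close> in the direction \<open>w \<phi>\<^sub>i\<close>; quantising the
  corrections makes the functions reachable in \<open>R\<close> steps few enough for a union bound.\<close>

definition step :: "nat \<times> complex \<times> nat \<Rightarrow> 'a \<Rightarrow> complex"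
  where "step t x = (case t of (l, w, i) \<Rightarrow> complex_of_real (step_size p * (1 / 2) ^ l) * w * \<phi> i x)"

definition walk :: "(nat \<times> complex \<times> nat) list \<Rightarrow> 'a \<Rightarrow> complex"
  where "walk ts x = (\<Sum>t\<leftarrow>ts. step t x)"

definition tokens :: "nat \<Rightarrow> nat \<Rightarrow> (nat \<times> complex \<times> nat) set"
  where "tokens L N = {..L} \<times> {1, -1, \<i>, -\<i>} \<times> {1..N}"

lemma bfun_step [simp]: "bfun (step t)"
  by (cases t) (simp add: step_def[abs_def])

lemma walk_Nil: "walk [] = (\<lambda>x. 0)"
  by (simp add: walk_def fun_eq_iff)

lemma walk_Cons: "walk (t # ts) = (\<lambda>x. walk ts x + step t x)"
  by (simp add: walk_def fun_eq_iff)

lemma bfun_walk [simp]: "bfun (walk ts)"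
  by (induction ts) (simp_all add: walk_Nil walk_Cons)

section \<open>Descent towards a fixed target\<close>

context
  fixes f g :: "'a \<Rightarrow> complex"
  assumes f: "bfun f" and fT: "\<And>x. cmod (f x) \<le> T" and fp: "(\<integral>x. cmod (f x) powr p \<partial>M) \<le> 1"
    and g: "\<And>x. g x = complex_of_real (cmod (f x) powr (p - 2)) * f x"
begin

lemma bfun_target: "bfun g"
proof -
  have "bfun (\<lambda>x. complex_of_real (cmod (f x) powr (p - 2)))"
    by (rule bfun_of_real[where u = "\<lambda>t. t powr (p - 2)" and U = "\<lambda>b. b powr (p - 2)"])
      (use f p in \<open>auto intro: powr_mono2\<close>)
  then have "bfun (\<lambda>x. complex_of_real (cmod (f x) powr (p - 2)) * f x)" using f by simp
  then show ?thesis using g by (simp add: g[abs_def])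
qed

lemma cmod_target: "cmod (g x) = cmod (f x) powr (p - 1)"
proof (cases "f x = 0")
  case False
  then have "cmod (f x) powr (p - 2) * cmod (f x) powr 1 = cmod (f x) powr (p - 1)"
    unfolding powr_add[symmetric] by simp
  then show ?thesis using False by (simp add: g norm_mult)
qed (use p in \<open>simp add: g\<close>)

text \<open>The modulus of \<open>g\<close> is at most \<open>1 + cmod (f x) powr p\<close>. The
  bound \<open>2\<close> lets the dyadic decomposition of the coefficients start at scale
  \<open>1\<close>.\<close>

lemma coef_target_le: "cmod (coef g i) \<le> 2"
proof -
  have "cmod (coef g i) \<le> (\<integral>x. cmod (g x * cnj (\<phi> i x)) \<partial>M)"
    unfolding coef_def by (rule integral_norm_bound)
  also have "\<dots> \<le> (\<integral>x. 1 + cmod (f x) powr p \<partial>M)"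
  proof (rule integral_mono)
    fix x
    have "cmod (g x * cnj (\<phi> i x)) \<le> cmod (g x) * 1"
      unfolding norm_mult using phi_le by (intro mult_left_mono) auto
    also have "\<dots> = cmod (f x) powr (p - 1)" by (simp add: cmod_target)
    also have "\<dots> \<le> 1 + cmod (f x) powr p"
    proof (cases "cmod (f x) \<le> 1")
      case True
      then have "cmod (f x) powr (p - 1) \<le> 1" using p by (intro powr_le1) auto
      then show ?thesis by (simp add: add_increasing2)
    next
      case False
      then have "cmod (f x) powr (p - 1) \<le> cmod (f x) powr p" by (intro powr_mono) auto
      then show ?thesis by simp
    qed
    finally show "cmod (g x * cnj (\<phi> i x)) \<le> 1 + cmod (f x) powr p" .
  qed (use bfun_target f p in \<open>auto intro!: integrable_norm bfun_integrable\<close>)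
  also have "\<dots> \<le> 2" using f fp p by (simp add: prob_space)
  finally show ?thesis .
qed

text \<open>Integrates \<open>wt_young\<close>. Only half of the potential is spent, so the other
  half remains to bound \<open>pot F\<close> when \<open>gap F \<le> 0\<close>.\<close>

lemma pairing_le:
  assumes F: "bfun F"
  shows "Re (\<integral>x. F x * cnj (g x) \<partial>M) \<le> pot F / 2 + 2 * p"
proof -
  have "Re (\<integral>x. F x * cnj (g x) \<partial>M) = (\<integral>x. Re (F x * cnj (g x)) \<partial>M)"
    by (intro bfun_integral_Re[symmetric] bfun_mult bfun_cnj bfun_target F)
  also have "\<dots> \<le> (\<integral>x. rho p T (cmod (F x)) / 2 + 2 * p * cmod (f x) powr p \<partial>M)"
  proof (rule integral_mono)
    fix x
    have "Re (F x * cnj (g x)) \<le> cmod (F x * cnj (g x))" by (rule complex_Re_le_cmod)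
    also have "\<dots> = cmod (F x) * cmod (f x) powr (p - 1)" by (simp add: norm_mult cmod_target)
    also have "\<dots> \<le> wt p T (cmod (F x)) * (cmod (F x))\<^sup>2 / (2 * p) + 2 * p * cmod (f x) powr p"
      by (rule wt_young) (use p T fT in auto)
    also have "\<dots> \<le> rho p T (cmod (F x)) / 2 + 2 * p * cmod (f x) powr p"
      using rho_ge[of p T "cmod (F x)"] p T by simp
    finally show "Re (F x * cnj (g x)) \<le> rho p T (cmod (F x)) / 2 + 2 * p * cmod (f x) powr p" .
  next
    show "integrable M (\<lambda>x. Re (F x * cnj (g x)))"
      by (intro bfun_integrable_Re bfun_mult bfun_cnj bfun_target F)
  qed (use F f p in \<open>auto intro!: Bochner_Integration.integrable_add\<close>)
  also have "\<dots> = pot F / 2 + 2 * p * (\<integral>x. cmod (f x) powr p \<partial>M)"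
    using F f p by (simp add: pot_def)
  also have "\<dots> \<le> pot F / 2 + 2 * p" using fp p mult_left_mono[of _ 1 "2 * p"] by simp
  finally show ?thesis .
qed

text \<open>The quantity lowered by the descent. Its gradient at \<open>F\<close> is
  \<open>mir F - g\<close>, so a suitable multiple of \<open>\<phi> i\<close> lowers it whenever
  \<open>mir F\<close> and \<open>g\<close> differ in their \<open>i\<close>-th coefficient.\<close>

definition gap :: "('a \<Rightarrow> complex) \<Rightarrow> real"
  where "gap F = pot F - Re (\<integral>x. F x * cnj (g x) \<partial>M)"

lemma pot_nonneg: "0 \<le> pot F"
  unfolding pot_def using p T by (intro integral_nonneg_AE AE_I2 rho_nonneg) auto

lemma gap_ge: "bfun F \<Longrightarrow> - 2 * p \<le> gap F"
  using pairing_le[of F] pot_nonneg[of F] by (simp add: gap_def)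

lemma pot_le_if_gap: "bfun F \<Longrightarrow> gap F \<le> 0 \<Longrightarrow> pot F \<le> 4 * p"
  using pairing_le[of F] by (simp add: gap_def)

lemma gap_walk_Nil: "gap (walk []) = 0"
  using p T by (simp add: gap_def walk_Nil pot_def)

text \<open>With \<open>\<theta> = (1 / 2) ^ l\<close> and
  \<open>e = step_size p * \<theta>\<close>, the quarter turn aligned with the residual gains at
  least \<open>e * \<theta> / 4\<close> at first order, and smoothness takes back
  \<open>e * \<theta> / 8\<close>.\<close>

lemma gap_step:
  assumes neg: "gap (walk ts) \<le> 0" and i: "(1 / 2) ^ l / 2 \<le> cmod (coef g i - coef (mir (walk ts)) i)"
  shows "\<exists>w\<in>{1, -1, \<i>, -\<i>}. gap (walk ((l, w, i) # ts)) \<le> gap (walk ts) - step_size p / 8 * (1 / 4) ^ l"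
proof -
  define F where "F = walk ts"
  have F: "bfun F" by (simp add: F_def)
  define d where "d = coef g i - coef (mir F) i"
  obtain w where w: "w \<in> {1, -1, \<i>, -\<i>}" "cmod d / 2 \<le> Re (w * cnj d)"
    by (rule quarter_turn_obtain)
  define e where "e = step_size p * (1 / 2) ^ l"
  have e: "0 \<le> e" "e \<le> 1" "0 < step_size p"
    unfolding e_def using step_size_bounds[OF p] by (auto intro!: mult_le_one power_le_one)
  define v where "v = step (l, w, i)"
  have v: "bfun v" by (simp add: v_def)
  have v_eq: "v = (\<lambda>x. complex_of_real e * w * \<phi> i x)" by (simp add: v_def step_def e_def fun_eq_iff)
  have ve: "cmod (v x) \<le> e" for x
  proof -
    have "cmod w = 1" using w(1) by auto
    then have "cmod (v x) = e * cmod (\<phi> i x)" using e by (simp add: v_eq norm_mult)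
    also have "\<dots> \<le> e * 1" using e phi_le by (intro mult_left_mono) auto
    finally show ?thesis by simp
  qed
  have pair: "(\<integral>x. v x * cnj (h x) \<partial>M) = complex_of_real e * (w * cnj (coef h i))" if "bfun h" for h
  proof -
    have "(\<integral>x. v x * cnj (h x) \<partial>M) = (\<integral>x. (complex_of_real e * w) * cnj (h x * cnj (\<phi> i x)) \<partial>M)"
      by (simp add: v_eq mult_ac)
    also have "\<dots> = (complex_of_real e * w) * (\<integral>x. cnj (h x * cnj (\<phi> i x)) \<partial>M)"
      by (rule integral_mult_right_zero)
    also have "(\<integral>x. cnj (h x * cnj (\<phi> i x)) \<partial>M) = cnj (coef h i)"
      unfolding coef_def by (rule Bochner_Integration.integral_cnj)
    finally show ?thesis by (simp add: mult.assoc)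
  qed
  have "gap (\<lambda>x. F x + v x) = pot (\<lambda>x. F x + v x) - Re (\<integral>x. F x * cnj (g x) \<partial>M) - Re (\<integral>x. v x * cnj (g x) \<partial>M)"
  proof -
    have "integrable M (\<lambda>x. F x * cnj (g x))" "integrable M (\<lambda>x. v x * cnj (g x))"
      by (intro bfun_integrable bfun_mult bfun_cnj F v bfun_target)+
    then show ?thesis by (simp add: gap_def distrib_right)
  qed
  also have "\<dots> \<le> gap F + (Re (\<integral>x. v x * cnj (mir F x) \<partial>M) - Re (\<integral>x. v x * cnj (g x) \<partial>M)) + smooth_const p * e\<^sup>2"
    using pot_add_le[OF F v ve e(1,2)] pot_le_if_gap[OF F] neg unfolding gap_def F_def by simp
  also have "Re (\<integral>x. v x * cnj (mir F x) \<partial>M) - Re (\<integral>x. v x * cnj (g x) \<partial>M) = - (e * Re (w * cnj d))"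
    unfolding pair[OF bfun_target] pair[OF bfun_mir[OF F]] d_def
    by (simp add: algebra_simps)
  also have "\<dots> \<le> - (e * ((1 / 2) ^ l / 4))"
    using w(2) i e unfolding d_def F_def by (intro le_imp_neg_le mult_left_mono) auto
  also have "smooth_const p * e\<^sup>2 = e * (1 / 2) ^ l / 8"
    using smooth_const_ge_1[OF p] by (simp add: e_def step_size_def power2_eq_square)
  finally have "gap (\<lambda>x. F x + v x) \<le> gap F - e * (1 / 2) ^ l / 8" by simp
  also have "e * (1 / 2) ^ l / 8 = step_size p / 8 * (1 / 4) ^ l"
    by (simp add: e_def mult.assoc power_mult_distrib[symmetric])
  finally show ?thesis using w(1) by (auto simp: walk_Cons F_def v_def)
qed

text \<open>Each correction lowers the gap by a fixed amount and the gap is at least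
  \<open>- 2 * p\<close>, so a maximal number of corrections at scale \<open>l\<close> exists. At
  that point \<open>gap_step\<close> leaves no large residual on \<open>S\<close>.\<close>

lemma gap_phase:
  assumes neg: "gap (walk ts) \<le> 0" and ts: "set ts \<subseteq> tokens L N" and l: "l \<le> L" and S: "S \<subseteq> {1..N}"
  obtains us where "set us \<subseteq> tokens L N" "gap (walk us) \<le> 0"
    "gap (walk us) \<le> gap (walk ts) - step_size p / 8 * (1 / 4) ^ l * (real (length us) - real (length ts))"
    "\<forall>i\<in>S. cmod (coef g i - coef (mir (walk us)) i) < (1 / 2) ^ l / 2"
proof -
  define c where "c = step_size p / 8 * (1 / 4) ^ l"
  have c: "c > 0" using step_size_bounds[OF p] by (simp add: c_def)
  define P where "P n \<longleftrightarrow> (\<exists>us. length us = length ts + n \<and> set us \<subseteq> tokens L N \<and>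
    gap (walk us) \<le> gap (walk ts) - c * real n)" for n
  have P0: "P 0" unfolding P_def using ts by (intro exI[of _ ts]) auto
  have bound: "n \<le> nat \<lceil>2 * p / c\<rceil>" if "P n" for n
  proof -
    from that obtain us where "gap (walk us) \<le> gap (walk ts) - c * real n" by (auto simp: P_def)
    then have "c * real n \<le> 2 * p" using gap_ge[of "walk us"] neg by simp
    then have "real n \<le> 2 * p / c" using c by (simp add: divide_simps mult.commute)
    then show ?thesis by linarith
  qed
  obtain n where n: "P n" "\<And>k. P k \<Longrightarrow> k \<le> n"
    using ex_has_greatest_nat[of P 0 "\<lambda>x. x" "Suc (nat \<lceil>2 * p / c\<rceil>)"] P0 bound by (auto simp: less_Suc_eq_le)
  from n(1) obtain us where us: "length us = length ts + n" "set us \<subseteq> tokens L N"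
    "gap (walk us) \<le> gap (walk ts) - c * real n" by (auto simp: P_def)
  have neg': "gap (walk us) \<le> 0" using us(3) neg c by (smt (verit) mult_nonneg_nonneg of_nat_0_le_iff)
  have "cmod (coef g i - coef (mir (walk us)) i) < (1 / 2) ^ l / 2" if i: "i \<in> S" for i
  proof (rule ccontr)
    assume "\<not> ?thesis"
    then obtain w where w: "w \<in> {1, -1, \<i>, -\<i>}" "gap (walk ((l, w, i) # us)) \<le> gap (walk us) - c"
      using gap_step[OF neg', of l i] by (auto simp: c_def not_less)
    have "P (Suc n)" unfolding P_def
      by (intro exI[of _ "(l, w, i) # us"])
        (use us w S i l in \<open>auto simp: tokens_def algebra_simps\<close>)
    then show False using n(2) by force
  qed
  then show ?thesis using that[of us] us neg' by (simp add: c_def)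
qed

text \<open>The deterministic core. At the end of the phase with \<open>\<theta> = 2 ^ -l\<close>, a
  coefficient of \<open>g\<close> of size at least \<open>\<theta>\<close> forces one of size at
  least \<open>\<theta> / 2\<close> on the hypothesis, so \<open>spec\<close> bounds the number of
  such indices in \<open>S\<close> by the corrections made so far. With weights
  \<open>4 ^ -l\<close> these numbers are paid for by the decrease of the gap, at most
  \<open>2 * p\<close> in all.\<close>

lemma coef_square_sum_le:
  fixes K e :: real
  assumes S: "S \<subseteq> {1..N}" and cS: "card S \<le> 4 ^ L" and K: "0 < K"
    and spec: "\<And>l ts. l \<le> L \<Longrightarrow> set ts \<subseteq> tokens L N \<Longrightarrow> pot (walk ts) \<le> 4 * p \<Longrightarrow>
      real (card (S \<inter> {i. (1 / 2) ^ l / 2 \<le> cmod (coef (mir (walk ts)) i)})) \<le> K * (real (length ts) + 1 + 4 ^ l * e)"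
  shows "(\<Sum>i\<in>S. (cmod (coef g i))\<^sup>2)
    \<le> 4 * (K * (64 * p / (3 * step_size p) + 4 / 3 + real (L + 1) * e)) + 1"
proof -
  have fS: "finite S" using S by (rule finite_subset) simp
  define n where "n j = real (card {i\<in>S. (1 / 2) ^ j \<le> cmod (coef g i)})" for j :: nat
  \<comment> \<open>By \<open>spec\<close>, each bracket is at most the number of tokens in use at
    the end of the phase at scale \<open>j\<close>.\<close>
  define A where "A l = (\<Sum>j<l. (1 / 4) ^ j * (n j / K - 1 - 4 ^ j * e))" for l
  define c where "c = 3 * step_size p / 32"
  have c: "0 < c" using step_size_bounds[OF p] by (simp add: c_def)
  have c': "step_size p / 8 = c * (4 / 3)" by (simp add: c_def)
  txt \<open>The last term \<open>4 / 3 * 4 ^ -l * length ts\<close> pays in advance for the tokens used so far at all later scales,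
    since \<open>4 / 3 * 4 ^ -l = (\<Sum>j\<ge>l. 4 ^ -j)\<close>.\<close>
  have inv: "\<exists>ts. set ts \<subseteq> tokens L N \<and> gap (walk ts) \<le> 0 \<and>
      gap (walk ts) \<le> - (c * (A l + 4 / 3 * (1 / 4) ^ l * real (length ts)))" if "l \<le> Suc L" for l
    using that
  proof (induction l)
    case 0
    show ?case by (rule exI[of _ "[]"]) (simp add: gap_walk_Nil A_def)
  next
    case (Suc l)
    then obtain ts where ts: "set ts \<subseteq> tokens L N" "gap (walk ts) \<le> 0"
      "gap (walk ts) \<le> - (c * (A l + 4 / 3 * (1 / 4) ^ l * real (length ts)))" by auto
    have l: "l \<le> L" using Suc by simp
    obtain us where us: "set us \<subseteq> tokens L N" "gap (walk us) \<le> 0"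
      "gap (walk us) \<le> gap (walk ts) - step_size p / 8 * (1 / 4) ^ l * (real (length us) - real (length ts))"
      "\<forall>i\<in>S. cmod (coef g i - coef (mir (walk us)) i) < (1 / 2) ^ l / 2"
      by (rule gap_phase[OF ts(2,1) l S])
    have "{i\<in>S. (1 / 2) ^ l \<le> cmod (coef g i)} \<subseteq> S \<inter> {i. (1 / 2) ^ l / 2 \<le> cmod (coef (mir (walk us)) i)}"
    proof
      fix i assume i: "i \<in> {i\<in>S. (1 / 2) ^ l \<le> cmod (coef g i)}"
      then have "cmod (coef g i - coef (mir (walk us)) i) < (1 / 2) ^ l / 2" using us(4) by blast
      then have "cmod (coef g i) - cmod (coef (mir (walk us)) i) < (1 / 2) ^ l / 2"
        using norm_triangle_ineq2[of "coef g i" "coef (mir (walk us)) i"] by linarith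
      then show "i \<in> S \<inter> {i. (1 / 2) ^ l / 2 \<le> cmod (coef (mir (walk us)) i)}" using i by simp
    qed
    then have "n l \<le> real (card (S \<inter> {i. (1 / 2) ^ l / 2 \<le> cmod (coef (mir (walk us)) i)}))"
      unfolding n_def using fS by (intro of_nat_mono card_mono) auto
    also have "\<dots> \<le> K * (real (length us) + 1 + 4 ^ l * e)"
      by (rule spec[OF l us(1) pot_le_if_gap]) (use us in auto)
    finally have "n l / K \<le> real (length us) + 1 + 4 ^ l * e"
      using K by (simp add: pos_divide_le_eq mult.commute[of _ K])
    then have "n l / K - 1 - 4 ^ l * e \<le> real (length us)" by simp
    then have "(1 / 4) ^ l * (n l / K - 1 - 4 ^ l * e) \<le> (1 / 4) ^ l * real (length us)"
      by (rule mult_left_mono) simp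
    moreover have "A (Suc l) = A l + (1 / 4) ^ l * (n l / K - 1 - 4 ^ l * e)" by (simp add: A_def)
    moreover have "4 / 3 * (1 / 4) ^ Suc l * real (length us) = (1 / 4) ^ l * real (length us) / 3" by simp
    ultimately have "A (Suc l) + 4 / 3 * (1 / 4) ^ Suc l * real (length us) \<le> A l + 4 / 3 * (1 / 4) ^ l * real (length us)"
      by linarith
    then have "- (c * (A l + 4 / 3 * (1 / 4) ^ l * real (length us)))
        \<le> - (c * (A (Suc l) + 4 / 3 * (1 / 4) ^ Suc l * real (length us)))"
      using c by (intro le_imp_neg_le mult_left_mono) auto
    moreover have "gap (walk us) \<le> - (c * (A l + 4 / 3 * (1 / 4) ^ l * real (length us)))"
      using us(3) ts(3) unfolding c' by (simp add: field_simps)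
    ultimately have "gap (walk us) \<le> - (c * (A (Suc l) + 4 / 3 * (1 / 4) ^ Suc l * real (length us)))"
      by linarith
    then show ?case using us by blast
  qed
  obtain ts where ts: "gap (walk ts) \<le> - (c * (A (Suc L) + 4 / 3 * (1 / 4) ^ Suc L * real (length ts)))"
    using inv[of "Suc L"] by auto
  have "c * A (Suc L) \<le> c * (A (Suc L) + 4 / 3 * (1 / 4) ^ Suc L * real (length ts))"
    using c by (intro mult_left_mono) auto
  also have "\<dots> \<le> 2 * p" using ts gap_ge[of "walk ts"] by simp
  finally have "A (Suc L) \<le> 2 * p / c" using c by (simp add: divide_simps mult.commute)
  also have "\<dots> = 64 * p / (3 * step_size p)" by (simp add: c_def)
  finally have A: "A (Suc L) \<le> 64 * p / (3 * step_size p)" .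
  have geo: "(\<Sum>j<Suc L. (1 / 4 :: real) ^ j) \<le> 4 / 3"
    using geometric_sum_less[of "1 / 4 :: real" "{..<Suc L}"] by simp
  have "A (Suc L) = (\<Sum>j<Suc L. (1 / 4) ^ j * n j) / K - (\<Sum>j<Suc L. (1 / 4) ^ j) - real (Suc L) * e"
  proof -
    have "(1 / 4) ^ j * (n j / K - 1 - 4 ^ j * e) = (1 / 4) ^ j * n j / K - (1 / 4) ^ j - e" for j
      by (simp add: algebra_simps power_divide)
    then show ?thesis unfolding A_def by (simp only: sum_subtractf sum_divide_distrib) simp
  qed
  then have "(\<Sum>j<Suc L. (1 / 4) ^ j * n j) / K \<le> 64 * p / (3 * step_size p) + 4 / 3 + real (L + 1) * e"
    using A geo by simp
  then have n_sum: "(\<Sum>j<Suc L. (1 / 4) ^ j * n j) \<le> K * (64 * p / (3 * step_size p) + 4 / 3 + real (L + 1) * e)"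
    using K by (simp only: pos_divide_le_eq mult.commute[of _ K])
  \<comment> \<open>A square is charged to the first scale that the coefficient reaches, at the loss
    of a factor \<open>4\<close>. Coefficients below \<open>2 ^ -L\<close> contribute at most
    \<open>card S * (1 / 4) ^ L \<le> 1\<close> together.\<close>
  have dyadic: "(cmod (coef g i))\<^sup>2 \<le> 4 * (\<Sum>j<Suc L. (1 / 4) ^ j * of_bool ((1 / 2) ^ j \<le> cmod (coef g i))) + (1 / 4) ^ L" for i
  proof (cases "cmod (coef g i) < (1 / 2) ^ L")
    case True
    then have "(cmod (coef g i))\<^sup>2 \<le> ((1 / 2) ^ L)\<^sup>2" by (intro power_mono) auto
    also have "\<dots> = (1 / 4) ^ L" by (simp add: power2_eq_square power_mult_distrib[symmetric])
    finally show ?thesis by (simp add: add_increasing sum_nonneg del: sum.lessThan_Suc)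
  next
    case False
    define j where "j = (LEAST j. (1 / 2) ^ j \<le> cmod (coef g i))"
    have j: "(1 / 2) ^ j \<le> cmod (coef g i)" unfolding j_def by (rule LeastI[of _ L]) (use False in simp)
    have jL: "j \<le> L" unfolding j_def by (rule Least_le) (use False in simp)
    \<comment> \<open>The factor \<open>2\<close> comes from the minimality of \<open>j\<close>, or
      from \<open>coef_target_le\<close> at the top scale.\<close>
    have "cmod (coef g i) \<le> 2 * (1 / 2) ^ j"
    proof (cases j)
      case 0
      then show ?thesis using coef_target_le by simp
    next
      case (Suc k)
      then have "k < (LEAST j. (1 / 2) ^ j \<le> cmod (coef g i))" by (simp add: j_def)
      then have "\<not> (1 / 2) ^ k \<le> cmod (coef g i)" by (rule not_less_Least)
      then show ?thesis using Suc by simp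
    qed
    then have "(cmod (coef g i))\<^sup>2 \<le> (2 * (1 / 2) ^ j)\<^sup>2" by (intro power_mono) auto
    also have "\<dots> = 4 * ((1 / 4) ^ j * of_bool ((1 / 2) ^ j \<le> cmod (coef g i)))"
      using j by (simp add: power2_eq_square power_mult_distrib[symmetric])
    also have "\<dots> \<le> 4 * (\<Sum>j<Suc L. (1 / 4) ^ j * of_bool ((1 / 2) ^ j \<le> cmod (coef g i)))"
      using jL by (intro mult_left_mono member_le_sum) auto
    finally show ?thesis by (simp add: add_increasing2 del: sum.lessThan_Suc)
  qed
  have "(\<Sum>i\<in>S. (cmod (coef g i))\<^sup>2)
      \<le> (\<Sum>i\<in>S. 4 * (\<Sum>j<Suc L. (1 / 4) ^ j * of_bool ((1 / 2) ^ j \<le> cmod (coef g i))) + (1 / 4) ^ L)"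
    by (intro sum_mono dyadic)
  also have "\<dots> = 4 * (\<Sum>i\<in>S. \<Sum>j<Suc L. (1 / 4) ^ j * of_bool ((1 / 2) ^ j \<le> cmod (coef g i))) + real (card S) * (1 / 4) ^ L"
    by (simp only: sum.distrib sum_distrib_left sum_constant)
  also have "(\<Sum>i\<in>S. \<Sum>j<Suc L. (1 / 4) ^ j * of_bool ((1 / 2) ^ j \<le> cmod (coef g i))) = (\<Sum>j<Suc L. (1 / 4) ^ j * n j)"
  proof (subst sum.swap, rule sum.cong)
    fix j
    have "(\<Sum>i\<in>S. (1 / 4) ^ j * of_bool ((1 / 2) ^ j \<le> cmod (coef g i)))
        = (1 / 4 :: real) ^ j * (\<Sum>i\<in>S. of_bool ((1 / 2) ^ j \<le> cmod (coef g i)))"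
      by (rule sum_distrib_left[symmetric])
    also have "(\<Sum>i\<in>S. of_bool ((1 / 2) ^ j \<le> cmod (coef g i))) = n j"
      unfolding n_def using fS by (simp add: sum.If_cases of_bool_def Int_def)
    finally show "(\<Sum>i\<in>S. (1 / 4) ^ j * of_bool ((1 / 2) ^ j \<le> cmod (coef g i))) = (1 / 4) ^ j * n j" .
  qed simp
  also have "real (card S) * (1 / 4) ^ L \<le> 1"
  proof -
    have "real (card S) \<le> 4 ^ L" using cS by (metis of_nat_le_iff of_nat_numeral of_nat_power)
    then show ?thesis by (simp add: power_divide divide_simps)
  qed
  finally show ?thesis using n_sum by linarith
qed

end

end

section \<open>The random kernel\<close>

context bounded_system
begin

text \<open>The kernel of the centred quadratic form \<open>\<Sum>\<^sub>S |coef g i|\<^sup>2 -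
  \<delta> \<Sum>\<^sub>[\<^sub>N\<^sub>] |coef g i|\<^sup>2\<close> with
  \<open>\<delta> = m / N\<close>.\<close>

definition kernel :: "nat \<Rightarrow> nat \<Rightarrow> nat set \<Rightarrow> 'a \<times> 'a \<Rightarrow> complex"
  where "kernel N m S z = (\<Sum>i=1..N. complex_of_real (of_bool (i \<in> S) - real m / real N) *
    (cnj (\<phi> i (fst z)) * \<phi> i (snd z)))"

lemma kernel_measurable [measurable]: "kernel N m S \<in> borel_measurable (M \<Otimes>\<^sub>M M)"
proof -
  have [measurable]: "(\<lambda>x. cnj (\<phi> i x)) \<in> borel_measurable M" for i
    using bfun_cnj[OF bfun_phi] by (rule bfun_measurable)
  show ?thesis unfolding kernel_def[abs_def] by measurable
qed

text \<open>At a fixed point \<open>z\<close> the real and imaginary parts are centred sums with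
  coefficients bounded by \<open>1\<close>, to which \<open>nsub_moment_le\<close> applies.\<close>

lemma kernel_moment_le:
  assumes "m \<le> N" "1 \<le> m"
  shows "(\<Sum>S\<in>nsub N m. cmod (kernel N m S z) ^ r)
    \<le> real (N choose m) * (2 ^ r * (4 * exp 1 * real (N + 1) * fact r * sqrt (real m) ^ r))"
proof -
  define c where "c i = cnj (\<phi> i (fst z)) * \<phi> i (snd z)" for i
  have c1: "cmod (c i) \<le> 1" for i
    unfolding c_def norm_mult using phi_le by (simp add: mult_le_one)
  define X where "X S = (\<Sum>i=1..N. (of_bool (i \<in> S) - real m / real N) * Re (c i))" for S
  define Y where "Y S = (\<Sum>i=1..N. (of_bool (i \<in> S) - real m / real N) * Im (c i))" for S
  have ker: "Re (kernel N m S z) = X S" "Im (kernel N m S z) = Y S" for S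
    unfolding kernel_def X_def Y_def c_def[symmetric] Re_sum Im_sum by simp_all
  have "cmod (kernel N m S z) ^ r \<le> 2 ^ r * (\<bar>X S\<bar> ^ r + \<bar>Y S\<bar> ^ r)" for S
  proof -
    have "cmod (kernel N m S z) \<le> \<bar>X S\<bar> + \<bar>Y S\<bar>" using cmod_le[of "kernel N m S z"] by (simp add: ker)
    also have "\<dots> \<le> 2 * max \<bar>X S\<bar> \<bar>Y S\<bar>" by simp
    finally have "cmod (kernel N m S z) ^ r \<le> (2 * max \<bar>X S\<bar> \<bar>Y S\<bar>) ^ r" by (intro power_mono) auto
    also have "\<dots> = 2 ^ r * max \<bar>X S\<bar> \<bar>Y S\<bar> ^ r" by (rule power_mult_distrib)
    also have "\<dots> \<le> 2 ^ r * (\<bar>X S\<bar> ^ r + \<bar>Y S\<bar> ^ r)"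
      by (intro mult_left_mono) (auto simp: max_def)
    finally show ?thesis .
  qed
  then have "(\<Sum>S\<in>nsub N m. cmod (kernel N m S z) ^ r) \<le> (\<Sum>S\<in>nsub N m. 2 ^ r * (\<bar>X S\<bar> ^ r + \<bar>Y S\<bar> ^ r))"
    by (rule sum_mono)
  also have "\<dots> = 2 ^ r * ((\<Sum>S\<in>nsub N m. \<bar>X S\<bar> ^ r) + (\<Sum>S\<in>nsub N m. \<bar>Y S\<bar> ^ r))"
    by (simp only: sum_distrib_left[symmetric] sum.distrib)
  also have "\<dots> \<le> 2 ^ r * (real (N choose m) * (2 * exp 1 * real (N + 1) * fact r * sqrt (real m) ^ r)
      + real (N choose m) * (2 * exp 1 * real (N + 1) * fact r * sqrt (real m) ^ r))"
    unfolding X_def Y_def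
    by (intro mult_left_mono add_mono nsub_moment_le assms)
      (auto intro: order_trans[OF abs_Re_le_cmod c1] order_trans[OF abs_Im_le_cmod c1])
  finally show ?thesis by (simp add: algebra_simps)
qed

text \<open>A crude bound that serves integrability.\<close>

lemma kernel_le: "cmod (kernel N m S z) \<le> (\<Sum>i=1..N. \<bar>of_bool (i \<in> S) - real m / real N\<bar>)"
  unfolding kernel_def
proof (rule sum_norm_le)
  fix i
  show "cmod (complex_of_real (of_bool (i \<in> S) - real m / real N) * (cnj (\<phi> i (fst z)) * \<phi> i (snd z)))
      \<le> \<bar>of_bool (i \<in> S) - real m / real N\<bar>"
    unfolding norm_mult norm_of_real using phi_le
    by (intro mult_left_le) (auto intro: mult_le_one)
qed

sublocale pair: pair_prob_space M M ..

lemma integrable_pair_bounded: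
  fixes u :: "'a \<times> 'a \<Rightarrow> 'b::{banach, second_countable_topology}"
  assumes "u \<in> borel_measurable (M \<Otimes>\<^sub>M M)" "\<And>z. norm (u z) \<le> B"
  shows "integrable (M \<Otimes>\<^sub>M M) u"
  by (rule pair.P.integrable_const_bound[of _ B]) (use assms in auto)

lemma kernel_power_integrable: "integrable (M \<Otimes>\<^sub>M M) (\<lambda>z. cmod (kernel N m S z) ^ r)"
  by (rule integrable_pair_bounded[where B = "(\<Sum>i=1..N. \<bar>of_bool (i \<in> S) - real m / real N\<bar>) ^ r"])
    (auto intro!: power_mono kernel_le simp del: One_nat_def)

text \<open>Markov's inequality over the choice of \<open>S\<close>, with the finite sum moved under
  the integral.\<close>

lemma kernel_large_moment_card_le:
  assumes "m \<le> N" "1 \<le> m" and B: "0 < B"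
  shows "real (card {S\<in>nsub N m. B < (\<integral>z. cmod (kernel N m S z) ^ r \<partial>(M \<Otimes>\<^sub>M M))}) * B
    \<le> real (N choose m) * (2 ^ r * (4 * exp 1 * real (N + 1) * fact r * sqrt (real m) ^ r))"
proof -
  define I where "I S = (\<integral>z. cmod (kernel N m S z) ^ r \<partial>(M \<Otimes>\<^sub>M M))" for S
  have I0: "0 \<le> I S" for S unfolding I_def by simp
  have "real (card {S\<in>nsub N m. B < I S}) * B = (\<Sum>S | S \<in> nsub N m \<and> B < I S. B)" by simp
  also have "\<dots> \<le> (\<Sum>S | S \<in> nsub N m \<and> B < I S. I S)" by (rule sum_mono) auto
  also have "\<dots> \<le> (\<Sum>S\<in>nsub N m. I S)" by (rule sum_mono2) (auto simp: I0)
  also have "\<dots> = (\<integral>z. (\<Sum>S\<in>nsub N m. cmod (kernel N m S z) ^ r) \<partial>(M \<Otimes>\<^sub>M M))"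
    unfolding I_def by (rule Bochner_Integration.integral_sum[symmetric]) (rule kernel_power_integrable)
  also have "\<dots> \<le> (\<integral>z. real (N choose m) * (2 ^ r * (4 * exp 1 * real (N + 1) * fact r * sqrt (real m) ^ r)) \<partial>(M \<Otimes>\<^sub>M M))"
    by (rule integral_mono kernel_moment_le assms Bochner_Integration.integrable_sum
        kernel_power_integrable pair.P.integrable_const)+
  also have "\<dots> = real (N choose m) * (2 ^ r * (4 * exp 1 * real (N + 1) * fact r * sqrt (real m) ^ r))"
    by (simp add: pair.P.prob_space)
  finally show ?thesis unfolding I_def .
qed

lemma integral_pair_mult:
  fixes u v :: "'a \<Rightarrow> 'b::{banach, second_countable_topology, real_normed_field}"
  assumes [measurable]: "u \<in> borel_measurable M" "v \<in> borel_measurable M"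
    and uv: "\<And>x. norm (u x) \<le> A" "\<And>x. norm (v x) \<le> B"
  shows "(\<integral>z. u (fst z) * v (snd z) \<partial>(M \<Otimes>\<^sub>M M)) = (\<integral>x. u x \<partial>M) * (\<integral>x. v x \<partial>M)"
proof -
  have "integrable (M \<Otimes>\<^sub>M M) (\<lambda>z. u (fst z) * v (snd z))"
  proof (rule integrable_pair_bounded[where B = "A * B"])
    show "norm (u (fst z) * v (snd z)) \<le> A * B" for z
      unfolding norm_mult using uv by (intro mult_mono) (auto intro: order_trans[OF norm_ge_zero])
  qed measurable
  then have "(\<integral>z. u (fst z) * v (snd z) \<partial>(M \<Otimes>\<^sub>M M)) = (\<integral>x. \<integral>y. u x * v y \<partial>M \<partial>M)"
    by (subst pair.integral_fst'[symmetric]) auto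
  also have "\<dots> = (\<integral>x. u x \<partial>M) * (\<integral>x. v x \<partial>M)" by simp
  finally show ?thesis .
qed

text \<open>Each \<open>|coef g i|\<^sup>2\<close> is the product of an integral and its conjugate,
  hence one integral over the product space.\<close>

lemma coef_square_sum_eq_kernel:
  assumes g: "bfun g" and S: "S \<subseteq> {1..N}"
  shows "complex_of_real (\<Sum>i\<in>S. (cmod (coef g i))\<^sup>2) =
    complex_of_real (real m / real N * (\<Sum>i=1..N. (cmod (coef g i))\<^sup>2)) +
    (\<integral>z. g (fst z) * cnj (g (snd z)) * kernel N m S z \<partial>(M \<Otimes>\<^sub>M M))"
proof -
  define d where "d i = of_bool (i \<in> S) - real m / real N" for i
  obtain B where B: "\<And>x. cmod (g x) \<le> B" using g by (auto simp: bfun_def)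
  have B0: "B \<ge> 0" using B order_trans[OF norm_ge_zero] by blast
  have gphi: "cmod (g x * cnj (\<phi> i x)) \<le> B" for x i
    unfolding norm_mult using mult_mono[OF B phi_le B0 norm_ge_zero, of x i x] by simp
  have [measurable]: "g \<in> borel_measurable M" "(\<lambda>x. g x * cnj (\<phi> i x)) \<in> borel_measurable M"
    "(\<lambda>x. cnj (g x * cnj (\<phi> i x))) \<in> borel_measurable M" for i
    using g by (auto intro!: bfun_measurable bfun_mult bfun_cnj simp del: complex_cnj_mult)
  have prod_int: "integrable (M \<Otimes>\<^sub>M M) (\<lambda>z. (g (fst z) * cnj (\<phi> i (fst z))) * cnj (g (snd z) * cnj (\<phi> i (snd z))))" for i
  proof (rule integrable_pair_bounded[where B = "B * B"])
    show "cmod ((g (fst z) * cnj (\<phi> i (fst z))) * cnj (g (snd z) * cnj (\<phi> i (snd z)))) \<le> B * B" for z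
      unfolding norm_mult[of "g (fst z) * cnj (\<phi> i (fst z))"] complex_mod_cnj
      by (intro mult_mono gphi B0 norm_ge_zero)
  qed measurable
  have sq: "(\<integral>z. (g (fst z) * cnj (\<phi> i (fst z))) * cnj (g (snd z) * cnj (\<phi> i (snd z))) \<partial>(M \<Otimes>\<^sub>M M))
      = complex_of_real ((cmod (coef g i))\<^sup>2)" for i
  proof -
    have "(\<integral>z. (g (fst z) * cnj (\<phi> i (fst z))) * cnj (g (snd z) * cnj (\<phi> i (snd z))) \<partial>(M \<Otimes>\<^sub>M M))
      = (\<integral>x. g x * cnj (\<phi> i x) \<partial>M) * (\<integral>x. cnj (g x * cnj (\<phi> i x)) \<partial>M)"
      by (rule integral_pair_mult[where A = B and B = B]) (use gphi in \<open>auto simp del: complex_cnj_mult\<close>)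
    also have "(\<integral>x. cnj (g x * cnj (\<phi> i x)) \<partial>M) = cnj (coef g i)"
      unfolding coef_def by (rule Bochner_Integration.integral_cnj)
    finally show ?thesis unfolding coef_def[symmetric] complex_norm_square .
  qed
  have "(\<integral>z. g (fst z) * cnj (g (snd z)) * kernel N m S z \<partial>(M \<Otimes>\<^sub>M M))
    = (\<integral>z. (\<Sum>i=1..N. complex_of_real (d i) * ((g (fst z) * cnj (\<phi> i (fst z))) * cnj (g (snd z) * cnj (\<phi> i (snd z))))) \<partial>(M \<Otimes>\<^sub>M M))"
    unfolding kernel_def d_def[symmetric] sum_distrib_left by (simp add: mult_ac)
  also have "\<dots> = (\<Sum>i=1..N. \<integral>z. complex_of_real (d i) * ((g (fst z) * cnj (\<phi> i (fst z))) * cnj (g (snd z) * cnj (\<phi> i (snd z)))) \<partial>(M \<Otimes>\<^sub>M M))"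
    by (rule Bochner_Integration.integral_sum) (intro integrable_mult_right prod_int)
  also have "\<dots> = (\<Sum>i=1..N. complex_of_real (d i) * complex_of_real ((cmod (coef g i))\<^sup>2))"
    by (simp only: integral_mult_right_zero sq)
  also have "\<dots> = complex_of_real (\<Sum>i=1..N. d i * (cmod (coef g i))\<^sup>2)" by simp
  also have "(\<Sum>i=1..N. d i * (cmod (coef g i))\<^sup>2)
      = (\<Sum>i=1..N. if i \<in> S then (cmod (coef g i))\<^sup>2 else 0) - real m / real N * (\<Sum>i=1..N. (cmod (coef g i))\<^sup>2)"
    unfolding sum_distrib_left sum_subtractf[symmetric]
    by (rule sum.cong) (auto simp: d_def algebra_simps)
  also have "(\<Sum>i=1..N. if i \<in> S then (cmod (coef g i))\<^sup>2 else 0) = (\<Sum>i\<in>S. (cmod (coef g i))\<^sup>2)"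
    using S by (simp add: sum.If_cases Int_absorb1 Int_def[symmetric])
  finally show ?thesis by simp
qed

text \<open>\<open>q\<close> is conjugate to \<open>r\<close>. On either side of the curve
  \<open>w = u ^ (r - 1)\<close> one of the two terms alone dominates the product.\<close>

lemma young_powr:
  fixes u w q :: real
  assumes "0 \<le> u" "0 \<le> w" "2 \<le> r" and q: "q = real r / (real r - 1)"
  shows "u * w \<le> u ^ r + w powr q"
proof (cases "w \<le> u ^ (r - 1)")
  case True
  have "u * w \<le> u * u ^ (r - 1)" using True assms by (intro mult_left_mono) auto
  also have "\<dots> = u ^ r" using assms by (simp add: power_eq_if)
  finally show ?thesis by (simp add: add_increasing2)
next
  case False
  then have w: "w > 0" using assms by (smt (verit) zero_le_power)
  have "u \<le> w powr (1 / (real r - 1))"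
  proof (cases "u = 0")
    case False
    then have u: "u > 0" using assms by simp
    have "u = (u powr (real r - 1)) powr (1 / (real r - 1))" using u assms by (simp add: powr_powr)
    also have "u powr (real r - 1) = u ^ (r - 1)"
      using u assms by (simp add: powr_realpow[symmetric] of_nat_diff)
    also have "(u ^ (r - 1)) powr (1 / (real r - 1)) \<le> w powr (1 / (real r - 1))"
      using \<open>\<not> w \<le> u ^ (r - 1)\<close> u assms by (intro powr_mono2) auto
    finally show ?thesis .
  qed simp
  then have "u * w \<le> w powr (1 / (real r - 1)) * w powr 1" using w by (intro mult_mono) auto
  also have "\<dots> = w powr q" unfolding powr_add[symmetric] q using assms by (simp add: field_simps)
  finally show ?thesis using assms by (simp add: add_increasing)
qed

text \<open>Hoelder's inequality obtained from Young's: with the kernel divided by \<open>B\<close>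
  and the product of the two values of \<open>g\<close> by \<open>G\<^sup>2\<close>, both terms of
  \<open>young_powr\<close> integrate to at most \<open>1\<close>. The mean is left to Bessel's
  inequality.\<close>

lemma coef_square_sum_le_kernel:
  assumes g: "bfun g" and S: "S \<subseteq> {1..N}" and r: "2 \<le> r" and q: "q = real r / (real r - 1)"
    and B: "0 < B" "(\<integral>z. cmod (kernel N m S z) ^ r \<partial>(M \<Otimes>\<^sub>M M)) \<le> B ^ r"
    and G: "0 < G" "(\<integral>x. cmod (g x) powr q \<partial>M) \<le> G powr q"
  shows "(\<Sum>i\<in>S. (cmod (coef g i))\<^sup>2)
    \<le> real m / real N * (\<integral>x. (cmod (g x))\<^sup>2 \<partial>M) + 2 * B * G\<^sup>2"
proof -
  have q1: "1 < q" using r q by simp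
  obtain A where A: "\<And>x. cmod (g x) \<le> A" using g by (auto simp: bfun_def)
  have [measurable]: "g \<in> borel_measurable M" using g by (rule bfun_measurable)
  have [measurable]: "(\<lambda>x. cnj (g x)) \<in> borel_measurable M" using g by (auto intro!: bfun_measurable)
  define I where "I = (\<integral>z. g (fst z) * cnj (g (snd z)) * kernel N m S z \<partial>(M \<Otimes>\<^sub>M M))"
  have w_int: "(\<integral>z. cmod (g (fst z)) powr q * cmod (g (snd z)) powr q \<partial>(M \<Otimes>\<^sub>M M))
      = (\<integral>x. cmod (g x) powr q \<partial>M) * (\<integral>x. cmod (g x) powr q \<partial>M)"
    by (rule integral_pair_mult[where A = "A powr q" and B = "A powr q"])
      (use A q1 in \<open>auto intro!: powr_mono2\<close>)
  have w_integrable: "integrable (M \<Otimes>\<^sub>M M) (\<lambda>z. cmod (g (fst z)) powr q * cmod (g (snd z)) powr q)"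
    by (rule integrable_pair_bounded[where B = "A powr q * A powr q"])
      (use A q1 in \<open>auto intro!: mult_mono powr_mono2\<close>)
  have "cmod I \<le> (\<integral>z. cmod (g (fst z) * cnj (g (snd z)) * kernel N m S z) \<partial>(M \<Otimes>\<^sub>M M))"
    unfolding I_def by (rule integral_norm_bound)
  also have "\<dots> \<le> (\<integral>z. B * G\<^sup>2 * (cmod (kernel N m S z) ^ r / B ^ r
      + (cmod (g (fst z)) powr q * cmod (g (snd z)) powr q) / (G powr q * G powr q)) \<partial>(M \<Otimes>\<^sub>M M))"
  proof (rule integral_mono)
    show "integrable (M \<Otimes>\<^sub>M M) (\<lambda>z. cmod (g (fst z) * cnj (g (snd z)) * kernel N m S z))"
    proof (rule integrable_pair_bounded[where B = "A * A * (\<Sum>i=1..N. \<bar>of_bool (i \<in> S) - real m / real N\<bar>)"])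
      show "norm (cmod (g (fst z) * cnj (g (snd z)) * kernel N m S z))
          \<le> A * A * (\<Sum>i=1..N. \<bar>of_bool (i \<in> S) - real m / real N\<bar>)" for z
        using A order_trans[OF norm_ge_zero A] by (auto simp: norm_mult simp del: One_nat_def intro!: mult_mono kernel_le)
    qed measurable
    show "integrable (M \<Otimes>\<^sub>M M) (\<lambda>z. B * G\<^sup>2 * (cmod (kernel N m S z) ^ r / B ^ r
      + (cmod (g (fst z)) powr q * cmod (g (snd z)) powr q) / (G powr q * G powr q)))"
      by (intro integrable_mult_right Bochner_Integration.integrable_add integrable_divide
          kernel_power_integrable w_integrable)
    fix z
    define w where "w = cmod (g (fst z)) * cmod (g (snd z)) / G\<^sup>2"
    define u where "u = cmod (kernel N m S z) / B"
    have "cmod (g (fst z) * cnj (g (snd z)) * kernel N m S z) = B * G\<^sup>2 * (u * w)"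
      using B G by (simp add: u_def w_def norm_mult)
    also have "\<dots> \<le> B * G\<^sup>2 * (u ^ r + w powr q)"
      using B by (intro mult_left_mono young_powr[OF _ _ r q]) (auto simp: u_def w_def)
    also have "w powr q = (cmod (g (fst z)) powr q * cmod (g (snd z)) powr q) / (G powr q * G powr q)"
      using G by (simp add: w_def powr_divide powr_mult power2_eq_square)
    finally show "cmod (g (fst z) * cnj (g (snd z)) * kernel N m S z) \<le> B * G\<^sup>2 * (cmod (kernel N m S z) ^ r / B ^ r
      + (cmod (g (fst z)) powr q * cmod (g (snd z)) powr q) / (G powr q * G powr q))"
      by (simp add: u_def power_divide)
  qed
  also have "\<dots> = B * G\<^sup>2 * ((\<integral>z. cmod (kernel N m S z) ^ r \<partial>(M \<Otimes>\<^sub>M M)) / B ^ r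
      + ((\<integral>x. cmod (g x) powr q \<partial>M) * (\<integral>x. cmod (g x) powr q \<partial>M)) / (G powr q * G powr q))"
    by (subst integral_mult_right_zero, subst Bochner_Integration.integral_add)
      (auto intro!: integrable_divide kernel_power_integrable w_integrable simp: w_int)
  also have "\<dots> \<le> B * G\<^sup>2 * (1 + 1)"
  proof (intro mult_left_mono add_mono)
    show "(\<integral>z. cmod (kernel N m S z) ^ r \<partial>(M \<Otimes>\<^sub>M M)) / B ^ r \<le> 1"
      using B by (simp add: divide_le_eq)
    have "(\<integral>x. cmod (g x) powr q \<partial>M) * (\<integral>x. cmod (g x) powr q \<partial>M) \<le> G powr q * G powr q"
      using G by (intro mult_mono) auto
    then show "((\<integral>x. cmod (g x) powr q \<partial>M) * (\<integral>x. cmod (g x) powr q \<partial>M)) / (G powr q * G powr q) \<le> 1"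
      using G by (simp add: divide_le_eq)
  qed (use B in auto)
  finally have I_le: "cmod I \<le> 2 * B * G\<^sup>2" by simp
  have "(\<Sum>i\<in>S. (cmod (coef g i))\<^sup>2) = real m / real N * (\<Sum>i=1..N. (cmod (coef g i))\<^sup>2) + Re I"
    using arg_cong[OF coef_square_sum_eq_kernel[OF g S, of m], of Re] by (simp add: I_def)
  also have "\<dots> \<le> real m / real N * (\<integral>x. (cmod (g x))\<^sup>2 \<partial>M) + 2 * B * G\<^sup>2"
    using complex_Re_le_cmod[of I] I_le
    by (intro add_mono mult_left_mono Bessel g) auto
  finally show ?thesis .
qed

end

section \<open>The low part\<close>

text \<open>\<open>L\<close> is large enough to make coefficients below \<open>2 ^ -L\<close>
  negligible, yet only logarithmic in \<open>N\<close>, so \<open>N powr (- a)\<close> beats the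
  number of scales. The latter uses \<open>ln x \<le> x - 1\<close> at
  \<open>x = N powr a\<close>.\<close>

lemma log_scale_obtain:
  fixes a :: real
  assumes "2 \<le> N" "0 < a"
  obtains L where "L \<le> N" "N \<le> 4 ^ L" "real (L + 1) * real N powr (- a) \<le> 1 / (a * ln 2) + 2"
proof -
  define L where "L = nat \<lceil>log 2 (real N)\<rceil>"
  have N: "1 < real N" using assms by simp
  have log0: "0 < log 2 (real N)" using N by simp
  have "real N < 2 ^ N" by (rule of_nat_less_two_power)
  then have "log 2 (real N) \<le> real N" using N by (simp add: log_le_iff powr_realpow)
  then have LN: "L \<le> N" by (simp add: L_def ceiling_le_iff nat_le_iff)
  have L1: "log 2 (real N) \<le> real L" unfolding L_def by linarith
  have L2: "real L \<le> log 2 (real N) + 1" unfolding L_def using log0 by linarith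
  have "real N \<le> 2 powr real L" using L1 N by (simp add: log_le_iff)
  also have "\<dots> = 2 ^ L" by (simp add: powr_realpow)
  also have "\<dots> \<le> 4 ^ L" by (intro power_mono) auto
  finally have "real N \<le> real (4 ^ L)" by simp
  then have N4: "N \<le> 4 ^ L" by (simp only: of_nat_le_iff)
  have NA: "1 \<le> real N powr a" using N assms by (intro ge_one_powr_ge_zero) auto
  have "a * ln (real N) \<le> real N powr a"
    using ln_le_minus_one[of "real N powr a"] N by (simp add: ln_powr)
  then have "ln (real N) \<le> real N powr a / a" using assms by (simp add: pos_le_divide_eq mult.commute)
  then have "ln (real N) / ln 2 \<le> real N powr a / a / ln 2" by (intro divide_right_mono) auto
  then have "log 2 (real N) \<le> real N powr a * (1 / (a * ln 2))" by (simp add: log_def)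
  then have "real (L + 1) \<le> real N powr a * (1 / (a * ln 2)) + 2" using L2 by simp
  also have "\<dots> \<le> real N powr a * (1 / (a * ln 2)) + real N powr a * 2" using NA by simp
  also have "\<dots> = (1 / (a * ln 2) + 2) * real N powr a" by (simp add: algebra_simps)
  finally have "real (L + 1) * real N powr (- a) \<le> (1 / (a * ln 2) + 2) * real N powr a * real N powr (- a)"
    by (intro mult_right_mono) auto
  also have "\<dots> = 1 / (a * ln 2) + 2" using N by (simp add: powr_minus)
  finally show ?thesis using that LN N4 by blast
qed

text \<open>The exponent lies strictly between \<open>1 / (2 * p)\<close>, where the kernel moments
  begin to suffice, and \<open>1 / p\<close>, below which
  \<open>\<delta> * level p N powr (p - 2)\<close> is at most a constant times a negative power of
  \<open>N\<close>, with \<open>\<delta> = m / N\<close>.\<close>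

definition level :: "real \<Rightarrow> nat \<Rightarrow> real"
  where "level p N = real N powr (3 / (4 * p))"

text \<open>A third of the exponent saved in \<open>density_level_le\<close>. One third is spent on
  the weight \<open>y\<close> in \<open>nsub_spectrum_union_bound\<close>, and one stays in its
  threshold to beat the number of scales.\<close>

definition gain_exp :: "real \<Rightarrow> real"
  where "gain_exp p = (1 - 2 / p) / 12"

text \<open>The least \<open>K\<close> meeting the three conditions of
  \<open>nsub_spectrum_union_bound\<close> for \<open>D = 32 * p\<^sup>2\<close>.\<close>

definition union_const :: "real \<Rightarrow> real"
  where "union_const p = max 1 (max (16 / gain_exp p) (32 * p\<^sup>2 / (gain_exp p * ln 2)))"

definition low_const :: "real \<Rightarrow> real"
  where "low_const p = 4 * (union_const p *
    (64 * p / (3 * step_size p) + 4 / 3 + (1 / (gain_exp p * ln 2) + 2))) + 1"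

lemma gain_exp_pos: "2 < p \<Longrightarrow> 0 < gain_exp p"
  by (simp add: gain_exp_def)

lemma level_pos: "1 \<le> N \<Longrightarrow> 0 < level p N"
  by (simp add: level_def)

lemma density_level_le:
  assumes p: "2 < p" and N: "1 \<le> N" and m: "real m \<le> 2 * real N powr (2 / p)"
  shows "real m / real N * level p N powr (p - 2) \<le> 2 * real N powr (- 3 * gain_exp p)"
proof -
  have "real m / real N * level p N powr (p - 2)
      \<le> 2 * real N powr (2 / p) / real N * level p N powr (p - 2)"
    using m N by (intro mult_right_mono divide_right_mono) auto
  also have "\<dots> = 2 * (real N powr (2 / p) * real N powr (- 1) * real N powr (3 / (4 * p) * (p - 2)))"
    unfolding level_def powr_powr using N by (simp add: powr_minus_divide)
  also have "\<dots> = 2 * real N powr (2 / p + - 1 + 3 / (4 * p) * (p - 2))"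
    by (simp only: powr_add)
  also have "2 / p + - 1 + 3 / (4 * p) * (p - 2) = - 3 * gain_exp p"
    using p by (simp add: gain_exp_def field_simps)
  finally show ?thesis .
qed

context bounded_system
begin

definition low_good :: "real \<Rightarrow> nat \<Rightarrow> nat set \<Rightarrow> bool"
  where "low_good p N S \<longleftrightarrow> (\<forall>f. bfun f \<longrightarrow> (\<forall>x. cmod (f x) \<le> level p N) \<longrightarrow>
    (\<integral>x. cmod (f x) powr p \<partial>M) \<le> 1 \<longrightarrow>
    (\<Sum>i\<in>S. (cmod (coef (\<lambda>x. complex_of_real (cmod (f x) powr (p - 2)) * f x) i))\<^sup>2) \<le> low_const p)"

text \<open>A walk is determined by its tokens alone, so a union bound over token lists covers every
  hypothesis that any \<open>f\<close> can produce, although the path taken depends on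
  \<open>f\<close> and \<open>S\<close>. Outside the exceptional family
  \<open>coef_square_sum_le\<close> applies.\<close>

lemma low_bad_card_le:
  assumes p: "2 < p" and N: "2 \<le> N" and m: "m \<le> N" "real m \<le> 2 * real N powr (2 / p)"
  shows "real (card {S\<in>nsub N m. \<not> low_good p N S}) \<le> real (N choose m) / (2 * real N)"
proof -
  define T where "T = level p N"
  have T: "0 < T" using N by (simp add: T_def level_pos)
  interpret D: mirror_descent M \<phi> p T by unfold_locales (fact p, fact T)
  define a where "a = gain_exp p"
  define K where "K = union_const p"
  have a: "0 < a" using gain_exp_pos[OF p] by (simp add: a_def)
  obtain L where L: "L \<le> N" "N \<le> 4 ^ L" "real (L + 1) * real N powr (- a) \<le> 1 / (a * ln 2) + 2"
    by (rule log_scale_obtain[OF N a])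
  have K: "1 \<le> K" "16 \<le> a * K" "32 * p\<^sup>2 \<le> a * K * ln 2"
  proof -
    have "16 / a \<le> K" "32 * p\<^sup>2 / (a * ln 2) \<le> K" by (auto simp: K_def union_const_def a_def)
    then show "16 \<le> a * K" "32 * p\<^sup>2 \<le> a * K * ln 2" using a by (auto simp: pos_divide_le_eq mult_ac)
    show "1 \<le> K" by (simp add: K_def union_const_def)
  qed
  define V where "V = D.tokens L N"
  have fV: "finite V" by (simp add: V_def D.tokens_def)
  have "card V \<le> (L + 1) * (4 * N)"
    unfolding V_def D.tokens_def card_cartesian_product
    using card_length[of "[1, -1, \<i>, -\<i>]"] by (intro mult_le_mono) auto
  also have "\<dots> \<le> (2 * N) * (4 * N)" using L N by (intro mult_le_mono) auto
  also have "\<dots> = 2 ^ 3 * N ^ 2" by (simp add: power2_eq_square)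
  also have "\<dots> \<le> N ^ 3 * N ^ 2" using N by (intro mult_le_mono power_mono) auto
  also have "\<dots> = N ^ 5" by (simp add: power_add[symmetric])
  finally have cV: "card V \<le> N ^ 5" .
  \<comment> \<open>Empty when the potential is large, so that the size bound holds for every list;
    along the descent the first branch applies.\<close>
  define J where "J l xs = (if D.pot (D.walk xs) \<le> 4 * p
    then {i\<in>{1..N}. (1 / 2) ^ l / 2 \<le> cmod (coef (D.mir (D.walk xs)) i)} else {})" for l xs
  have J: "J l xs \<subseteq> {1..N}" for l xs by (auto simp: J_def)
  have cJ: "real m / real N * real (card (J l xs)) \<le> 32 * p\<^sup>2 * 4 ^ l * real N powr (- 3 * a)" for l xs
  proof (cases "D.pot (D.walk xs) \<le> 4 * p")
    case False
    then show ?thesis by (simp add: J_def)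
  next
    case True
    define h where "h = D.mir (D.walk xs)"
    have h: "bfun h" by (simp add: h_def)
    have fJ: "finite (J l xs)" using J finite_subset by blast
    have "real (card (J l xs)) * ((1 / 2) ^ l / 2)\<^sup>2 = (\<Sum>i\<in>J l xs. ((1 / 2) ^ l / 2)\<^sup>2)" by simp
    also have "\<dots> \<le> (\<Sum>i\<in>J l xs. (cmod (coef h i))\<^sup>2)"
      using True by (intro sum_mono power_mono) (auto simp: J_def h_def)
    also have "\<dots> \<le> (\<integral>x. (cmod (h x))\<^sup>2 \<partial>M)" by (rule Bessel[OF h fJ])
    also have "\<dots> \<le> T powr (p - 2) * (p * D.pot (D.walk xs))"
      unfolding h_def by (rule D.mir_square_integral_le) simp
    also have "\<dots> \<le> T powr (p - 2) * (p * (4 * p))"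
      using True p by (intro mult_left_mono) auto
    finally have *: "real (card (J l xs)) * ((1 / 2) ^ l / 2)\<^sup>2 \<le> T powr (p - 2) * (p * (4 * p))" .
    have "((1 / 2 :: real) ^ l / 2)\<^sup>2 * (4 * 4 ^ l) = 1"
      by (simp add: power2_eq_square power_divide power_mult_distrib[symmetric])
    then have "real (card (J l xs)) = real (card (J l xs)) * ((1 / 2) ^ l / 2)\<^sup>2 * (4 * 4 ^ l)"
      by simp
    also have "\<dots> \<le> T powr (p - 2) * (p * (4 * p)) * (4 * 4 ^ l)"
      by (rule mult_right_mono[OF *]) simp
    finally have "real m / real N * real (card (J l xs))
        \<le> real m / real N * (T powr (p - 2) * (p * (4 * p)) * (4 * 4 ^ l))"
      by (rule mult_left_mono) simp
    also have "\<dots> = (real m / real N * T powr (p - 2)) * (16 * p\<^sup>2 * 4 ^ l)"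
      by (simp add: power2_eq_square)
    also have "\<dots> \<le> (2 * real N powr (- 3 * a)) * (16 * p\<^sup>2 * 4 ^ l)"
      unfolding T_def a_def by (intro mult_right_mono density_level_le p m) (use N in auto)
    finally show ?thesis by (simp add: mult_ac)
  qed
  have good: "low_good p N S"
    if S: "S \<in> nsub N m" and spec: "\<not> (\<exists>l\<le>L. \<exists>xs. set xs \<subseteq> V \<and>
      K * (real (length xs) + 1 + 4 ^ l * real N powr (- a)) \<le> real (card (S \<inter> J l xs)))" for S
    unfolding low_good_def
  proof (intro allI impI)
    fix f assume f: "bfun f" "\<forall>x. cmod (f x) \<le> level p N" "(\<integral>x. cmod (f x) powr p \<partial>M) \<le> 1"
    have S': "S \<subseteq> {1..N}" "card S = m" using S by (auto simp: nsub_def)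
    define g where "g x = complex_of_real (cmod (f x) powr (p - 2)) * f x" for x
    have "(\<Sum>i\<in>S. (cmod (coef g i))\<^sup>2)
      \<le> 4 * (K * (64 * p / (3 * step_size p) + 4 / 3 + real (L + 1) * real N powr (- a))) + 1"
    proof (rule D.coef_square_sum_le[OF f(1) _ f(3) _ S'(1)])
      show "cmod (f x) \<le> T" for x using f(2) by (simp add: T_def)
      show "card S \<le> 4 ^ L" using S' m L by simp
      show "0 < K" using K by simp
      fix l ts assume l: "l \<le> L" and ts: "set ts \<subseteq> D.tokens L N" and pot: "D.pot (D.walk ts) \<le> 4 * p"
      have "S \<inter> {i. (1 / 2) ^ l / 2 \<le> cmod (coef (D.mir (D.walk ts)) i)} = S \<inter> J l ts"
        using S' pot by (auto simp: J_def)
      moreover have "\<not> K * (real (length ts) + 1 + 4 ^ l * real N powr (- a)) \<le> real (card (S \<inter> J l ts))"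
        using spec l ts unfolding V_def by blast
      ultimately show "real (card (S \<inter> {i. (1 / 2) ^ l / 2 \<le> cmod (coef (D.mir (D.walk ts)) i)}))
          \<le> K * (real (length ts) + 1 + 4 ^ l * real N powr (- a))"
        by simp
    qed (simp add: g_def)
    also have "\<dots> \<le> low_const p"
      using L(3) K unfolding low_const_def K_def[symmetric] a_def[symmetric]
      by (intro add_right_mono mult_left_mono add_left_mono) auto
    finally show "(\<Sum>i\<in>S. (cmod (coef (\<lambda>x. complex_of_real (cmod (f x) powr (p - 2)) * f x) i))\<^sup>2) \<le> low_const p"
      by (simp add: g_def[abs_def])
  qed
  have "card {S\<in>nsub N m. \<not> low_good p N S} \<le> card {S\<in>nsub N m. \<exists>l\<le>L. \<exists>xs. set xs \<subseteq> V \<and>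
      K * (real (length xs) + 1 + 4 ^ l * real N powr (- a)) \<le> real (card (S \<inter> J l xs))}"
  proof (rule card_mono)
    show "{S\<in>nsub N m. \<not> low_good p N S} \<subseteq> {S\<in>nsub N m. \<exists>l\<le>L. \<exists>xs. set xs \<subseteq> V \<and>
        K * (real (length xs) + 1 + 4 ^ l * real N powr (- a)) \<le> real (card (S \<inter> J l xs))}"
      using good by blast
  qed simp
  also have "real \<dots> \<le> real (N choose m) / (2 * real N)"
    by (rule nsub_spectrum_union_bound[OF m(1) N L(1) fV cV a _ K J cJ]) simp
  finally show ?thesis by simp
qed

text \<open>Duality: the pairing is a finite sum of products of \<open>cnj (a i)\<close> with
  coefficients of \<open>g\<close>, and Cauchy-Schwarz applies.\<close>

lemma square_norm_pairing_le:
  assumes g: "bfun g" and S: "finite S" and a: "(\<Sum>i\<in>S. (cmod (a i))\<^sup>2) \<le> 1"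
  shows "(cmod (\<integral>x. g x * cnj (\<Sum>i\<in>S. a i * \<phi> i x) \<partial>M))\<^sup>2 \<le> (\<Sum>i\<in>S. (cmod (coef g i))\<^sup>2)"
proof -
  have "cmod (\<integral>x. g x * cnj (\<Sum>i\<in>S. a i * \<phi> i x) \<partial>M) \<le> (\<Sum>i\<in>S. cmod (a i) * cmod (coef g i))"
    unfolding integral_mult_cnj_sum[OF g S] by (rule sum_norm_le) (simp add: norm_mult)
  then have "(cmod (\<integral>x. g x * cnj (\<Sum>i\<in>S. a i * \<phi> i x) \<partial>M))\<^sup>2 \<le> (\<Sum>i\<in>S. cmod (a i) * cmod (coef g i))\<^sup>2"
    by (rule power_mono) simp
  also have "\<dots> \<le> (\<Sum>i\<in>S. (cmod (a i))\<^sup>2) * (\<Sum>i\<in>S. (cmod (coef g i))\<^sup>2)"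
    by (rule Cauchy_Schwarz_ineq_sum)
  also have "\<dots> \<le> 1 * (\<Sum>i\<in>S. (cmod (coef g i))\<^sup>2)"
    by (rule mult_right_mono[OF a]) (simp add: sum_nonneg)
  finally show ?thesis by simp
qed

lemma bfun_restrict:
  assumes f: "bfun f" and P: "{t. P t} \<in> sets borel"
  shows "bfun (\<lambda>x. if P (cmod (f x)) then f x else 0)"
proof -
  have "bfun (\<lambda>x. complex_of_real (indicator {t. P t} (cmod (f x))))"
    by (rule bfun_of_real[where U = "\<lambda>_. 1" and u = "indicator {t. P t}", OF f])
      (use P in \<open>auto simp: indicator_def\<close>)
  then have "bfun (\<lambda>x. complex_of_real (indicator {t. P t} (cmod (f x))) * f x)" using f by simp
  moreover have "(\<lambda>x. complex_of_real (indicator {t. P t} (cmod (f x))) * f x)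
    = (\<lambda>x. if P (cmod (f x)) then f x else 0)" by (auto simp: indicator_def)
  ultimately show ?thesis by simp
qed

text \<open>Let \<open>A\<close> be the integral. Rescaling the low part to \<open>L^p\<close> norm
  one gives \<open>v\<close>, and the function \<open>|v| powr (p - 2) * v\<close> pairs with
  \<open>f\<close> to \<open>A powr (1 / p)\<close>. Duality and \<open>low_good\<close> then give
  \<open>A powr (2 / p) \<le> low_const p\<close>.\<close>

lemma low_part_le:
  assumes p: "2 < p" and good: "low_good p N S" and S: "finite S" and a: "(\<Sum>i\<in>S. (cmod (a i))\<^sup>2) \<le> 1"
    and f: "\<And>x. f x = (\<Sum>i\<in>S. a i * \<phi> i x)"
  shows "(\<integral>x. cmod (if cmod (f x) \<le> level p N then f x else 0) powr p \<partial>M) \<le> max 1 (low_const p powr (p / 2))"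
proof (rule ccontr)
  define u where "u x = (if cmod (f x) \<le> level p N then f x else 0)" for x
  define A where "A = (\<integral>x. cmod (u x) powr p \<partial>M)"
  assume "\<not> ?thesis"
  then have A: "1 < A" "low_const p powr (p / 2) < A" by (auto simp: A_def u_def)
  have bf: "bfun f" using f by (simp add: f[abs_def])
  have bu: "bfun u" unfolding u_def by (rule bfun_restrict[OF bf]) simp
  define c where "c = A powr (- (1 / p))"
  have c: "0 < c" "c \<le> 1" using A p by (auto simp: c_def powr_minus divide_simps ge_one_powr_ge_zero)
  define v where "v x = complex_of_real c * u x" for x
  have bv: "bfun v" unfolding v_def using bu by simp
  have cv: "cmod (v x) = c * cmod (u x)" for x using c by (simp add: v_def norm_mult)
  have "cmod (u x) \<le> level p N" for x by (simp add: u_def level_def)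
  then have v_le: "cmod (v x) \<le> level p N" for x
    unfolding cv using c mult_mono[of c 1 "cmod (u x)" "level p N"] by simp
  have v_int: "(\<integral>x. cmod (v x) powr p \<partial>M) = 1"
  proof -
    have "(\<integral>x. cmod (v x) powr p \<partial>M) = c powr p * A"
      using c by (simp add: cv powr_mult A_def)
    also have "c powr p = A powr (- 1)" unfolding c_def powr_powr using p by simp
    also have "\<dots> = inverse A" using A by (simp add: powr_minus)
    finally show ?thesis using A by simp
  qed
  define g where "g x = complex_of_real (cmod (v x) powr (p - 2)) * v x" for x
  have "bfun (\<lambda>x. complex_of_real (cmod (v x) powr (p - 2)))"
    by (rule bfun_of_real[where u = "\<lambda>t. t powr (p - 2)" and U = "\<lambda>b. b powr (p - 2)"])
      (use bv p in \<open>auto intro: powr_mono2\<close>)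
  then have bg: "bfun g" unfolding g_def using bv by simp
  have gf: "g x * cnj (f x) = complex_of_real (cmod (v x) powr p / c)" for x
  proof -
    have "v x * cnj (f x) = v x * cnj (u x)" by (auto simp: v_def u_def)
    also have "\<dots> = complex_of_real (c * (cmod (u x))\<^sup>2)"
      by (simp only: v_def complex_norm_square of_real_mult mult.assoc)
    also have "c * (cmod (u x))\<^sup>2 = (cmod (v x))\<^sup>2 / c"
      using c by (simp add: cv power2_eq_square)
    finally have "g x * cnj (f x) = complex_of_real (cmod (v x) powr (p - 2) * (cmod (v x))\<^sup>2 / c)"
      by (simp add: g_def mult.assoc)
    then show ?thesis by (simp only: powr_diff_two_mult[OF norm_ge_zero])
  qed
  have "(\<integral>x. g x * cnj (f x) \<partial>M) = complex_of_real (1 / c)"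
    unfolding gf using v_int by (simp only: integral_complex_of_real) simp
  moreover have "(cmod (\<integral>x. g x * cnj (f x) \<partial>M))\<^sup>2 \<le> (\<Sum>i\<in>S. (cmod (coef g i))\<^sup>2)"
    unfolding f by (rule square_norm_pairing_le[OF bg S a])
  moreover have "(\<Sum>i\<in>S. (cmod (coef g i))\<^sup>2) \<le> low_const p"
    using good bv v_le v_int unfolding low_good_def g_def by simp
  ultimately have "(1 / c)\<^sup>2 \<le> low_const p" using c by (simp add: norm_divide)
  also have "1 / c = A powr (1 / p)" by (simp add: c_def powr_minus divide_inverse)
  also have "(A powr (1 / p))\<^sup>2 = A powr (2 / p)" using A by (simp add: powr_power)
  finally have "(A powr (2 / p)) powr (p / 2) \<le> low_const p powr (p / 2)"
    using p by (intro powr_mono2) auto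
  then show False using A p by (simp add: powr_powr)
qed

end

section \<open>The high part\<close>

text \<open>The order \<open>r\<close> of the kernel moment; \<open>r \<ge> 9 * p\<close> is
  equivalent to the comparison of exponents
  \<open>3 + r / p \<le> 3 / (4 * p) * (2 * r - 2 * p)\<close> in
  \<open>high_bad_card_le\<close>.\<close>

definition high_exp :: "real \<Rightarrow> nat"
  where "high_exp p = nat \<lceil>9 * p\<rceil>"

text \<open>From this size on, one factor \<open>N\<close> absorbs the constants of
  \<open>high_bad_card_le\<close>; smaller \<open>N\<close> are covered by the trivial
  bound.\<close>

definition size_const :: "real \<Rightarrow> real"
  where "size_const p = 16 * exp 1 * fact (high_exp p) * 20 ^ high_exp p"

text \<open>The bound for the \<open>L^q\<close> norm of the dual function in
  \<open>high_part_le\<close>, with \<open>q\<close> conjugate to \<open>high_exp p\<close>.\<close>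

definition high_radius :: "real \<Rightarrow> nat \<Rightarrow> real"
  where "high_radius p N = level p N powr (p / real (high_exp p) - 1)"

lemma high_exp_ge: "2 < p \<Longrightarrow> 9 * p \<le> real (high_exp p)" "2 < p \<Longrightarrow> 2 \<le> high_exp p"
proof -
  assume p: "2 < p"
  show *: "9 * p \<le> real (high_exp p)" unfolding high_exp_def by linarith
  show "2 \<le> high_exp p" using * p by linarith
qed

lemma high_radius_pos: "1 \<le> N \<Longrightarrow> 0 < high_radius p N"
  using level_pos[of N p] by (simp add: high_radius_def)

context bounded_system
begin

text \<open>With \<open>B = 1 / (5 * G\<^sup>2)\<close> and \<open>G = high_radius p N\<close>, the
  error \<open>2 * B * G\<^sup>2\<close> of \<open>coef_square_sum_le_kernel\<close> is
  \<open>2 / 5\<close>.\<close>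

definition high_good :: "real \<Rightarrow> nat \<Rightarrow> nat \<Rightarrow> nat set \<Rightarrow> bool"
  where "high_good p N m S \<longleftrightarrow> (\<integral>z. cmod (kernel N m S z) ^ high_exp p \<partial>(M \<Otimes>\<^sub>M M))
    \<le> (1 / (5 * (high_radius p N)\<^sup>2)) ^ high_exp p"

lemma high_bad_card_le:
  assumes p: "2 < p" and N: "2 \<le> N" "size_const p \<le> real N"
    and m: "m \<le> N" "1 \<le> m" "real m \<le> 2 * real N powr (2 / p)"
  shows "real (card {S\<in>nsub N m. \<not> high_good p N m S}) \<le> real (N choose m) / (2 * real N)"
proof -
  define r where "r = high_exp p"
  define B where "B = (1 / (5 * (high_radius p N)\<^sup>2)) ^ r"
  define Z where "Z = 2 ^ r * (4 * exp 1 * real (N + 1) * fact r * sqrt (real m) ^ r)"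
  have r: "9 * p \<le> real r" "2 \<le> r" using high_exp_ge[OF p] by (auto simp: r_def)
  have G: "0 < high_radius p N" using N by (intro high_radius_pos) simp
  have B0: "0 < B" using G by (simp add: B_def)
  have B_eq: "B = real N powr (3 / (4 * p) * (2 * real r - 2 * p)) / 5 ^ r"
  proof -
    have "((high_radius p N)\<^sup>2) ^ r = high_radius p N ^ (2 * r)" by (rule power_mult[symmetric])
    also have "\<dots> = high_radius p N powr real (2 * r)" by (rule powr_realpow[OF G, symmetric])
    also have "real (2 * r) = 2 * real r" by simp
    also have "high_radius p N powr (2 * real r) = real N powr (3 / (4 * p) * ((p / real r - 1) * (2 * real r)))"
      by (simp only: high_radius_def r_def level_def powr_powr mult.assoc)
    also have "(p / real r - 1) * (2 * real r) = - (2 * real r - 2 * p)" using r by (simp add: field_simps)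
    also have "real N powr (3 / (4 * p) * - (2 * real r - 2 * p)) = 1 / real N powr (3 / (4 * p) * (2 * real r - 2 * p))"
      by (simp only: mult_minus_right powr_minus_divide)
    finally show ?thesis by (simp add: B_def power_divide power_mult_distrib)
  qed
  have sq: "sqrt (real m) \<le> 2 * real N powr (1 / p)"
  proof (rule real_le_lsqrt)
    have "(2 * real N powr (1 / p))\<^sup>2 = 4 * real N powr (2 / p)"
      using N by (simp add: power_mult_distrib powr_power)
    then show "real m \<le> (2 * real N powr (1 / p))\<^sup>2"
      using m(3) powr_ge_zero[of "real N" "2 / p"] by linarith
  qed simp
  have "sqrt (real m) ^ r \<le> (2 * real N powr (1 / p)) ^ r" by (rule power_mono[OF sq]) simp
  also have "\<dots> = 2 ^ r * real N powr (real r / p)"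
    using N by (simp add: power_mult_distrib powr_power)
  finally have sqr: "sqrt (real m) ^ r \<le> 2 ^ r * real N powr (real r / p)" .
  \<comment> \<open>Three powers of \<open>N\<close> are lost: to the failure probability
    \<open>1 / (2 * N)\<close>, to the factor \<open>N + 1\<close> in \<open>Z\<close>, and to
    \<open>size_const p\<close>.\<close>
  have "2 * real N * Z * 5 ^ r \<le> 2 * real N * (2 ^ r * (4 * exp 1 * (2 * real N) * fact r * (2 ^ r * real N powr (real r / p)))) * 5 ^ r"
    unfolding Z_def using N by (intro mult_left_mono mult_right_mono mult_mono sqr) auto
  also have "\<dots> = (16 * exp 1 * fact r * (2 ^ r * 2 ^ r * 5 ^ r)) * (real N ^ 2 * real N powr (real r / p))"
    by (simp add: power2_eq_square mult_ac)
  also have "(2 ^ r * 2 ^ r * 5 ^ r :: real) = 20 ^ r" by (simp add: power_mult_distrib[symmetric])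
  also have "16 * exp 1 * fact r * 20 ^ r = size_const p" by (simp add: size_const_def r_def)
  also have "size_const p * (real N ^ 2 * real N powr (real r / p)) \<le> real N * (real N ^ 2 * real N powr (real r / p))"
    by (rule mult_right_mono[OF N(2)]) simp
  also have "\<dots> = real N ^ 3 * real N powr (real r / p)" by (simp add: power_numeral_reduce)
  also have "real N ^ 3 = real N powr 3" using N by (simp add: powr_numeral)
  also have "real N powr 3 * real N powr (real r / p) = real N powr (3 + real r / p)" by (simp add: powr_add)
  also have "\<dots> \<le> real N powr (3 / (4 * p) * (2 * real r - 2 * p))"
  proof (rule powr_mono)
    have "9 \<le> real r / p" using r p by (simp add: pos_le_divide_eq)
    moreover have "3 / (4 * p) * (2 * real r - 2 * p) = 3 / 2 * (real r / p) - 3 / 2" using p by (simp add: field_simps)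
    ultimately show "3 + real r / p \<le> 3 / (4 * p) * (2 * real r - 2 * p)" by linarith
  qed (use N in simp)
  also have "\<dots> = B * 5 ^ r" by (simp add: B_eq)
  finally have ZB: "2 * real N * Z \<le> B" by simp
  have "real (card {S\<in>nsub N m. B < (\<integral>z. cmod (kernel N m S z) ^ r \<partial>(M \<Otimes>\<^sub>M M))}) * B \<le> real (N choose m) * Z"
    unfolding Z_def by (rule kernel_large_moment_card_le[OF m(1,2) B0])
  also have "\<dots> \<le> real (N choose m) * (B / (2 * real N))"
    using ZB N by (intro mult_left_mono) (auto simp: pos_le_divide_eq mult_ac)
  finally have "real (card {S\<in>nsub N m. B < (\<integral>z. cmod (kernel N m S z) ^ r \<partial>(M \<Otimes>\<^sub>M M))}) * B
      \<le> real (N choose m) / (2 * real N) * B" by simp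
  then have "real (card {S\<in>nsub N m. B < (\<integral>z. cmod (kernel N m S z) ^ r \<partial>(M \<Otimes>\<^sub>M M))}) \<le> real (N choose m) / (2 * real N)"
    by (rule mult_right_le_imp_le[OF _ B0])
  then show ?thesis by (simp add: high_good_def not_le B_def r_def)
qed

lemma sum_pointwise_le:
  assumes S: "finite S" and a: "(\<Sum>i\<in>S. (cmod (a i))\<^sup>2) \<le> 1"
  shows "cmod (\<Sum>i\<in>S. a i * \<phi> i x) \<le> sqrt (real (card S))"
proof (rule real_le_rsqrt)
  have "cmod (\<Sum>i\<in>S. a i * \<phi> i x) \<le> (\<Sum>i\<in>S. cmod (a i) * cmod (\<phi> i x))"
    by (rule sum_norm_le) (simp add: norm_mult)
  then have "(cmod (\<Sum>i\<in>S. a i * \<phi> i x))\<^sup>2 \<le> (\<Sum>i\<in>S. cmod (a i) * cmod (\<phi> i x))\<^sup>2"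
    by (rule power_mono) simp
  also have "\<dots> \<le> (\<Sum>i\<in>S. (cmod (a i))\<^sup>2) * (\<Sum>i\<in>S. (cmod (\<phi> i x))\<^sup>2)" by (rule Cauchy_Schwarz_ineq_sum)
  also have "\<dots> \<le> 1 * (\<Sum>i\<in>S. 1)"
    using a phi_le by (intro mult_mono sum_mono) (auto simp: abs_square_le_1 sum_nonneg)
  finally show "(cmod (\<Sum>i\<in>S. a i * \<phi> i x))\<^sup>2 \<le> real (card S)" by simp
qed

text \<open>If the integral \<open>A\<close> were larger, a dual function \<open>g\<close> with
  pairing \<open>1\<close> would give \<open>1 \<le> 1 / 2 + 2 / 5\<close>. The term
  \<open>1 / 2\<close> bounds the mean, via the pointwise bound \<open>sqrt m\<close> for
  \<open>f\<close>, and \<open>2 / 5\<close> bounds the kernel term.\<close>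

lemma high_part_le:
  assumes p: "2 < p" and N: "1 \<le> N" and S: "S \<in> nsub N m" and m: "real m \<le> 2 * real N powr (2 / p)"
    and good: "high_good p N m S" and a: "(\<Sum>i\<in>S. (cmod (a i))\<^sup>2) \<le> 1"
    and f: "\<And>x. f x = (\<Sum>i\<in>S. a i * \<phi> i x)"
  shows "(\<integral>x. cmod (if level p N < cmod (f x) then f x else 0) powr p \<partial>M) \<le> 2 * 2 powr (p / 2)"
proof (rule ccontr)
  define T where "T = level p N"
  define u where "u x = (if T < cmod (f x) then f x else 0)" for x
  define A where "A = (\<integral>x. cmod (u x) powr p \<partial>M)"
  assume "\<not> ?thesis"
  then have A: "2 * 2 powr (p / 2) < A" by (simp add: A_def u_def T_def)
  have "1 \<le> 2 powr (p / 2)" using p by (intro ge_one_powr_ge_zero) auto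
  then have A1: "1 < A" using A by linarith
  have S': "S \<subseteq> {1..N}" "finite S" "card S = m" using S by (auto simp: nsub_def intro: finite_subset)
  have T: "0 < T" using N by (simp add: T_def level_pos)
  have bf: "bfun f" using f by (simp add: f[abs_def])
  have bu: "bfun u" unfolding u_def by (rule bfun_restrict[OF bf]) simp
  define r where "r = high_exp p"
  have r: "9 * p \<le> real r" "2 \<le> r" using high_exp_ge[OF p] by (auto simp: r_def)
  define q where "q = real r / (real r - 1)"
  have q1: "1 < q" using r by (simp add: q_def)
  define g where "g x = complex_of_real (1 / A) * (complex_of_real (cmod (u x) powr (p - 2)) * u x)" for x
  have "bfun (\<lambda>x. complex_of_real (cmod (u x) powr (p - 2)))"
    by (rule bfun_of_real[where u = "\<lambda>t. t powr (p - 2)" and U = "\<lambda>b. b powr (p - 2)"])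
      (use bu p in \<open>auto intro: powr_mono2\<close>)
  then have bg: "bfun g" unfolding g_def by (rule bfun_mult[OF bfun_const bfun_mult[OF _ bu]])
  have cg: "cmod (g x) = cmod (u x) powr (p - 1) / A" for x
  proof (cases "u x = 0")
    case False
    then have "cmod (u x) powr (p - 2) * cmod (u x) powr 1 = cmod (u x) powr (p - 1)"
      unfolding powr_add[symmetric] by simp
    then show ?thesis using False A1 by (simp add: g_def norm_mult norm_divide)
  qed (use p in \<open>simp add: g_def\<close>)
  have gf: "g x * cnj (f x) = complex_of_real (cmod (u x) powr p / A)" for x
  proof -
    have "u x * cnj (f x) = complex_of_real ((cmod (u x))\<^sup>2)"
      unfolding complex_norm_square by (auto simp: u_def)
    then have "g x * cnj (f x) = complex_of_real (cmod (u x) powr (p - 2) * (cmod (u x))\<^sup>2 / A)"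
      by (simp add: g_def mult.assoc)
    then show ?thesis by (simp only: powr_diff_two_mult[OF norm_ge_zero])
  qed
  have "(\<integral>x. g x * cnj (f x) \<partial>M) = complex_of_real ((\<integral>x. cmod (u x) powr p / A \<partial>M))"
    unfolding gf by (rule integral_complex_of_real)
  also have "(\<integral>x. cmod (u x) powr p / A \<partial>M) = 1" using A1 by (simp add: A_def)
  finally have "1 \<le> (\<Sum>i\<in>S. (cmod (coef g i))\<^sup>2)"
    using square_norm_pairing_le[OF bg S'(2) a] by (simp add: f)
  also have "\<dots> \<le> real m / real N * (\<integral>x. (cmod (g x))\<^sup>2 \<partial>M) + 2 * (1 / (5 * (high_radius p N)\<^sup>2)) * (high_radius p N)\<^sup>2"
  proof (rule coef_square_sum_le_kernel[OF bg S'(1) r(2) q_def])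
    show "0 < 1 / (5 * (high_radius p N)\<^sup>2)" "0 < high_radius p N" using high_radius_pos[OF N, of p] by auto
    show "(\<integral>z. cmod (kernel N m S z) ^ r \<partial>(M \<Otimes>\<^sub>M M)) \<le> (1 / (5 * (high_radius p N)\<^sup>2)) ^ r"
      using good by (simp add: high_good_def r_def)
    \<comment> \<open>The exponent is nonpositive because \<open>r \<ge> p\<close>, so on the high
      set, where the modulus exceeds \<open>T\<close>, that power is at most its value at
      \<open>T\<close>.\<close>
    have e: "(p - 1) * q - p = (p / real r - 1) * q"
      using r by (simp add: q_def field_simps)
    have e0: "(p - 1) * q - p \<le> 0"
      unfolding e using q1 r p by (intro mult_nonpos_nonneg) auto
    have "(\<integral>x. cmod (g x) powr q \<partial>M) \<le> (\<integral>x. T powr ((p - 1) * q - p) * (cmod (u x) powr p / A) \<partial>M)"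
    proof (rule integral_mono)
      fix x
      have "cmod (g x) powr q = cmod (u x) powr ((p - 1) * q) / A powr q"
        using A1 by (simp add: cg powr_divide powr_powr)
      also have "\<dots> \<le> cmod (u x) powr ((p - 1) * q) / A"
        using A1 q1 powr_mono[of 1 q A] by (intro divide_left_mono) auto
      also have "\<dots> \<le> T powr ((p - 1) * q - p) * cmod (u x) powr p / A"
      proof (rule divide_right_mono)
        show "cmod (u x) powr ((p - 1) * q) \<le> T powr ((p - 1) * q - p) * cmod (u x) powr p"
        proof (cases "T < cmod (f x)")
          case True
          then have "T \<le> cmod (u x)" by (simp add: u_def)
          then have "cmod (u x) powr ((p - 1) * q - p) \<le> T powr ((p - 1) * q - p)"
            using T e0 by (intro powr_mono2') auto
          then have "cmod (u x) powr ((p - 1) * q - p) * cmod (u x) powr p \<le> T powr ((p - 1) * q - p) * cmod (u x) powr p"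
            by (rule mult_right_mono) simp
          then show ?thesis by (simp add: powr_add[symmetric])
        qed (simp add: u_def)
      qed (use A1 in simp)
      finally show "cmod (g x) powr q \<le> T powr ((p - 1) * q - p) * (cmod (u x) powr p / A)" by simp
    qed (use bg bu p q1 in \<open>auto intro!: integrable_mult_right integrable_divide\<close>)
    also have "\<dots> = T powr ((p - 1) * q - p)" using A1 by (simp add: A_def)
    also have "\<dots> = high_radius p N powr q" unfolding e by (simp add: high_radius_def r_def T_def powr_powr)
    finally show "(\<integral>x. cmod (g x) powr q \<partial>M) \<le> high_radius p N powr q" .
  qed
  also have "2 * (1 / (5 * (high_radius p N)\<^sup>2)) * (high_radius p N)\<^sup>2 = 2 / 5"
    using high_radius_pos[OF N, of p] by simp
  also have "real m / real N * (\<integral>x. (cmod (g x))\<^sup>2 \<partial>M) \<le> 1 / 2"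
  proof -
    have "(\<integral>x. (cmod (g x))\<^sup>2 \<partial>M) \<le> (\<integral>x. real m powr ((p - 2) / 2) * (cmod (u x) powr p / A) / A \<partial>M)"
    proof (rule integral_mono)
      fix x
      have "cmod (f x) \<le> sqrt (real m)" unfolding f S'(3)[symmetric] by (rule sum_pointwise_le[OF S'(2) a])
      then have "cmod (u x) \<le> sqrt (real m)" by (auto simp: u_def)
      then have "cmod (u x) powr (p - 2) \<le> sqrt (real m) powr (p - 2)" using p by (intro powr_mono2) auto
      also have "\<dots> = real m powr ((p - 2) / 2)" by (simp add: powr_half_sqrt[symmetric] powr_powr)
      finally have *: "cmod (u x) powr (p - 2) \<le> real m powr ((p - 2) / 2)" .
      have "(cmod (g x))\<^sup>2 = cmod (u x) powr (p - 2) * (cmod (u x) powr p / A) / A"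
      proof -
        have "(cmod (u x) powr (p - 1))\<^sup>2 = cmod (u x) powr (p - 2) * cmod (u x) powr p"
          by (simp add: power2_eq_square powr_add[symmetric])
        then show ?thesis by (simp add: cg power_divide power2_eq_square[of A])
      qed
      also have "\<dots> \<le> real m powr ((p - 2) / 2) * (cmod (u x) powr p / A) / A"
        using A1 by (intro divide_right_mono mult_right_mono *) auto
      finally show "(cmod (g x))\<^sup>2 \<le> real m powr ((p - 2) / 2) * (cmod (u x) powr p / A) / A" .
    qed (use bg bu p in \<open>auto intro!: integrable_mult_right integrable_divide\<close>)
    also have "\<dots> = real m powr ((p - 2) / 2) / A" using A1 by (simp add: A_def)
    finally have "real m / real N * (\<integral>x. (cmod (g x))\<^sup>2 \<partial>M) \<le> real m / real N * (real m powr ((p - 2) / 2) / A)"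
      by (rule mult_left_mono) simp
    also have "\<dots> = real m powr (p / 2) / (real N * A)"
    proof (cases "m = 0")
      case False
      then have "real m powr 1 * real m powr ((p - 2) / 2) = real m powr (p / 2)"
        unfolding powr_add[symmetric] by (simp add: field_simps)
      then show ?thesis using False by simp
    qed (use p in simp)
    \<comment> \<open>The cardinality of \<open>S\<close> enters here: \<open>m powr (p / 2)\<close>
      is at most a constant times \<open>N\<close>.\<close>
    also have "\<dots> \<le> (2 * real N powr (2 / p)) powr (p / 2) / (real N * A)"
      using m p N A1 by (intro divide_right_mono powr_mono2) auto
    also have "(2 * real N powr (2 / p)) powr (p / 2) = 2 powr (p / 2) * real N"
      using p N by (simp add: powr_mult powr_powr)
    also have "2 powr (p / 2) * real N / (real N * A) = 2 powr (p / 2) / A" using N by simp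
    also have "\<dots> \<le> 1 / 2" using A A1 by (simp add: divide_simps)
    finally show ?thesis .
  qed
  finally show False by simp
qed

end

section \<open>The random selection theorem\<close>

text \<open>The first entry serves \<open>N\<close> below \<open>size_const p\<close>; the second is
  the \<open>p\<close>-th root of the sum of the low and high bounds.\<close>

definition lam_const :: "real \<Rightarrow> real"
  where "lam_const p = max (sqrt (size_const p))
    ((max 1 (low_const p powr (p / 2)) + 2 * 2 powr (p / 2)) powr (1 / p))"

lemma size_const_ge_2: "2 \<le> size_const p"
proof -
  have "2 * 1 * 1 * 1 \<le> 16 * exp 1 * fact (high_exp p) * (20 ^ high_exp p :: real)"
    by (intro mult_mono) (auto simp: one_le_power)
  then show ?thesis by (simp add: size_const_def)
qed

lemma selection_size_bounds:
  assumes "2 < p" "1 \<le> N"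
  defines "m \<equiv> nat \<lceil>real N powr (2 / p)\<rceil>"
  shows "1 \<le> m" "m \<le> N" "real m \<le> 2 * real N powr (2 / p)"
proof -
  have ge1: "1 \<le> real N powr (2 / p)" using assms by (intro ge_one_powr_ge_zero) auto
  have "real N powr (2 / p) \<le> real N powr 1" using assms by (intro powr_mono) auto
  then have le: "real N powr (2 / p) \<le> real N" by simp
  have "1 \<le> \<lceil>real N powr (2 / p)\<rceil>" using ge1 by linarith
  then show "1 \<le> m" unfolding m_def by linarith
  show "m \<le> N" using le by (simp add: m_def nat_le_iff ceiling_le_iff)
  have "real m \<le> real N powr (2 / p) + 1" unfolding m_def using ge1 by linarith
  then show "real m \<le> 2 * real N powr (2 / p)" using ge1 by linarith
qed

lemma selections_eq_nsub: "selections p N = nsub N (nat \<lceil>real N powr (2 / p)\<rceil>)"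
  by (simp add: selections_def nsub_def)

section \<open>From good sets to the norm inequality\<close>

context bounded_system
begin

lemma Lambda_p_bound_of_normalized:
  assumes S: "finite S" and p: "0 < p" and C: "0 \<le> C"
    and norm: "\<And>a. (\<Sum>i\<in>S. (cmod (a i))\<^sup>2) \<le> 1 \<Longrightarrow> Lq_norm p M (\<lambda>x. \<Sum>i\<in>S. a i * \<phi> i x) \<le> C"
  shows "Lambda_p_bound p C M \<phi> S"
  unfolding Lambda_p_bound_def
proof
  fix a :: "nat \<Rightarrow> complex"
  define s where "s = sqrt (\<Sum>i\<in>S. (cmod (a i))\<^sup>2)"
  have s2: "s\<^sup>2 = (\<Sum>i\<in>S. (cmod (a i))\<^sup>2)" by (simp add: s_def sum_nonneg)
  have s0: "0 \<le> s" by (simp add: s_def sum_nonneg)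
  show "Lq_norm p M (\<lambda>x. \<Sum>i\<in>S. a i * \<phi> i x) \<le> C * sqrt (\<Sum>i\<in>S. (cmod (a i))\<^sup>2)"
  proof (cases "s = 0")
    case True
    then have "\<forall>i\<in>S. a i = 0" using s2 S by (simp add: sum_nonneg_eq_0_iff)
    then have "(\<Sum>i\<in>S. a i * \<phi> i x) = 0" for x by simp
    then show ?thesis using True p by (simp add: Lq_norm_def s_def)
  next
    case False
    then have s: "0 < s" using s0 by simp
    define b where "b i = a i / complex_of_real s" for i
    have "(\<Sum>i\<in>S. (cmod (b i))\<^sup>2) = 1"
      using s by (simp add: b_def norm_divide power_divide sum_divide_distrib[symmetric] s2[symmetric])
    then have b: "Lq_norm p M (\<lambda>x. \<Sum>i\<in>S. b i * \<phi> i x) \<le> C" by (intro norm) simp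
    have eq: "cmod (\<Sum>i\<in>S. a i * \<phi> i x) powr p = s powr p * cmod (\<Sum>i\<in>S. b i * \<phi> i x) powr p" for x
    proof -
      have "(\<Sum>i\<in>S. a i * \<phi> i x) = complex_of_real s * (\<Sum>i\<in>S. b i * \<phi> i x)"
        using s by (simp add: b_def sum_distrib_left)
      then show ?thesis using s by (simp add: norm_mult powr_mult)
    qed
    have "Lq_norm p M (\<lambda>x. \<Sum>i\<in>S. a i * \<phi> i x) = s * Lq_norm p M (\<lambda>x. \<Sum>i\<in>S. b i * \<phi> i x)"
      unfolding Lq_norm_def eq using s p by (simp add: powr_mult powr_powr)
    also have "\<dots> \<le> s * C" using b s by (intro mult_left_mono) auto
    finally show ?thesis by (simp add: s_def mult.commute)
  qed
qed

lemma Lambda_p_bound_trivial: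
  assumes S: "finite S" and p: "0 < p" and C: "sqrt (real (card S)) \<le> C"
  shows "Lambda_p_bound p C M \<phi> S"
proof (rule Lambda_p_bound_of_normalized[OF S p])
  show C0: "0 \<le> C" using C real_sqrt_ge_zero[of "real (card S)"] by linarith
  fix a :: "nat \<Rightarrow> complex" assume a: "(\<Sum>i\<in>S. (cmod (a i))\<^sup>2) \<le> 1"
  have "(\<integral>x. cmod (\<Sum>i\<in>S. a i * \<phi> i x) powr p \<partial>M) \<le> (\<integral>x. C powr p \<partial>M)"
    by (rule integral_mono)
      (use p C order_trans[OF sum_pointwise_le[OF S a] C] in \<open>auto intro!: powr_mono2 bfun_cmod_powr_integrable\<close>)
  also have "\<dots> = C powr p" by (simp add: prob_space)
  finally have "(\<integral>x. cmod (\<Sum>i\<in>S. a i * \<phi> i x) powr p \<partial>M) powr (1 / p) \<le> (C powr p) powr (1 / p)"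
    using p by (intro powr_mono2) auto
  then show "Lq_norm p M (\<lambda>x. \<Sum>i\<in>S. a i * \<phi> i x) \<le> C"
    using p C0 by (simp add: Lq_norm_def powr_powr)
qed

text \<open>The low and high parts have disjoint supports, so their \<open>p\<close>-th powers add
  exactly.\<close>

lemma Lambda_p_bound_if_good:
  assumes p: "2 < p" and N: "1 \<le> N" and S: "S \<in> nsub N m" and m: "real m \<le> 2 * real N powr (2 / p)"
    and low: "low_good p N S" and high: "high_good p N m S"
  shows "Lambda_p_bound p (lam_const p) M \<phi> S"
proof -
  have fS: "finite S" using S by (auto simp: nsub_def intro: finite_subset)
  define Q where "Q = max 1 (low_const p powr (p / 2)) + 2 * 2 powr (p / 2)"
  show ?thesis
  proof (rule Lambda_p_bound_of_normalized[OF fS])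
    show "0 < p" using p by simp
    have "0 \<le> Q powr (1 / p)" by simp
    then show "0 \<le> lam_const p" unfolding lam_const_def Q_def[symmetric] by linarith
    fix a :: "nat \<Rightarrow> complex" assume a: "(\<Sum>i\<in>S. (cmod (a i))\<^sup>2) \<le> 1"
    define f where "f x = (\<Sum>i\<in>S. a i * \<phi> i x)" for x
    define u where "u x = (if cmod (f x) \<le> level p N then f x else 0)" for x
    define v where "v x = (if level p N < cmod (f x) then f x else 0)" for x
    have f: "bfun f" by (simp add: f_def[abs_def])
    have u: "bfun u" unfolding u_def by (rule bfun_restrict[OF f]) simp
    have v: "bfun v" unfolding v_def by (rule bfun_restrict[OF f]) simp
    have "cmod (f x) powr p = cmod (u x) powr p + cmod (v x) powr p" for x by (simp add: u_def v_def)
    then have "(\<integral>x. cmod (f x) powr p \<partial>M) = (\<integral>x. cmod (u x) powr p \<partial>M) + (\<integral>x. cmod (v x) powr p \<partial>M)"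
      using u v p by simp
    also have "\<dots> \<le> Q"
      unfolding Q_def u_def v_def
      by (intro add_mono low_part_le[OF p low fS a f_def] high_part_le[OF p N S m high a f_def])
    finally have "(\<integral>x. cmod (f x) powr p \<partial>M) powr (1 / p) \<le> Q powr (1 / p)"
      using p by (intro powr_mono2) auto
    also have "\<dots> \<le> lam_const p" by (simp add: lam_const_def Q_def)
    finally show "Lq_norm p M (\<lambda>x. \<Sum>i\<in>S. a i * \<phi> i x) \<le> lam_const p"
      by (simp add: Lq_norm_def f_def)
  qed
qed

text \<open>Each of the two exceptional families has a share of at most \<open>1 / (2 * N)\<close>.
  Existence is proved alongside, since the count alone says nothing when
  \<open>N = 1\<close>.\<close>

lemma Lambda_p_random:
  assumes p: "2 < p" and N: "1 \<le> N"
  defines "m \<equiv> nat \<lceil>real N powr (2 / p)\<rceil>"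
  shows "real (card {S\<in>nsub N m. \<not> Lambda_p_bound p (lam_const p) M \<phi> S}) \<le> real (N choose m) / real N"
    and "\<exists>S\<in>nsub N m. Lambda_p_bound p (lam_const p) M \<phi> S"
proof -
  note m = selection_size_bounds[OF p N, folded m_def]
  have nz: "0 < N choose m" using m by simp
  have *: "real (card {S\<in>nsub N m. \<not> Lambda_p_bound p (lam_const p) M \<phi> S}) \<le> real (N choose m) / real N \<and>
    (\<exists>S\<in>nsub N m. Lambda_p_bound p (lam_const p) M \<phi> S)"
  proof (cases "size_const p \<le> real N")
    case False
    have all: "Lambda_p_bound p (lam_const p) M \<phi> S" if S: "S \<in> nsub N m" for S
    proof (rule Lambda_p_bound_trivial)
      show "finite S" "0 < p" using S p by (auto simp: nsub_def intro: finite_subset)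
      have "card S = m" using S by (simp add: nsub_def)
      then have "real (card S) \<le> size_const p" using m(2) False by linarith
      then have "sqrt (real (card S)) \<le> sqrt (size_const p)" by simp
      then show "sqrt (real (card S)) \<le> lam_const p" unfolding lam_const_def by linarith
    qed
    moreover have "nsub N m \<noteq> {}" using nz card_nsub[of N m] by force
    ultimately show ?thesis by (auto simp: Collect_empty_eq[THEN iffD2])
  next
    case True
    then have N2: "2 \<le> N" using size_const_ge_2[of p] by linarith
    have sub: "{S\<in>nsub N m. \<not> Lambda_p_bound p (lam_const p) M \<phi> S}
        \<subseteq> {S\<in>nsub N m. \<not> low_good p N S} \<union> {S\<in>nsub N m. \<not> high_good p N m S}"
      using Lambda_p_bound_if_good[OF p N _ m(3)] by blast
    have "card {S\<in>nsub N m. \<not> Lambda_p_bound p (lam_const p) M \<phi> S}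
        \<le> card ({S\<in>nsub N m. \<not> low_good p N S} \<union> {S\<in>nsub N m. \<not> high_good p N m S})"
      by (rule card_mono[OF _ sub]) simp
    also have "\<dots> \<le> card {S\<in>nsub N m. \<not> low_good p N S} + card {S\<in>nsub N m. \<not> high_good p N m S}"
      by (rule card_Un_le)
    finally have "real (card {S\<in>nsub N m. \<not> Lambda_p_bound p (lam_const p) M \<phi> S})
        \<le> real (card {S\<in>nsub N m. \<not> low_good p N S}) + real (card {S\<in>nsub N m. \<not> high_good p N m S})"
      by linarith
    also have "\<dots> \<le> real (N choose m) / (2 * real N) + real (N choose m) / (2 * real N)"
      by (intro add_mono low_bad_card_le high_bad_card_le p N2 m True)
    also have "\<dots> = real (N choose m) / real N" by (simp add: field_simps)
    finally have bad: "real (card {S\<in>nsub N m. \<not> Lambda_p_bound p (lam_const p) M \<phi> S}) \<le> real (N choose m) / real N" .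
    moreover have "\<exists>S\<in>nsub N m. Lambda_p_bound p (lam_const p) M \<phi> S"
    proof (rule ccontr)
      assume "\<not> ?thesis"
      then have "{S\<in>nsub N m. \<not> Lambda_p_bound p (lam_const p) M \<phi> S} = nsub N m" by blast
      then have "real (N choose m) \<le> real (N choose m) / real N" using bad by (simp add: card_nsub)
      then show False using nz N2 by (simp add: pos_le_divide_eq)
    qed
    ultimately show ?thesis by blast
  qed
  then show "real (card {S\<in>nsub N m. \<not> Lambda_p_bound p (lam_const p) M \<phi> S}) \<le> real (N choose m) / real N"
    "\<exists>S\<in>nsub N m. Lambda_p_bound p (lam_const p) M \<phi> S" by auto
qed

end

text \<open>The assertion inside \<open>Lambda_const\<close>, named so that it can be moved between
  probability spaces.\<close>

definition Lambda_p_conclusion :: "real \<Rightarrow> real \<Rightarrow> 'a measure \<Rightarrow> nat \<Rightarrow> (nat \<Rightarrow> 'a \<Rightarrow> complex) \<Rightarrow> bool"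
  where "Lambda_p_conclusion p C M N \<phi> \<longleftrightarrow> (\<exists>S\<in>selections p N. Lambda_p_bound p C M \<phi> S) \<and>
    (2 \<le> N \<longrightarrow> measure_pmf.prob (pmf_of_set (selections p N)) {S. Lambda_p_bound p C M \<phi> S} \<ge> 1 - 1 / real N)"

lemma Lambda_p_conclusion_cong:
  assumes p: "2 < p" and N: "1 \<le> N"
    and eq: "\<And>S. S \<subseteq> {1..N} \<Longrightarrow> Lambda_p_bound p C M \<phi> S \<longleftrightarrow> Lambda_p_bound p C M' \<phi>' S"
  shows "Lambda_p_conclusion p C M N \<phi> \<longleftrightarrow> Lambda_p_conclusion p C M' N \<phi>'"
proof -
  define m where "m = nat \<lceil>real N powr (2 / p)\<rceil>"
  note m = selection_size_bounds[OF p N, folded m_def]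
  have sel: "selections p N = nsub N m" by (simp add: selections_eq_nsub m_def)
  have ne: "nsub N m \<noteq> {}" using m card_nsub[of N m] by force
  have eq': "Lambda_p_bound p C M \<phi> S \<longleftrightarrow> Lambda_p_bound p C M' \<phi>' S" if "S \<in> nsub N m" for S
    using that eq by (simp add: nsub_def)
  have "nsub N m \<inter> {S. Lambda_p_bound p C M \<phi> S} = nsub N m \<inter> {S. Lambda_p_bound p C M' \<phi>' S}"
    using eq' by blast
  then show ?thesis
    unfolding Lambda_p_conclusion_def sel using eq' ne by (simp add: measure_pmf_of_set)
qed

lemma (in bounded_system) Lambda_p_conclusion_holds:
  assumes p: "2 < p" and N: "1 \<le> N"
  shows "Lambda_p_conclusion p (lam_const p) M N \<phi>"
proof -
  define m where "m = nat \<lceil>real N powr (2 / p)\<rceil>"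
  note m = selection_size_bounds[OF p N, folded m_def]
  note rand = Lambda_p_random[OF p N, folded m_def]
  have sel: "selections p N = nsub N m" by (simp add: selections_eq_nsub m_def)
  have nz: "0 < N choose m" using m by simp
  then have ne: "nsub N m \<noteq> {}" using card_nsub[of N m] by force
  define G where "G = nsub N m \<inter> {S. Lambda_p_bound p (lam_const p) M \<phi> S}"
  have "G = nsub N m - {S\<in>nsub N m. \<not> Lambda_p_bound p (lam_const p) M \<phi> S}" by (auto simp: G_def)
  then have "card G = card (nsub N m) - card {S\<in>nsub N m. \<not> Lambda_p_bound p (lam_const p) M \<phi> S}"
    by (simp add: card_Diff_subset)
  then have "real (N choose m) - real (N choose m) / real N \<le> real (card G)"
    using rand(1) unfolding card_nsub by linarith
  then have "real (N choose m) * (1 - 1 / real N) \<le> real (card G)" by (simp add: algebra_simps)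
  then have "1 - 1 / real N \<le> real (card G) / real (N choose m)"
    using nz by (simp add: pos_le_divide_eq mult.commute)
  also have "\<dots> = measure_pmf.prob (pmf_of_set (nsub N m)) {S. Lambda_p_bound p (lam_const p) M \<phi> S}"
    using ne by (simp add: measure_pmf_of_set G_def card_nsub)
  finally show ?thesis using rand(2) unfolding Lambda_p_conclusion_def sel by blast
qed

section \<open>Transfer to essentially bounded systems and to arbitrary types\<close>

lemma Linf_norm_le_1_AE:
  assumes "Linf_norm M h \<le> 1"
  shows "AE x in M. cmod (h x) \<le> 1"
proof -
  have "AE x in M. ereal (cmod (h x)) \<le> Linf_norm M h"
    unfolding Linf_norm_def by (rule esssup_AE)
  then show ?thesis
  proof eventually_elim
    case (elim x)
    then have "ereal (cmod (h x)) \<le> 1" using assms by (rule order_trans)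
    then show ?case by simp
  qed
qed

text \<open>\<open>\<psi>\<close> agrees with \<open>\<phi>\<close> almost everywhere on the index
  range, so the norms are unchanged, and its zero entries elsewhere preserve orthogonality.\<close>

lemma Lambda_p_conclusion_bounded_orthogonal:
  assumes p: "2 < p" and N: "1 \<le> N" and M: "prob_space M" and sys: "bounded_orthogonal_system M N \<phi>"
  shows "Lambda_p_conclusion p (lam_const p) M N \<phi>"
proof -
  define \<psi> where "\<psi> i x = (if i \<in> {1..N} \<and> cmod (\<phi> i x) \<le> 1 then \<phi> i x else 0)" for i x
  have meas [measurable]: "\<phi> i \<in> borel_measurable M" if "i \<in> {1..N}" for i
    using sys that by (simp add: bounded_orthogonal_system_def)
  have bound: "AE x in M. cmod (\<phi> i x) \<le> 1" if "i \<in> {1..N}" for i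
    using sys that by (intro Linf_norm_le_1_AE) (simp add: bounded_orthogonal_system_def)
  have psi_meas [measurable]: "\<psi> i \<in> borel_measurable M" for i
  proof (cases "i \<in> {1..N}")
    case True
    note [measurable] = meas[OF True]
    show ?thesis unfolding \<psi>_def[abs_def] using True by simp
  next
    case False
    then have "\<psi> i = (\<lambda>x. 0)" by (auto simp: \<psi>_def)
    then show ?thesis by simp
  qed
  have psi_eq: "AE x in M. \<psi> i x = \<phi> i x" if "i \<in> {1..N}" for i
    using bound[OF that] by eventually_elim (use that in \<open>simp add: \<psi>_def\<close>)
  have orth: "(\<integral>x. \<psi> i x * cnj (\<psi> j x) \<partial>M) = 0" if ij: "i \<noteq> j" for i j
  proof (cases "i \<in> {1..N} \<and> j \<in> {1..N}")
    case True
    note [measurable] = meas[of i] meas[of j]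
    have "(\<integral>x. \<psi> i x * cnj (\<psi> j x) \<partial>M) = (\<integral>x. \<phi> i x * cnj (\<phi> j x) \<partial>M)"
    proof (rule integral_cong_AE)
      have cnj_meas: "cnj \<in> borel_measurable borel"
        by (rule borel_measurable_continuous_onI) (intro continuous_intros)
      have "(\<lambda>x. cnj (\<phi> j x)) \<in> borel_measurable M" "(\<lambda>x. cnj (\<psi> j x)) \<in> borel_measurable M"
        using True by (auto intro!: measurable_compose[OF _ cnj_meas])
      then show "(\<lambda>x. \<psi> i x * cnj (\<psi> j x)) \<in> borel_measurable M" "(\<lambda>x. \<phi> i x * cnj (\<phi> j x)) \<in> borel_measurable M"
        using True by (auto intro!: borel_measurable_times)
      show "AE x in M. \<psi> i x * cnj (\<psi> j x) = \<phi> i x * cnj (\<phi> j x)"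
        using psi_eq[OF conjunct1[OF True]] psi_eq[OF conjunct2[OF True]] by eventually_elim simp
    qed
    then show ?thesis using sys ij True by (simp add: bounded_orthogonal_system_def)
  next
    case False
    then have "(\<lambda>x. \<psi> i x * cnj (\<psi> j x)) = (\<lambda>x. 0)" by (auto simp: \<psi>_def)
    then show ?thesis by simp
  qed
  interpret bounded_system M \<psi>
  proof (intro bounded_system.intro M bounded_system_axioms.intro)
    show "cmod (\<psi> i x) \<le> 1" for i x by (simp add: \<psi>_def)
  qed (use orth in auto)
  have "Lambda_p_bound p C M \<phi> S \<longleftrightarrow> Lambda_p_bound p C M \<psi> S" if S: "S \<subseteq> {1..N}" for C S
  proof -
    have fS: "finite S" using S by (rule finite_subset) simp
    have "Lq_norm p M (\<lambda>x. \<Sum>i\<in>S. a i * \<phi> i x) = Lq_norm p M (\<lambda>x. \<Sum>i\<in>S. a i * \<psi> i x)" for a :: "nat \<Rightarrow> complex"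
    proof -
      have "AE x in M. \<forall>i\<in>S. \<psi> i x = \<phi> i x"
        using psi_eq S by (intro AE_finite_allI[OF fS]) auto
      then have "AE x in M. cmod (\<Sum>i\<in>S. a i * \<phi> i x) powr p = cmod (\<Sum>i\<in>S. a i * \<psi> i x) powr p"
        by eventually_elim simp
      moreover have "(\<lambda>x. \<Sum>i\<in>S. a i * \<phi> i x) \<in> borel_measurable M"
        using S by (intro borel_measurable_sum borel_measurable_times meas) auto
      ultimately show ?thesis
        unfolding Lq_norm_def by (intro arg_cong[where f = "\<lambda>t. t powr (1 / p)"] integral_cong_AE) auto
    qed
    then show ?thesis by (simp add: Lambda_p_bound_def)
  qed
  from Lambda_p_conclusion_cong[OF p N this] Lambda_p_conclusion_holds[OF p N] show ?thesis by simp
qed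

text \<open>\<open>lam_const p\<close> is a witness for the choice that defines
  \<open>Lambda_const p\<close>.\<close>

lemma Lambda_p_conclusion_Lambda_const_sequences:
  fixes M :: "(nat \<Rightarrow> complex) measure"
  assumes p: "2 < p" and "1 \<le> N" "prob_space M" "bounded_orthogonal_system M N \<phi>"
  shows "Lambda_p_conclusion p (Lambda_const p) M N \<phi>"
proof -
  let ?P = "\<lambda>C. \<forall>(M :: (nat \<Rightarrow> complex) measure) N \<phi>. prob_space M \<longrightarrow> 1 \<le> N \<longrightarrow>
    bounded_orthogonal_system M N \<phi> \<longrightarrow> Lambda_p_conclusion p C M N \<phi>"
  have "?P (lam_const p)" using Lambda_p_conclusion_bounded_orthogonal[OF p] by blast
  then have "?P (SOME C. ?P C)" by (rule someI)
  moreover have "(SOME C. ?P C) = Lambda_const p"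
    by (simp only: Lambda_const_def Lambda_p_conclusion_def)
  ultimately show ?thesis using assms by simp
qed

text \<open>The law of the sequence \<open>\<phi>\<close> is a probability measure on
  \<open>nat \<Rightarrow> complex\<close> whose coordinate functions form a system with the same
  integrals. The constant fixed for that type therefore works for every type.\<close>

lemma Lambda_p_conclusion_Lambda_const:
  assumes p: "2 < p" and N: "1 \<le> N" and M: "prob_space M" and sys: "bounded_orthogonal_system M N \<phi>"
  shows "Lambda_p_conclusion p (Lambda_const p) M N \<phi>"
proof -
  define Q where "Q = (\<Pi>\<^sub>M i\<in>(UNIV :: nat set). (borel :: complex measure))"
  define X where "X x = (\<lambda>i. if i \<in> {1..N} then \<phi> i x else 0)" for x
  define e where "e i \<omega> = (\<omega> i :: complex)" for i :: nat and \<omega>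
  have meas: "\<phi> i \<in> borel_measurable M" if "i \<in> {1..N}" for i
    using sys that by (simp add: bounded_orthogonal_system_def)
  have X [measurable]: "X \<in> M \<rightarrow>\<^sub>M Q"
    unfolding X_def[abs_def] Q_def
  proof (rule measurable_PiM_single')
    show "(\<lambda>x. if i \<in> {1..N} then \<phi> i x else 0) \<in> borel_measurable M" for i
      using meas[of i] by (cases "i \<in> {1..N}") auto
  qed simp
  have e_meas [measurable]: "e i \<in> borel_measurable Q" for i
    unfolding e_def[abs_def] Q_def by (rule measurable_component_singleton) simp
  have eX: "e i (X x) = \<phi> i x" if "i \<in> {1..N}" for i x using that by (simp add: e_def X_def)
  have cnj_meas: "cnj \<in> borel_measurable borel"
    by (rule borel_measurable_continuous_onI) (intro continuous_intros)
  have cnj_e [measurable]: "(\<lambda>\<omega>. cnj (e i \<omega>)) \<in> borel_measurable Q" for i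
    by (rule measurable_compose[OF e_meas cnj_meas])
  have prob: "prob_space (distr M Q X)" by (rule prob_space.prob_space_distr[OF M X])
  have "bounded_orthogonal_system (distr M Q X) N e"
    unfolding bounded_orthogonal_system_def
  proof (intro conjI ballI impI)
    fix i assume i: "i \<in> {1..N}"
    show "e i \<in> borel_measurable (distr M Q X)" by simp
    have "AE x in M. cmod (\<phi> i x) \<le> 1"
      using sys i by (intro Linf_norm_le_1_AE) (simp add: bounded_orthogonal_system_def)
    then have "AE \<omega> in distr M Q X. ereal (cmod (e i \<omega>)) \<le> 1"
      by (subst AE_distr_iff[OF X]) (use i in \<open>auto simp: eX\<close>)
    then show "Linf_norm (distr M Q X) (e i) \<le> 1"
      unfolding Linf_norm_def by (intro esssup_I) auto
  next
    fix i j assume ij: "i \<in> {1..N}" "j \<in> {1..N}" "i \<noteq> j"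
    have "(\<integral>\<omega>. e i \<omega> * cnj (e j \<omega>) \<partial>distr M Q X) = (\<integral>x. e i (X x) * cnj (e j (X x)) \<partial>M)"
      by (rule integral_distr[OF X]) simp
    also have "\<dots> = 0" using ij sys by (simp add: eX bounded_orthogonal_system_def)
    finally show "(\<integral>\<omega>. e i \<omega> * cnj (e j \<omega>) \<partial>distr M Q X) = 0" .
  qed
  then have "Lambda_p_conclusion p (Lambda_const p) (distr M Q X) N e"
    by (rule Lambda_p_conclusion_Lambda_const_sequences[OF p N prob])
  then show ?thesis
  proof (rule Lambda_p_conclusion_cong[OF p N, THEN iffD1, rotated])
    fix S assume S: "S \<subseteq> {1..N}"
    show "Lambda_p_bound p (Lambda_const p) (distr M Q X) e S \<longleftrightarrow> Lambda_p_bound p (Lambda_const p) M \<phi> S"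
    proof -
      have "Lq_norm p (distr M Q X) (\<lambda>\<omega>. \<Sum>i\<in>S. a i * e i \<omega>) = Lq_norm p M (\<lambda>x. \<Sum>i\<in>S. a i * \<phi> i x)" for a :: "nat \<Rightarrow> complex"
      proof -
        have "(\<integral>\<omega>. cmod (\<Sum>i\<in>S. a i * e i \<omega>) powr p \<partial>distr M Q X) = (\<integral>x. cmod (\<Sum>i\<in>S. a i * e i (X x)) powr p \<partial>M)"
          by (rule integral_distr[OF X]) simp
        moreover have "(\<Sum>i\<in>S. a i * e i (X x)) = (\<Sum>i\<in>S. a i * \<phi> i x)" for x
          using S by (intro sum.cong) (auto simp: eX)
        ultimately show ?thesis by (simp add: Lq_norm_def)
      qed
      then show ?thesis by (simp add: Lambda_p_bound_def)
    qed
  qed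
qed

theorem theorem1p1:
  fixes p :: real and N :: nat and M :: "'a measure" and \<phi> :: "nat \<Rightarrow> 'a \<Rightarrow> complex"
  assumes "2 < p"
    and "1 \<le> N"
    and "prob_space M"
    and "bounded_orthogonal_system M N \<phi>"
  shows "(\<exists>S. S \<subseteq> {1..N} \<and> card S = nat \<lceil>real N powr (2 / p)\<rceil> \<and>
            Lambda_p_bound p (Lambda_const p) M \<phi> S) \<and>
         (2 \<le> N \<longrightarrow>
            measure_pmf.prob
              (pmf_of_set {S. S \<subseteq> {1..N} \<and> card S = nat \<lceil>real N powr (2 / p)\<rceil>})
              {S. Lambda_p_bound p (Lambda_const p) M \<phi> S} \<ge> 1 - 1 / real N)"
  using Lambda_p_conclusion_Lambda_const[OF assms]
  unfolding Lambda_p_conclusion_def selections_def by blast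

end
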